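(* Let $X$ and $A$ be second countable compact Hausdorff spaces and $H$ a separable Hilbert space. Let $E=(E(\cdot|x))_{x\in X}$ be an operator-valued (resp. projection-valued) information channel from $X$ to $A$ with values in $\mathcal{B}(H)$, and write $E_x=E(\cdot|x)$. Then the map $\Phi_E : C(A)\to\mathfrak{B}(X;H)$ given by $$\Phi_E(f)(x)=\phi_{E_x}(f),\qquad f\in C(A),\ x\in X,$$ is well-defined, unital and completely positive (resp. a well-defined unital $*$-homomorphism). Conversely, if $\Phi:C(A)\to\mathfrak{B}(X;H)$ is a unital completely positive map (resp. a unital $*$-homomorphism), then there exists an operator-valued (resp. projection-valued) information channel $E$ from $X$ to $A$ with values in $\mathcal{B}(H)$ such that $\Phi=\Phi_E$.
   Context: A quantum probability measure (QPM) on a compact Hausdorff space $A$ with values in $\mathcal{B}(H)$ is a map $E:\mathfrak{A}_A\to\mathcal{B}(H)^+$ on the Borel $\sigma$-algebra $\mathfrak{A}_A$ with $E(A)=I_H$ that is countably additive on disjoint sequences of Borel sets in the weak* topology; it is a spectral measure if each $E(\alpha)$ is a projection. For a QPM $E$ and $\xi,\eta\in H$ put $E_{\xi,\eta}(\alpha)=\langle E(\alpha)\xi,\eta\rangle$; $\phi_E:C(A)\to\mathcal{B}(H)$ denotes the unital completely positive map determined by $\langle\phi_E(f)\xi,\eta\rangle=\int_A f\,dE_{\xi,\eta}$. A function $F:X\to\mathcal{B}(H)$ is weakly measurable if $x\mapsto\langle F(x)\xi,\eta\rangle$ is Borel for all $\xi,\eta\in H$. An operator-valued information channel from $X$ to $A$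 with values in $\mathcal{B}(H)$ is a family $E=(E(\cdot|x))_{x\in X}$ of QPM's on $A$ with values in $\mathcal{B}(H)$ such that for every $\alpha\in\mathfrak{A}_A$ the function $x\mapsto E(\alpha|x)$ is weakly measurable; it is projection-valued if each $E(\cdot|x)$ is a spectral measure. $\mathfrak{B}(X;H)$ is the space of all bounded weakly measurable functions $F:X\to\mathcal{B}(H)$; for separable $H$ it is a unital C*-algebra under pointwise operations, pointwise adjoint, and norm $\|F\|=\sup_{x\in X}\|F(x)\|$. *)

theory Defs
  imports "HOL-Analysis.Analysis"
begin

text \<open>Complex Hilbert spaces are built on top of the real ones of the library, so that norm,
  topology and completeness are the library's; the inner product is linear in its first argument.\<close>

class complex_inner = real_inner +
  fixes scaleC :: "complex \<Rightarrow> 'a \<Rightarrow> 'a"  (infixr \<open>*\<^sub>C\<close> 75)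
    and cinner :: "'a \<Rightarrow> 'a \<Rightarrow> complex"
  assumes scaleC_add_right: "c *\<^sub>C (x + y) = c *\<^sub>C x + c *\<^sub>C y"
    and scaleC_add_left: "(c + d) *\<^sub>C x = c *\<^sub>C x + d *\<^sub>C x"
    and scaleC_scaleC: "c *\<^sub>C d *\<^sub>C x = (c * d) *\<^sub>C x"
    and scaleC_of_real: "complex_of_real r *\<^sub>C x = r *\<^sub>R x"
    and cinner_commute: "cinner x y = cnj (cinner y x)"
    and cinner_add_left: "cinner (x + y) z = cinner x z + cinner y z"
    and cinner_scaleC_left: "cinner (c *\<^sub>C x) y = c * cinner x y"
    and inner_eq_Re_cinner: "x \<bullet> y = Re (cinner x y)"

class chilbert_space = complex_inner + complete_space

text \<open>\<open>B(H)\<close>: the complex-linear elements of the library's space of bounded real-linear maps.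
  The norm of that type is the operator norm.\<close>

definition bops :: "('h::chilbert_space \<Rightarrow>\<^sub>L 'h) set" where
  "bops = {T. \<forall>c \<xi>. blinfun_apply T (c *\<^sub>C \<xi>) = c *\<^sub>C blinfun_apply T \<xi>}"

definition cadjoint :: "('h::chilbert_space \<Rightarrow>\<^sub>L 'h) \<Rightarrow> 'h \<Rightarrow>\<^sub>L 'h" where
  "cadjoint T = (THE S. S \<in> bops \<and>
     (\<forall>\<xi> \<eta>. cinner (blinfun_apply T \<xi>) \<eta> = cinner \<xi> (blinfun_apply S \<eta>)))"

definition positive_op :: "('h::chilbert_space \<Rightarrow>\<^sub>L 'h) \<Rightarrow> bool" where
  "positive_op T \<longleftrightarrow> T \<in> bops \<and> (\<forall>\<xi>. cinner (blinfun_apply T \<xi>) \<xi> \<in> \<real>\<^sub>\<ge>\<^sub>0)"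

definition projection_op :: "('h::chilbert_space \<Rightarrow>\<^sub>L 'h) \<Rightarrow> bool" where
  "projection_op P \<longleftrightarrow> P \<in> bops \<and> P o\<^sub>L P = P \<and> cadjoint P = P"

text \<open>The weak* topology on \<open>B(H)\<close> is the one induced by the normal functionals
  \<open>T \<mapsto> \<Sum>\<^sub>k \<langle>T \<xi>\<^sub>k, \<eta>\<^sub>k\<rangle>\<close> with \<open>\<Sum>\<^sub>k \<parallel>\<xi>\<^sub>k\<parallel>\<^sup>2\<close> and
  \<open>\<Sum>\<^sub>k \<parallel>\<eta>\<^sub>k\<parallel>\<^sup>2\<close> finite.\<close>

definition weak_star_tendsto ::
    "('i \<Rightarrow> ('h::chilbert_space \<Rightarrow>\<^sub>L 'h)) \<Rightarrow> ('h \<Rightarrow>\<^sub>L 'h) \<Rightarrow> 'i filter \<Rightarrow> bool" where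
  "weak_star_tendsto T L F \<longleftrightarrow>
     (\<forall>\<xi> \<eta> :: nat \<Rightarrow> 'h.
        summable (\<lambda>k. (norm (\<xi> k))\<^sup>2) \<longrightarrow> summable (\<lambda>k. (norm (\<eta> k))\<^sup>2) \<longrightarrow>
        ((\<lambda>i. \<Sum>k. cinner (blinfun_apply (T i) (\<xi> k)) (\<eta> k)) \<longlongrightarrow>
           (\<Sum>k. cinner (blinfun_apply L (\<xi> k)) (\<eta> k))) F)"

definition qpm :: "('a::topological_space set \<Rightarrow> ('h::chilbert_space \<Rightarrow>\<^sub>L 'h)) \<Rightarrow> bool" where
  "qpm E \<longleftrightarrow>
     (\<forall>\<alpha>\<in>sets borel. positive_op (E \<alpha>)) \<and>
     E UNIV = id_blinfun \<and>
     (\<forall>\<alpha> :: nat \<Rightarrow> 'a set. range \<alpha> \<subseteq> sets borel \<longrightarrow> disjoint_family \<alpha> \<longrightarrow>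
        weak_star_tendsto (\<lambda>N. \<Sum>n<N. E (\<alpha> n)) (E (\<Union>n. \<alpha> n)) sequentially)"

definition spectral_measure ::
    "('a::topological_space set \<Rightarrow> ('h::chilbert_space \<Rightarrow>\<^sub>L 'h)) \<Rightarrow> bool" where
  "spectral_measure E \<longleftrightarrow> qpm E \<and> (\<forall>\<alpha>\<in>sets borel. projection_op (E \<alpha>))"

definition qpm_coeff ::
    "('a set \<Rightarrow> ('h::chilbert_space \<Rightarrow>\<^sub>L 'h)) \<Rightarrow> 'h \<Rightarrow> 'h \<Rightarrow> 'a set \<Rightarrow> complex" where
  "qpm_coeff E \<xi> \<eta> \<alpha> = cinner (blinfun_apply (E \<alpha>) \<xi>) \<eta>"

text \<open>\<open>\<integral> f d\<mu> = I\<close> for a complex Borel measure \<open>\<mu>\<close>: write \<open>\<mu>\<close> as a combination of four finite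
  positive measures and integrate against each of them. The value does not depend on the
  decomposition.\<close>

definition has_cmeasure_integral ::
    "('a::topological_space set \<Rightarrow> complex) \<Rightarrow> ('a \<Rightarrow> complex) \<Rightarrow> complex \<Rightarrow> bool" where
  "has_cmeasure_integral \<mu> f I \<longleftrightarrow>
     (\<exists>m1 m2 m3 m4 :: 'a measure.
        (\<forall>m\<in>{m1, m2, m3, m4}. finite_measure m \<and> sets m = sets borel \<and> integrable m f) \<and>
        (\<forall>\<alpha>\<in>sets borel. \<mu> \<alpha> =
           complex_of_real (measure m1 \<alpha> - measure m2 \<alpha>)
           + \<i> * complex_of_real (measure m3 \<alpha> - measure m4 \<alpha>)) \<and>
        I = (integral\<^sup>L m1 f - integral\<^sup>L m2 f) + \<i> * (integral\<^sup>L m3 f - integral\<^sup>L m4 f))"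

definition has_qpm_integral ::
    "('a::topological_space set \<Rightarrow> ('h::chilbert_space \<Rightarrow>\<^sub>L 'h)) \<Rightarrow> ('a \<Rightarrow> complex)
      \<Rightarrow> ('h \<Rightarrow>\<^sub>L 'h) \<Rightarrow> bool" where
  "has_qpm_integral E f T \<longleftrightarrow> T \<in> bops \<and>
     (\<forall>\<xi> \<eta>. has_cmeasure_integral (qpm_coeff E \<xi> \<eta>) f (cinner (blinfun_apply T \<xi>) \<eta>))"

definition qpm_map ::
    "('a::topological_space set \<Rightarrow> ('h::chilbert_space \<Rightarrow>\<^sub>L 'h)) \<Rightarrow> ('a \<Rightarrow> complex) \<Rightarrow> 'h \<Rightarrow>\<^sub>L 'h" where
  "qpm_map E f = (THE T. has_qpm_integral E f T)"

definition weakly_measurable ::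
    "('x::topological_space \<Rightarrow> ('h::chilbert_space \<Rightarrow>\<^sub>L 'h)) \<Rightarrow> bool" where
  "weakly_measurable F \<longleftrightarrow>
     (\<forall>\<xi> \<eta>. (\<lambda>x. cinner (blinfun_apply (F x) \<xi>) \<eta>) \<in> borel_measurable borel)"

text \<open>A channel is curried: \<open>E x \<alpha>\<close> stands for \<open>E(\<alpha>|x)\<close>.\<close>

definition info_channel ::
    "('x::topological_space \<Rightarrow> 'a::topological_space set \<Rightarrow> ('h::chilbert_space \<Rightarrow>\<^sub>L 'h)) \<Rightarrow> bool" where
  "info_channel E \<longleftrightarrow>
     (\<forall>x. qpm (E x)) \<and> (\<forall>\<alpha>\<in>sets borel. weakly_measurable (\<lambda>x. E x \<alpha>))"

definition projection_valued ::
    "('x::topological_space \<Rightarrow> 'a::topological_space set \<Rightarrow> ('h::chilbert_space \<Rightarrow>\<^sub>L 'h)) \<Rightarrow> bool" where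
  "projection_valued E \<longleftrightarrow> (\<forall>x. spectral_measure (E x))"

definition channel_map ::
    "('x \<Rightarrow> 'a::topological_space set \<Rightarrow> ('h::chilbert_space \<Rightarrow>\<^sub>L 'h)) \<Rightarrow>
     ('a \<Rightarrow> complex) \<Rightarrow> 'x \<Rightarrow> 'h \<Rightarrow>\<^sub>L 'h" where
  "channel_map E f x = qpm_map (E x) f"

definition cfuns :: "('a::topological_space \<Rightarrow> complex) set" where
  "cfuns = {f. continuous_on UNIV f}"

definition wmfuns :: "('x::topological_space \<Rightarrow> ('h::chilbert_space \<Rightarrow>\<^sub>L 'h)) set" where
  "wmfuns = {F. (\<forall>x. F x \<in> bops) \<and> bounded (range F) \<and> weakly_measurable F}"

text \<open>In what follows, a map from \<open>cfuns\<close> to \<open>wmfuns\<close> is a total function of which only the values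
  on \<open>cfuns\<close> matter.\<close>

definition unital_map ::
    "(('a::topological_space \<Rightarrow> complex) \<Rightarrow> 'x::topological_space \<Rightarrow> ('h::chilbert_space \<Rightarrow>\<^sub>L 'h)) \<Rightarrow> bool" where
  "unital_map \<Phi> \<longleftrightarrow> (\<forall>x. \<Phi> (\<lambda>_. 1) x = id_blinfun)"

definition clinear_map ::
    "(('a::topological_space \<Rightarrow> complex) \<Rightarrow> 'x::topological_space \<Rightarrow> ('h::chilbert_space \<Rightarrow>\<^sub>L 'h)) \<Rightarrow> bool" where
  "clinear_map \<Phi> \<longleftrightarrow>
     (\<forall>f\<in>cfuns. \<Phi> f \<in> wmfuns) \<and>
     (\<forall>f\<in>cfuns. \<forall>g\<in>cfuns. \<forall>x. \<Phi> (\<lambda>a. f a + g a) x = \<Phi> f x + \<Phi> g x) \<and>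
     (\<forall>c. \<forall>f\<in>cfuns. \<forall>x \<xi>.
        blinfun_apply (\<Phi> (\<lambda>a. c * f a) x) \<xi> = c *\<^sub>C blinfun_apply (\<Phi> f x) \<xi>)"

text \<open>An element of the C*-algebra of \<open>n \<times> n\<close> matrices over \<open>cfuns\<close>, respectively \<open>wmfuns\<close>, is
  positive iff it is of the form \<open>G* G\<close> for such a matrix \<open>G\<close>. Matrices are indexed by \<open>{..<n}\<close>.\<close>

definition cfuns_mat_positive :: "nat \<Rightarrow> (nat \<Rightarrow> nat \<Rightarrow> 'a::topological_space \<Rightarrow> complex) \<Rightarrow> bool" where
  "cfuns_mat_positive n M \<longleftrightarrow>
     (\<exists>G. (\<forall>i<n. \<forall>j<n. G i j \<in> cfuns) \<and>
        (\<forall>i<n. \<forall>j<n. M i j = (\<lambda>a. \<Sum>k<n. cnj (G k i a) * G k j a)))"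

definition wmfuns_mat_positive ::
    "nat \<Rightarrow> (nat \<Rightarrow> nat \<Rightarrow> 'x::topological_space \<Rightarrow> ('h::chilbert_space \<Rightarrow>\<^sub>L 'h)) \<Rightarrow> bool" where
  "wmfuns_mat_positive n M \<longleftrightarrow>
     (\<exists>G. (\<forall>i<n. \<forall>j<n. G i j \<in> wmfuns) \<and>
        (\<forall>i<n. \<forall>j<n. M i j = (\<lambda>x. \<Sum>k<n. cadjoint (G k i x) o\<^sub>L G k j x)))"

definition completely_positive ::
    "(('a::topological_space \<Rightarrow> complex) \<Rightarrow> 'x::topological_space \<Rightarrow> ('h::chilbert_space \<Rightarrow>\<^sub>L 'h)) \<Rightarrow> bool" where
  "completely_positive \<Phi> \<longleftrightarrow> clinear_map \<Phi> \<and>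
     (\<forall>n M. cfuns_mat_positive n M \<longrightarrow> wmfuns_mat_positive n (\<lambda>i j. \<Phi> (M i j)))"

definition star_hom ::
    "(('a::topological_space \<Rightarrow> complex) \<Rightarrow> 'x::topological_space \<Rightarrow> ('h::chilbert_space \<Rightarrow>\<^sub>L 'h)) \<Rightarrow> bool" where
  "star_hom \<Phi> \<longleftrightarrow> clinear_map \<Phi> \<and>
     (\<forall>f\<in>cfuns. \<forall>g\<in>cfuns. \<forall>x. \<Phi> (\<lambda>a. f a * g a) x = \<Phi> f x o\<^sub>L \<Phi> g x) \<and>
     (\<forall>f\<in>cfuns. \<forall>x. \<Phi> (\<lambda>a. cnj (f a)) x = cadjoint (\<Phi> f x))"

text \<open>Each value \<open>\<Phi>\<^sub>E(f)(x)\<close> exists and is unique, and \<open>\<Phi>\<^sub>E(f)\<close> lies in the target space.\<close>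

definition channel_map_well_defined ::
    "('x::topological_space \<Rightarrow> 'a::topological_space set \<Rightarrow> ('h::chilbert_space \<Rightarrow>\<^sub>L 'h)) \<Rightarrow> bool" where
  "channel_map_well_defined E \<longleftrightarrow>
     (\<forall>f\<in>cfuns. (\<forall>x. \<exists>!T. has_qpm_integral (E x) f T) \<and> channel_map E f \<in> wmfuns)"

end

(* For a channel E, each Phi_E(f)(x) is the norm limit of Riemann sums over the atoms of finite
   subalgebras generated by a countable base of A; linearity, adjoints and, for spectral measures,
   multiplicativity pass from the sums to the limit. Complete positivity asks for a weakly measurable
   square root of a positive operator matrix; the iteration Y := (B + Y^2) / 2 converges in norm, and
   products of weakly measurable functions are weakly measurable because H is separable.

   Conversely, Riesz-Markov turns f |-> <Phi(f)(x) xi, xi> into a measure for every x and xi, and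
   polarization turns these measures into the coefficients of operators E(alpha|x). Sesquilinearity
   and measurability in x hold for sets {f > 0} with f continuous, as limits, and extend to all Borel
   sets by a Dynkin argument; so does E(alpha) E(beta) = E(alpha Int beta) in the multiplicative case. *)

theory Submission
  imports Defs
begin


subsection \<open>Complex inner products\<close>

text \<open>Positivity in the matrices over \<open>wmfuns\<close> asks for a factor \<open>G\<close>
  that is again weakly measurable, so a square root chosen separately at each x would not do. The
  iteration applies one recipe with a scaling constant uniform in x. For the same reason the
  partitions and tags of the Riemann sums are fixed once for the space \<open>A\<close>. Estimates
  are made on the diagonal, where the coefficients of a QPM are positive measures of total mass
  \<open>(norm z)\<^sup>2\<close>. Bounds uniform in z become operator norm bounds by polarization,
  at the price of a factor 2. The sets {f > 0} suit the converse because min 1 (k f) is continuous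
  and increases to their indicator: statements about the operators \<Phi>(f)(x) reach them by
  dominated convergence. They are stable under intersection, and by Urysohn and Lindelof each open
  set is a countable union of them. This matters since polarizing the Riesz-Markov measures defines
  a function of two vectors that is not visibly sesquilinear.\<close>

instance chilbert_space \<subseteq> banach ..

context complex_inner
begin

lemma cinner_add_right: "cinner x (y + z) = cinner x y + cinner x z"
  by (metis cinner_add_left cinner_commute complex_cnj_add)

lemma cinner_scaleC_right: "cinner x (c *\<^sub>C y) = cnj c * cinner x y"
  by (metis cinner_scaleC_left cinner_commute complex_cnj_mult)

lemma cinner_self: "cinner x x = complex_of_real ((norm x)\<^sup>2)"
proof -
  have "Im (cinner x x) = 0"
    using arg_cong[OF cinner_commute[of x x], of Im] by simp
  moreover have "Re (cinner x x) = (norm x)\<^sup>2"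
    using inner_eq_Re_cinner[of x x] by (simp add: power2_norm_eq_inner)
  ultimately show ?thesis
    by (simp add: complex_eq_iff)
qed

lemma norm_scaleC [simp]: "norm (c *\<^sub>C x) = cmod c * norm x"
proof -
  have "complex_of_real ((norm (c *\<^sub>C x))\<^sup>2) = complex_of_real ((cmod c * norm x)\<^sup>2)"
    unfolding cinner_self[symmetric] cinner_scaleC_left cinner_scaleC_right
    by (simp add: cinner_self power_mult_distrib mult.assoc[symmetric] complex_norm_square del: of_real_power)
  then have "(norm (c *\<^sub>C x))\<^sup>2 = (cmod c * norm x)\<^sup>2"
    using of_real_eq_iff by blast
  then show ?thesis
    by (simp add: power2_eq_iff_nonneg)
qed

lemma norm_cinner_le: "cmod (cinner x y) \<le> norm x * norm y"
proof (cases "cinner x y = 0")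
  case False
  \<comment> \<open>A unimodular phase that makes the inner product real and nonnegative, so that
    the real Cauchy-Schwarz inequality applies.\<close>
  define c where "c = cnj (cinner x y) / cmod (cinner x y)"
  have c: "cmod c = 1"
    using False by (simp add: c_def norm_divide)
  have "cinner (c *\<^sub>C x) y = complex_of_real (cmod (cinner x y))"
    using False
    by (simp add: c_def cinner_scaleC_left divide_simps)
       (metis complex_norm_square mult.commute power2_eq_square of_real_mult)
  then have "cmod (cinner x y) = (c *\<^sub>C x) \<bullet> y"
    by (simp add: inner_eq_Re_cinner)
  also have "\<dots> \<le> norm (c *\<^sub>C x) * norm y"
    by (rule norm_cauchy_schwarz)
  finally show ?thesis
    by (simp add: c)
qed simp

end

lemma bounded_bilinear_cinner: "bounded_bilinear (cinner :: 'h::complex_inner \<Rightarrow> 'h \<Rightarrow> complex)"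
proof
  fix r :: real and x y :: 'h
  show "cinner (r *\<^sub>R x) y = r *\<^sub>R cinner x y" "cinner x (r *\<^sub>R y) = r *\<^sub>R cinner x y"
    by (simp_all add: cinner_scaleC_left cinner_scaleC_right scaleR_conv_of_real flip: scaleC_of_real)
  show "\<exists>K. \<forall>(a::'h) b. cmod (cinner a b) \<le> norm a * norm b * K"
    by (rule exI[of _ 1]) (simp add: norm_cinner_le)
qed (simp_all add: cinner_add_left cinner_add_right)

interpretation cinner: bounded_bilinear "cinner :: 'h::complex_inner \<Rightarrow> 'h \<Rightarrow> complex"
  by (rule bounded_bilinear_cinner)

lemma bounded_bilinear_scaleC: "bounded_bilinear (scaleC :: complex \<Rightarrow> 'h::complex_inner \<Rightarrow> 'h)"
proof
  fix r :: real and c :: complex and x :: 'h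
  show "(r *\<^sub>R c) *\<^sub>C x = r *\<^sub>R (c *\<^sub>C x)" "c *\<^sub>C (r *\<^sub>R x) = r *\<^sub>R (c *\<^sub>C x)"
    by (simp_all add: scaleC_scaleC scaleR_conv_of_real mult.commute flip: scaleC_of_real)
  show "\<exists>K. \<forall>a (b::'h). norm (a *\<^sub>C b) \<le> norm a * norm b * K"
    by (rule exI[of _ 1]) simp
qed (simp_all add: scaleC_add_left scaleC_add_right)

interpretation scaleC: bounded_bilinear "scaleC :: complex \<Rightarrow> 'h::complex_inner \<Rightarrow> 'h"
  by (rule bounded_bilinear_scaleC)

lemma scaleC_one [simp]: "1 *\<^sub>C (x::'h::complex_inner) = x"
  using scaleC_of_real[of 1 x] by simp

lemma scaleC_minus_one [simp]: "(-1) *\<^sub>C (x::'h::complex_inner) = - x"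
  by (simp add: scaleC.minus_left)

lemma cinner_eqI:
  fixes x y :: "'h::complex_inner"
  assumes "\<And>z. cinner x z = cinner y z"
  shows "x = y"
proof -
  have "cinner (x - y) (x - y) = 0"
    using assms by (simp add: cinner.diff_left)
  then show ?thesis
    by (simp add: cinner_self)
qed

lemma cinner_eqI2:
  fixes x y :: "'h::complex_inner"
  assumes "\<And>z. cinner z x = cinner z y"
  shows "x = y"
  using assms by (intro cinner_eqI) (simp add: cinner_commute[of x] cinner_commute[of y])

lemma norm_le_cinnerI:
  fixes x :: "'h::complex_inner"
  assumes "\<And>y. cmod (cinner x y) \<le> K * norm y" "0 \<le> K"
  shows "norm x \<le> K"
proof (cases "x = 0")
  case False
  have "norm x * norm x \<le> K * norm x"
    using assms(1)[of x] by (simp add: cinner_self power2_eq_square norm_mult)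
  then show ?thesis
    using False by simp
qed (use assms in simp)

section \<open>Sesquilinear forms and polarization\<close>

definition sesquilinear :: "('h::complex_inner \<Rightarrow> 'h \<Rightarrow> complex) \<Rightarrow> bool" where
  "sesquilinear b \<longleftrightarrow>
     (\<forall>x y z. b (x + y) z = b x z + b y z) \<and> (\<forall>x y z. b x (y + z) = b x y + b x z) \<and>
     (\<forall>c x y. b (c *\<^sub>C x) y = c * b x y) \<and> (\<forall>c x y. b x (c *\<^sub>C y) = cnj c * b x y)"

lemma sesquilinearD:
  assumes "sesquilinear b"
  shows "b (x + y) z = b x z + b y z" "b x (y + z) = b x y + b x z"
    "b (c *\<^sub>C x) y = c * b x y" "b x (c *\<^sub>C y) = cnj c * b x y"
    "b (- x) y = - b x y" "b x (- y) = - b x y"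
    "b (x - y) z = b x z - b y z" "b x (y - z) = b x y - b x z"
    "b 0 y = 0" "b x 0 = 0"
proof -
  note D = assms[unfolded sesquilinear_def]
  show 1: "b (x + y) z = b x z + b y z" "b x (y + z) = b x y + b x z"
    "b (c *\<^sub>C x) y = c * b x y" "b x (c *\<^sub>C y) = cnj c * b x y" for x y z c
    using D by blast+
  show 2: "b (- x) y = - b x y" "b x (- y) = - b x y" for x y
    using 1(3)[of "-1" x y] 1(4)[of x "-1" y] by simp_all
  show "b (x - y) z = b x z - b y z" "b x (y - z) = b x y - b x z"
    using 1(1)[of x "-y" z] 1(2)[of x y "-z"] 2 by simp_all
  show "b 0 y = 0" "b x 0 = 0"
    using 1(3)[of 0 0 y] 1(4)[of x 0 0] by (simp_all add: scaleC.zero_left)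
qed

lemma sesquilinear_cinner: "sesquilinear cinner"
  by (simp add: sesquilinear_def cinner_add_left cinner_add_right cinner_scaleC_left cinner_scaleC_right)

text \<open>Takes only a diagonal \<open>q\<close> as input, so that two sesquilinear forms with
  equal diagonals are seen to be equal.\<close>

definition polar :: "('h::complex_inner \<Rightarrow> complex) \<Rightarrow> 'h \<Rightarrow> 'h \<Rightarrow> complex" where
  "polar q x y =
     (q (x + y) - q (x - y) + \<i> * (q (x + \<i> *\<^sub>C y) - q (x - \<i> *\<^sub>C y))) / 4"

lemma polarization:
  assumes "sesquilinear b"
  shows "b x y = polar (\<lambda>z. b z z) x y"
  unfolding polar_def by (simp add: sesquilinearD[OF assms] algebra_simps)

text \<open>The constant 2 comes from summing \<open>\<parallel>x + i\<^sup>k y\<parallel>\<^sup>2\<close> over the four terms of \<^const>\<open>polar\<close>.\<close>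

lemma sesquilinear_bound:
  fixes b :: "'h::complex_inner \<Rightarrow> 'h \<Rightarrow> complex"
  assumes b: "sesquilinear b" and q: "\<And>z. cmod (b z z) \<le> K * (norm z)\<^sup>2" and K: "0 \<le> K"
  shows "cmod (b x y) \<le> 2 * K * norm x * norm y"
proof -
  have *: "cmod (b x y) \<le> K * ((norm x)\<^sup>2 + (norm y)\<^sup>2)" for x y
  proof -
    have "4 * cmod (b x y) \<le>
        cmod (b (x + y) (x + y)) + cmod (b (x - y) (x - y)) +
        (cmod (b (x + \<i> *\<^sub>C y) (x + \<i> *\<^sub>C y)) + cmod (b (x - \<i> *\<^sub>C y) (x - \<i> *\<^sub>C y)))"
    proof -
      have "4 * cmod (b x y) = cmod (4 * b x y)"
        by (simp add: norm_mult)
      also have "4 * b x y = (b (x + y) (x + y) - b (x - y) (x - y)) +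
          \<i> * (b (x + \<i> *\<^sub>C y) (x + \<i> *\<^sub>C y) - b (x - \<i> *\<^sub>C y) (x - \<i> *\<^sub>C y))"
        by (subst polarization[OF b]) (simp add: polar_def)
      also have "cmod \<dots> \<le> cmod (b (x + y) (x + y) - b (x - y) (x - y)) +
          cmod (b (x + \<i> *\<^sub>C y) (x + \<i> *\<^sub>C y) - b (x - \<i> *\<^sub>C y) (x - \<i> *\<^sub>C y))"
        by (rule order_trans[OF norm_triangle_ineq]) (simp add: norm_mult)
      finally show ?thesis
        using norm_triangle_ineq4[of "b (x + y) (x + y)" "b (x - y) (x - y)"]
          norm_triangle_ineq4[of "b (x + \<i> *\<^sub>C y) (x + \<i> *\<^sub>C y)" "b (x - \<i> *\<^sub>C y) (x - \<i> *\<^sub>C y)"]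
        by linarith
    qed
    also have "\<dots> \<le> K * (norm (x + y))\<^sup>2 + K * (norm (x - y))\<^sup>2 +
        (K * (norm (x + \<i> *\<^sub>C y))\<^sup>2 + K * (norm (x - \<i> *\<^sub>C y))\<^sup>2)"
      by (intro add_mono q)
    also have "\<dots> = K * ((norm (x + y))\<^sup>2 + (norm (x - y))\<^sup>2 +
        ((norm (x + \<i> *\<^sub>C y))\<^sup>2 + (norm (x - \<i> *\<^sub>C y))\<^sup>2))"
      by (simp add: algebra_simps)
    finally have "4 * cmod (b x y) \<le> K * ((norm (x + y))\<^sup>2 + (norm (x - y))\<^sup>2 +
        ((norm (x + \<i> *\<^sub>C y))\<^sup>2 + (norm (x - \<i> *\<^sub>C y))\<^sup>2))" .
    moreover have pl: "(norm (x + y))\<^sup>2 + (norm (x - y))\<^sup>2 = 2 * (norm x)\<^sup>2 + 2 * (norm y)\<^sup>2" for y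
      by (simp add: power2_norm_eq_inner inner_simps inner_commute)
    ultimately have "4 * cmod (b x y) \<le> K * (4 * (norm x)\<^sup>2 + 4 * (norm y)\<^sup>2)"
      by simp
    also have "\<dots> = 4 * (K * ((norm x)\<^sup>2 + (norm y)\<^sup>2))"
      by (simp add: algebra_simps)
    finally show ?thesis
      by simp
  qed
  show ?thesis
  proof (cases "x = 0 \<or> y = 0")
    case True
    then show ?thesis
      by (auto simp: sesquilinearD[OF b])
  next
    case False
    \<comment> \<open>Replacing x by t x and y by y / t keeps \<open>b x y\<close>. This t makes
      both squares equal to \<open>norm x * norm y\<close>, turning the sum of squares into the
      product.\<close>
    define t where "t = sqrt (norm y / norm x)"
    have t: "t > 0" "t\<^sup>2 = norm y / norm x"
      using False by (simp_all add: t_def)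
    have "b x y = b (complex_of_real t *\<^sub>C x) (complex_of_real (1 / t) *\<^sub>C y)"
      using t(1) by (simp add: sesquilinearD[OF b])
    also have "cmod \<dots> \<le> K * ((t * norm x)\<^sup>2 + (norm y / t)\<^sup>2)"
      using *[of "complex_of_real t *\<^sub>C x" "complex_of_real (1 / t) *\<^sub>C y"] t(1)
      by (simp add: norm_divide)
    also have "(t * norm x)\<^sup>2 + (norm y / t)\<^sup>2 = 2 * norm x * norm y"
      unfolding power_mult_distrib power_divide t(2) using False by (simp add: power2_eq_square)
    finally show ?thesis
      by (simp add: mult_ac)
  qed
qed

subsection \<open>Riesz representation and adjoints\<close>

text \<open>Variational proof: if \<psi> is the inner product with z, then \<open>J x\<close> is
  \<open>(norm (x - z))\<^sup>2 - (norm z)\<^sup>2\<close>, so z is found as the minimizer of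
  \<open>J\<close>. Completeness supplies the limit of a minimizing sequence.\<close>

lemma riesz_representation_real:
  fixes \<psi> :: "'h::{real_inner, complete_space} \<Rightarrow> real"
  assumes "bounded_linear \<psi>"
  shows "\<exists>z. \<forall>x. \<psi> x = z \<bullet> x"
proof -
  interpret \<psi>: bounded_linear \<psi> by fact
  obtain K where K: "\<And>x. norm (\<psi> x) \<le> norm x * K"
    using \<psi>.bounded by blast
  define J where "J x = (norm x)\<^sup>2 - 2 * \<psi> x" for x
  have J_lower: "J x \<ge> - (K\<^sup>2)" for x
  proof -
    have "0 \<le> (norm x - K)\<^sup>2" by simp
    then show ?thesis
      using K[of x] unfolding J_def by (simp add: power2_diff mult.commute)
  qed
  then have bdd: "bdd_below (range J)"
    by (intro bdd_belowI[of _ "- (K\<^sup>2)"]) auto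
  define m where "m = Inf (range J)"
  have m_le: "m \<le> J x" for x
    unfolding m_def by (rule cInf_lower[OF _ bdd]) simp
  have "\<exists>x. J x < m + 1 / Suc n" for n
    using cInf_lessD[of "range J" "m + 1 / Suc n"] by (auto simp: m_def)
  then obtain u where u: "\<And>n. J (u n) < m + 1 / Suc n"
    by metis
  \<comment> \<open>The parallelogram law as uniform convexity of \<open>J\<close>: two
    near-minimizers have a midpoint whose value is at least m, which forces them to be
    close.\<close>
  have midpoint: "J ((1/2) *\<^sub>R (x + y)) = J x / 2 + J y / 2 - (norm (x - y))\<^sup>2 / 4" for x y
    unfolding J_def
    by (simp add: power2_norm_eq_inner inner_simps inner_commute \<psi>.add \<psi>.scaleR field_simps)
  have close: "(norm (u i - u j))\<^sup>2 \<le> 2 / Suc i + 2 / Suc j" for i j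
    using m_le[of "(1/2) *\<^sub>R (u i + u j)"] u[of i] u[of j] unfolding midpoint by simp
  have "Cauchy u"
  proof (rule metric_CauchyI)
    fix e :: real assume e: "e > 0"
    obtain N where N: "4 / e\<^sup>2 < real N"
      using reals_Archimedean2 by blast
    show "\<exists>M. \<forall>i\<ge>M. \<forall>j\<ge>M. dist (u i) (u j) < e"
    proof (intro exI allI impI)
      fix i j assume "i \<ge> N" "j \<ge> N"
      have small: "2 / Suc k < e\<^sup>2 / 2" if "k \<ge> N" for k
      proof -
        have "4 / e\<^sup>2 < real (Suc k)"
          using N that by linarith
        then show ?thesis
          using e by (simp add: field_simps)
      qed
      have "(norm (u i - u j))\<^sup>2 < e\<^sup>2"
        using close[of i j] small[OF \<open>i \<ge> N\<close>] small[OF \<open>j \<ge> N\<close>] by linarith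
      then show "dist (u i) (u j) < e"
        using e by (simp add: dist_norm power2_less_imp_less)
    qed
  qed
  then obtain z where z: "u \<longlonglongrightarrow> z"
    using Cauchy_convergent convergent_def by blast
  have "(\<lambda>n. J (u n)) \<longlonglongrightarrow> J z"
    unfolding J_def by (intro tendsto_intros \<psi>.tendsto z)
  moreover have "(\<lambda>n. m + 1 / Suc n) \<longlonglongrightarrow> m + 0"
    by (intro tendsto_intros LIMSEQ_Suc[OF lim_1_over_n])
  ultimately have "J z \<le> m + 0"
    by (rule LIMSEQ_le) (use u in \<open>auto intro: less_imp_le\<close>)
  then have Jz: "J z \<le> m"
    by simp
  have "\<psi> x = z \<bullet> x" for x
  proof (rule ccontr)
    assume ne: "\<psi> x \<noteq> z \<bullet> x"
    define d where "d = \<psi> x - z \<bullet> x"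
    have le: "0 \<le> t\<^sup>2 * (norm x)\<^sup>2 - 2 * t * d" for t
    proof -
      have "J (z + t *\<^sub>R x) = J z + t\<^sup>2 * (norm x)\<^sup>2 - 2 * t * d"
        unfolding J_def d_def
        by (simp add: power2_norm_eq_inner inner_simps inner_commute \<psi>.add \<psi>.scaleR)
           (simp add: power2_eq_square algebra_simps)
      then show ?thesis
        using m_le[of "z + t *\<^sub>R x"] Jz by linarith
    qed
    have d: "d \<noteq> 0" and x: "x \<noteq> 0"
      using ne by (auto simp: d_def \<psi>.zero)
    \<comment> \<open>The minimizer of the quadratic polynomial in t; its minimum is negative unless
      d = 0.\<close>
    have "0 \<le> (d / (norm x)\<^sup>2)\<^sup>2 * (norm x)\<^sup>2 - 2 * (d / (norm x)\<^sup>2) * d"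
      by (rule le)
    also have "\<dots> = - (d\<^sup>2 / (norm x)\<^sup>2)"
      using x by (simp add: power2_eq_square field_simps)
    finally show False
      using d x by (simp add: divide_le_0_iff not_le)
  qed
  then show ?thesis by blast
qed

text \<open>A complex-linear functional is determined by its real part, because its imaginary part
  at x is minus the real part at \<open>\<i> *\<^sub>C x\<close>.\<close>

lemma riesz_representation:
  fixes \<phi> :: "'h::chilbert_space \<Rightarrow> complex"
  assumes add: "\<And>x y. \<phi> (x + y) = \<phi> x + \<phi> y" and scale: "\<And>c x. \<phi> (c *\<^sub>C x) = c * \<phi> x"
    and bound: "\<And>x. cmod (\<phi> x) \<le> K * norm x"
  shows "\<exists>z. \<forall>x. \<phi> x = cinner x z"
proof -
  have "bounded_linear (\<lambda>x. Re (\<phi> x))"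
  proof (rule bounded_linear_intro[where K = K])
    show "Re (\<phi> (r *\<^sub>R x)) = r *\<^sub>R Re (\<phi> x)" for r x
      using scale[of "complex_of_real r" x] by (simp add: scaleC_of_real)
    show "norm (Re (\<phi> x)) \<le> norm x * K" for x
      using bound[of x] abs_Re_le_cmod[of "\<phi> x"] by (simp add: mult.commute)
  qed (simp add: add)
  from riesz_representation_real[OF this] obtain z where z: "\<And>x. Re (\<phi> x) = z \<bullet> x"
    by blast
  have re: "Re (\<phi> x) = Re (cinner x z)" for x
    using z[of x] cinner_commute[of z x] by (simp add: inner_eq_Re_cinner)
  have "Im (\<phi> x) = Im (cinner x z)" for x
    using re[of "\<i> *\<^sub>C x"] by (simp add: scale cinner_scaleC_left)
  with re show ?thesis
    by (auto simp: complex_eq_iff)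
qed

text \<open>For fixed x the conjugate of \<open>b x y\<close> is linear in y, so the Riesz vector of
  that functional is the value of the operator at x.\<close>

lemma sesquilinear_operator_exists:
  fixes b :: "'h::chilbert_space \<Rightarrow> 'h \<Rightarrow> complex"
  assumes b: "sesquilinear b" and bound: "\<And>x y. cmod (b x y) \<le> K * norm x * norm y"
  shows "\<exists>T\<in>bops. \<forall>x y. cinner (blinfun_apply T x) y = b x y"
proof -
  have "\<exists>z. \<forall>y. cnj (b x y) = cinner y z" for x
    by (rule riesz_representation[where K = "K * norm x"])
       (use bound[of x] in \<open>simp_all add: sesquilinearD[OF b]\<close>)
  then obtain t where t: "\<And>x y. cnj (b x y) = cinner y (t x)"
    by metis
  have ct: "cinner (t x) y = b x y" for x y
    using arg_cong[OF t[of x y], of cnj] cinner_commute[of "t x" y] by simp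
  have scale: "t (c *\<^sub>C x) = c *\<^sub>C t x" for c x
    by (rule cinner_eqI) (simp add: ct sesquilinearD[OF b] cinner_scaleC_left)
  have "bounded_linear t"
  proof (rule bounded_linear_intro[where K = "\<bar>K\<bar>"])
    show "t (x + y) = t x + t y" for x y
      by (rule cinner_eqI) (simp add: ct sesquilinearD[OF b] cinner_add_left)
    show "t (r *\<^sub>R x) = r *\<^sub>R t x" for r x
      using scale[of "complex_of_real r" x] by (simp add: scaleC_of_real)
    show "norm (t x) \<le> norm x * \<bar>K\<bar>" for x
    proof (rule norm_le_cinnerI)
      fix y
      have "cmod (cinner (t x) y) \<le> K * norm x * norm y"
        by (simp add: ct bound)
      also have "\<dots> \<le> \<bar>K\<bar> * norm x * norm y"
        by (intro mult_right_mono) auto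
      finally show "cmod (cinner (t x) y) \<le> norm x * \<bar>K\<bar> * norm y"
        by (simp add: mult_ac)
    qed simp
  qed
  then show ?thesis
    by (intro bexI[of _ "Blinfun t"])
       (auto simp: bounded_linear_Blinfun_apply ct bops_def scale)
qed

section \<open>Complex-linear operators and adjoints\<close>

lemma bops_apply_scaleC: "T \<in> bops \<Longrightarrow> blinfun_apply T (c *\<^sub>C x) = c *\<^sub>C blinfun_apply T x"
  by (simp add: bops_def)

lemma bops_id [simp]: "id_blinfun \<in> bops"
  and bops_zero [simp]: "0 \<in> bops"
  and bops_add: "S \<in> bops \<Longrightarrow> T \<in> bops \<Longrightarrow> S + T \<in> bops"
  and bops_diff: "S \<in> bops \<Longrightarrow> T \<in> bops \<Longrightarrow> S - T \<in> bops"
  and bops_scaleR: "T \<in> bops \<Longrightarrow> r *\<^sub>R T \<in> bops"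
  and bops_compose: "S \<in> bops \<Longrightarrow> T \<in> bops \<Longrightarrow> S o\<^sub>L T \<in> bops"
  by (simp_all add: bops_def blinfun.bilinear_simps scaleC_add_right scaleC.diff_right scaleC.scaleR_right)

lemma bops_sum: "(\<And>i. i \<in> I \<Longrightarrow> f i \<in> bops) \<Longrightarrow> sum f I \<in> bops"
  by (induction I rule: infinite_finite_induct) (auto intro: bops_add)

lemma bops_limit:
  assumes "\<And>n. T n \<in> bops" "T \<longlonglongrightarrow> L"
  shows "L \<in> bops"
  unfolding bops_def
proof (intro CollectI allI)
  fix c \<xi>
  have "(\<lambda>n. blinfun_apply (T n) (c *\<^sub>C \<xi>)) \<longlonglongrightarrow> blinfun_apply L (c *\<^sub>C \<xi>)"
    by (intro tendsto_intros assms)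
  moreover have "(\<lambda>n. blinfun_apply (T n) (c *\<^sub>C \<xi>)) \<longlonglongrightarrow> c *\<^sub>C blinfun_apply L \<xi>"
    using assms(1) by (simp add: bops_apply_scaleC) (intro scaleC.tendsto tendsto_intros assms)
  ultimately show "blinfun_apply L (c *\<^sub>C \<xi>) = c *\<^sub>C blinfun_apply L \<xi>"
    by (rule LIMSEQ_unique)
qed

lemma sesquilinear_cinner_apply:
  "T \<in> bops \<Longrightarrow> sesquilinear (\<lambda>x y. cinner (blinfun_apply T x) y)"
  by (simp add: sesquilinear_def blinfun.add_right bops_apply_scaleC cinner_add_left
      cinner_add_right cinner_scaleC_left cinner_scaleC_right)

lemma blinfun_cinner_eqI:
  fixes S T :: "'g::real_normed_vector \<Rightarrow>\<^sub>L 'h::complex_inner"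
  assumes "\<And>x y. cinner (blinfun_apply S x) y = cinner (blinfun_apply T x) y"
  shows "S = T"
  by (intro blinfun_eqI cinner_eqI assms)

lemma norm_blinfun_le_cinnerI:
  fixes T :: "'h::chilbert_space \<Rightarrow>\<^sub>L 'h"
  assumes "\<And>x y. cmod (cinner (blinfun_apply T x) y) \<le> K * norm x * norm y" "0 \<le> K"
  shows "norm T \<le> K"
  using assms by (intro norm_blinfun_bound norm_le_cinnerI) auto

lemma cadjoint_eqI:
  assumes "S \<in> bops" "\<And>x y. cinner (blinfun_apply T x) y = cinner x (blinfun_apply S y)"
  shows "cadjoint T = S"
  unfolding cadjoint_def
proof (rule the_equality)
  fix S' assume "S' \<in> bops \<and> (\<forall>\<xi> \<eta>. cinner (blinfun_apply T \<xi>) \<eta> = cinner \<xi> (blinfun_apply S' \<eta>))"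
  then show "S' = S"
    by (intro blinfun_eqI cinner_eqI2) (metis assms(2))
qed (use assms in auto)

text \<open>Gives the existence behind the definite description in \<open>cadjoint\<close>: the
  conjugate transpose of the form of \<open>T\<close> is again sesquilinear and bounded, hence comes
  from an operator.\<close>

lemma cadjoint:
  assumes T: "T \<in> bops"
  shows cadjoint_bops: "cadjoint T \<in> bops"
    and cinner_cadjoint: "cinner (blinfun_apply T x) y = cinner x (blinfun_apply (cadjoint T) y)"
proof -
  have "sesquilinear (\<lambda>y x. cnj (cinner (blinfun_apply T x) y))"
    using sesquilinear_cinner_apply[OF T] by (auto simp: sesquilinear_def)
  moreover have "cmod (cnj (cinner (blinfun_apply T x) y)) \<le> norm T * norm y * norm x" for x y
    using order_trans[OF norm_cinner_le mult_right_mono[OF norm_blinfun norm_ge_zero]]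
    by (simp add: mult_ac)
  ultimately obtain S where S: "S \<in> bops"
      "\<And>x y. cinner (blinfun_apply S y) x = cnj (cinner (blinfun_apply T x) y)"
    using sesquilinear_operator_exists[of "\<lambda>y x. cnj (cinner (blinfun_apply T x) y)" "norm T"]
    by metis
  have *: "cinner (blinfun_apply T x) y = cinner x (blinfun_apply S y)" for x y
    using S(2)[of y x] cinner_commute[of x "blinfun_apply S y"] by simp
  then have "cadjoint T = S"
    by (intro cadjoint_eqI S(1))
  then show "cadjoint T \<in> bops" "cinner (blinfun_apply T x) y = cinner x (blinfun_apply (cadjoint T) y)"
    using S(1) * by simp_all
qed

text \<open>The form and its conjugate transpose agree on the diagonal, which is real, and therefore
  everywhere by polarization.\<close>

lemma positive_op_selfadjoint:
  assumes "positive_op T"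
  shows "cinner (blinfun_apply T x) y = cinner x (blinfun_apply T y)"
proof -
  let ?b = "\<lambda>x y. cinner (blinfun_apply T x) y"
  have T: "T \<in> bops" and pos: "\<And>z. ?b z z \<in> \<real>\<^sub>\<ge>\<^sub>0"
    using assms by (auto simp: positive_op_def)
  have "sesquilinear (\<lambda>x y. cnj (?b y x))"
    using sesquilinear_cinner_apply[OF T] by (auto simp: sesquilinear_def)
  moreover have "cnj (?b z z) = ?b z z" for z
    using pos[of z] by (metis Reals_cnj_iff nonneg_Reals_subset_Reals subsetD)
  ultimately have "cnj (?b y x) = ?b x y"
    using polarization[OF sesquilinear_cinner_apply[OF T], of x y]
      polarization[of "\<lambda>x y. cnj (?b y x)" x y] by simp
  then show ?thesis
    using cinner_commute[of x "blinfun_apply T y"] by simp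
qed

subsection \<open>Weak measurability\<close>

lemma separable_dense_seq:
  assumes "separable_space (euclidean :: 'h::metric_space topology)"
  obtains d :: "nat \<Rightarrow> 'h::metric_space" where "closure (range d) = UNIV"
proof -
  obtain C :: "'h set" where C: "countable C" "closure C = UNIV"
    using assms unfolding separable_space_def by auto
  then have "C \<noteq> {}" by auto
  with C that show thesis
    using uncountable_def[of C] by metis
qed

text \<open>Polarization expresses the inner product through norms of combinations of u and v, and
  by separability a norm bound is a countable family of conditions on measurable functions.\<close>

lemma borel_measurable_cinner_weak:
  fixes u v :: "'x \<Rightarrow> 'h::complex_inner"
  assumes sep: "separable_space (euclidean :: 'h::complex_inner topology)"
    and u: "\<And>z. (\<lambda>x. cinner (u x) z) \<in> borel_measurable M"
    and v: "\<And>z. (\<lambda>x. cinner (v x) z) \<in> borel_measurable M"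
  shows "(\<lambda>x. cinner (u x) (v x)) \<in> borel_measurable M"
proof -
  obtain d :: "nat \<Rightarrow> 'h" where d: "closure (range d) = UNIV"
    using separable_dense_seq[OF sep] by blast
  \<comment> \<open>The inequality \<open>cmod (cinner z y) \<le> c * norm y\<close> is closed in y,
    so it may be tested on a dense sequence.\<close>
  have norm_le_iff: "norm z \<le> c \<longleftrightarrow> 0 \<le> c \<and> (\<forall>k. cmod (cinner z (d k)) \<le> c * norm (d k))"
    for z :: 'h and c
  proof
    assume z: "norm z \<le> c"
    show "0 \<le> c \<and> (\<forall>k. cmod (cinner z (d k)) \<le> c * norm (d k))"
      using order_trans[OF norm_ge_zero z]
        order_trans[OF norm_cinner_le mult_right_mono[OF z norm_ge_zero]] by blast
  next
    assume c: "0 \<le> c \<and> (\<forall>k. cmod (cinner z (d k)) \<le> c * norm (d k))"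
    have "cmod (cinner z y) - c * norm y \<le> 0" for y
      by (rule continuous_le_on_closure[where S = "range d" and f = "\<lambda>y. cmod (cinner z y) - c * norm y"])
         (use c d in \<open>auto intro!: continuous_intros cinner.continuous_on\<close>)
    then show "norm z \<le> c"
      using c by (intro norm_le_cinnerI) (auto simp: algebra_simps)
  qed
  have norm_meas: "(\<lambda>x. norm (w x)) \<in> borel_measurable M"
    if [measurable]: "\<And>z. (\<lambda>x. cinner (w x) z) \<in> borel_measurable M" for w :: "'x \<Rightarrow> 'h"
    unfolding borel_measurable_iff_le norm_le_iff by measurable
  have lin: "(\<lambda>x. cinner (u x + c *\<^sub>C v x) z) \<in> borel_measurable M" for c z
    using u v by (simp add: cinner_add_left cinner_scaleC_left)
  from polarization[OF sesquilinear_cinner] have eq: "cinner (u x) (v x) =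
      (of_real ((norm (u x + 1 *\<^sub>C v x))\<^sup>2) - of_real ((norm (u x + (-1) *\<^sub>C v x))\<^sup>2) +
       \<i> * (of_real ((norm (u x + \<i> *\<^sub>C v x))\<^sup>2) - of_real ((norm (u x + (- \<i>) *\<^sub>C v x))\<^sup>2))) / 4" for x
    by (simp add: polar_def cinner_self scaleC.minus_left)
  note norm_meas[OF lin, measurable]
  show ?thesis
    unfolding eq by measurable
qed

lemma weakly_measurableD:
  "weakly_measurable F \<Longrightarrow> (\<lambda>x. cinner (blinfun_apply (F x) \<xi>) \<eta>) \<in> borel_measurable borel"
  by (simp add: weakly_measurable_def)

text \<open>With the adjoint of \<open>F x\<close> moved to the second slot, a coefficient of the
  product is an inner product of two weakly measurable vector fields.\<close>

lemma weakly_measurable_compose: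
  fixes F G :: "'x::topological_space \<Rightarrow> ('h::chilbert_space \<Rightarrow>\<^sub>L 'h)"
  assumes sep: "separable_space (euclidean :: 'h topology)"
    and F: "\<And>x. F x \<in> bops" "weakly_measurable F" and G: "weakly_measurable G"
  shows "weakly_measurable (\<lambda>x. F x o\<^sub>L G x)"
  unfolding weakly_measurable_def
proof (intro allI)
  fix \<xi> \<eta>
  have "(\<lambda>x. cinner (blinfun_apply (G x) \<xi>) (blinfun_apply (cadjoint (F x)) \<eta>)) \<in> borel_measurable borel"
  proof (rule borel_measurable_cinner_weak[OF sep])
    show "(\<lambda>x. cinner (blinfun_apply (G x) \<xi>) z) \<in> borel_measurable borel" for z
      using G by (rule weakly_measurableD)
    have eq: "cinner (blinfun_apply (cadjoint (F x)) \<eta>) z = cnj (cinner (blinfun_apply (F x) z) \<eta>)" for x z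
      using cinner_cadjoint[OF F(1), of x z \<eta>] cinner_commute[of "blinfun_apply (cadjoint (F x)) \<eta>" z] by simp
    show "(\<lambda>x. cinner (blinfun_apply (cadjoint (F x)) \<eta>) z) \<in> borel_measurable borel" for z
      unfolding eq
      by (rule measurable_compose[OF weakly_measurableD[OF F(2)] borel_measurable_continuous_onI])
         (intro continuous_intros)
  qed
  then show "(\<lambda>x. cinner (blinfun_apply (F x o\<^sub>L G x) \<xi>) \<eta>) \<in> borel_measurable borel"
    by (simp add: cinner_cadjoint[OF F(1)])
qed

lemma weakly_measurable_add:
  "weakly_measurable F \<Longrightarrow> weakly_measurable G \<Longrightarrow> weakly_measurable (\<lambda>x. F x + G x)"
  unfolding weakly_measurable_def blinfun.add_left cinner_add_left
  by (intro allI borel_measurable_add) auto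

lemma weakly_measurable_diff:
  "weakly_measurable F \<Longrightarrow> weakly_measurable G \<Longrightarrow> weakly_measurable (\<lambda>x. F x - G x)"
  unfolding weakly_measurable_def blinfun.diff_left cinner.diff_left
  by (intro allI borel_measurable_diff) auto

lemma weakly_measurable_scaleR: "weakly_measurable F \<Longrightarrow> weakly_measurable (\<lambda>x. r *\<^sub>R F x)"
  unfolding weakly_measurable_def blinfun.scaleR_left cinner.scaleR_left
  by (intro allI borel_measurable_scaleR borel_measurable_const) auto

lemma weakly_measurable_const: "weakly_measurable (\<lambda>x. T)"
  by (simp add: weakly_measurable_def)

lemma weakly_measurable_sum:
  "(\<And>i. i \<in> I \<Longrightarrow> weakly_measurable (F i)) \<Longrightarrow> weakly_measurable (\<lambda>x. \<Sum>i\<in>I. F i x)"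
  by (induction I rule: infinite_finite_induct) (auto intro: weakly_measurable_add weakly_measurable_const)

lemma weakly_measurable_LIMSEQ:
  assumes "\<And>n. weakly_measurable (F n)" "\<And>x. (\<lambda>n. F n x) \<longlonglongrightarrow> L x"
  shows "weakly_measurable L"
  unfolding weakly_measurable_def
proof (intro allI)
  fix \<xi> \<eta>
  show "(\<lambda>x. cinner (blinfun_apply (L x) \<xi>) \<eta>) \<in> borel_measurable borel"
  proof (rule borel_measurable_LIMSEQ_metric)
    show "(\<lambda>x. cinner (blinfun_apply (F n x) \<xi>) \<eta>) \<in> borel_measurable borel" for n
      using assms(1) by (rule weakly_measurableD)
    show "(\<lambda>n. cinner (blinfun_apply (F n x) \<xi>) \<eta>) \<longlonglongrightarrow> cinner (blinfun_apply (L x) \<xi>) \<eta>" for x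
      by (intro cinner.tendsto blinfun.tendsto tendsto_const assms(2))
  qed
qed


subsection \<open>Square roots of positive operator matrices\<close>

definition mat_apply :: "nat \<Rightarrow> (nat \<Rightarrow> nat \<Rightarrow> ('h::real_normed_vector \<Rightarrow>\<^sub>L 'h)) \<Rightarrow> (nat \<Rightarrow> 'h) \<Rightarrow> nat \<Rightarrow> 'h" where
  "mat_apply n A v i = (\<Sum>j<n. blinfun_apply (A i j) (v j))"

definition mat_mult :: "nat \<Rightarrow> (nat \<Rightarrow> nat \<Rightarrow> ('h::real_normed_vector \<Rightarrow>\<^sub>L 'h)) \<Rightarrow>
    (nat \<Rightarrow> nat \<Rightarrow> ('h \<Rightarrow>\<^sub>L 'h)) \<Rightarrow> nat \<Rightarrow> nat \<Rightarrow> ('h \<Rightarrow>\<^sub>L 'h)" where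
  "mat_mult n A B i j = (\<Sum>k<n. A i k o\<^sub>L B k j)"

definition vec_norm :: "nat \<Rightarrow> (nat \<Rightarrow> 'h::real_normed_vector) \<Rightarrow> real" where
  "vec_norm n v = L2_set (\<lambda>i. norm (v i)) {..<n}"

text \<open>The size n is a variable, so the n-fold sum of \<open>H\<close> is represented by
  functions on indices, and a bound r on the operator norm of the matrix stands in for that
  norm.\<close>

definition mat_bound :: "nat \<Rightarrow> real \<Rightarrow> (nat \<Rightarrow> nat \<Rightarrow> ('h::real_normed_vector \<Rightarrow>\<^sub>L 'h)) \<Rightarrow> bool" where
  "mat_bound n r A \<longleftrightarrow> 0 \<le> r \<and> (\<forall>v. vec_norm n (mat_apply n A v) \<le> r * vec_norm n v)"

lemma vec_norm_nonneg [simp]: "0 \<le> vec_norm n v"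
  by (simp add: vec_norm_def)

lemma vec_norm_power2: "(vec_norm n v)\<^sup>2 = (\<Sum>i<n. (norm (v i))\<^sup>2)"
  by (simp add: vec_norm_def L2_set_def sum_nonneg)

lemma vec_norm_add: "vec_norm n (\<lambda>i. u i + v i) \<le> vec_norm n u + vec_norm n v"
  unfolding vec_norm_def
  by (rule order_trans[OF L2_set_mono L2_set_triangle_ineq]) (auto intro: norm_triangle_ineq)

lemma vec_norm_scaleR: "vec_norm n (\<lambda>i. c *\<^sub>R v i) = \<bar>c\<bar> * vec_norm n v"
  by (simp add: vec_norm_def L2_set_right_distrib)

lemma mat_apply_mult: "mat_apply n (mat_mult n A B) v = mat_apply n A (mat_apply n B v)"
proof
  fix i
  have "mat_apply n (mat_mult n A B) v i =
      (\<Sum>j<n. \<Sum>k<n. blinfun_apply (A i k) (blinfun_apply (B k j) (v j)))"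
    by (simp add: mat_apply_def mat_mult_def blinfun.sum_left)
  also have "\<dots> = (\<Sum>k<n. \<Sum>j<n. blinfun_apply (A i k) (blinfun_apply (B k j) (v j)))"
    by (rule sum.swap)
  also have "\<dots> = mat_apply n A (mat_apply n B v) i"
    by (simp add: mat_apply_def blinfun.sum_right)
  finally show "mat_apply n (mat_mult n A B) v i = mat_apply n A (mat_apply n B v) i" .
qed

lemma mat_bound_zero: "mat_bound n 0 (\<lambda>i j. 0)"
  by (simp add: mat_bound_def mat_apply_def vec_norm_def L2_set_def)

lemma mat_bound_add:
  assumes "mat_bound n r A" "mat_bound n s B"
  shows "mat_bound n (r + s) (\<lambda>i j. A i j + B i j)"
  unfolding mat_bound_def
proof (intro conjI allI)
  fix v
  have "vec_norm n (mat_apply n (\<lambda>i j. A i j + B i j) v) \<le>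
      vec_norm n (mat_apply n A v) + vec_norm n (mat_apply n B v)"
    using vec_norm_add[of n "mat_apply n A v" "mat_apply n B v"]
    by (simp add: mat_apply_def[abs_def] blinfun.add_left sum.distrib)
  also have "\<dots> \<le> (r + s) * vec_norm n v"
    using assms unfolding mat_bound_def by (simp add: distrib_right add_mono)
  finally show "vec_norm n (mat_apply n (\<lambda>i j. A i j + B i j) v) \<le> (r + s) * vec_norm n v" .
qed (use assms in \<open>simp add: mat_bound_def\<close>)

lemma mat_bound_scaleR:
  assumes "mat_bound n r A"
  shows "mat_bound n (\<bar>c\<bar> * r) (\<lambda>i j. c *\<^sub>R A i j)"
  unfolding mat_bound_def
proof (intro conjI allI)
  fix v
  have "vec_norm n (mat_apply n (\<lambda>i j. c *\<^sub>R A i j) v) = \<bar>c\<bar> * vec_norm n (mat_apply n A v)"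
    using vec_norm_scaleR[of n c "mat_apply n A v"]
    by (simp add: mat_apply_def[abs_def] blinfun.scaleR_left scaleR_sum_right)
  also have "\<dots> \<le> \<bar>c\<bar> * r * vec_norm n v"
    using assms unfolding mat_bound_def by (simp add: mult.assoc mult_left_mono)
  finally show "vec_norm n (mat_apply n (\<lambda>i j. c *\<^sub>R A i j) v) \<le> \<bar>c\<bar> * r * vec_norm n v" .
qed (use assms in \<open>simp add: mat_bound_def\<close>)

lemma mat_bound_mult:
  assumes A: "mat_bound n r A" and B: "mat_bound n s B"
  shows "mat_bound n (r * s) (mat_mult n A B)"
  unfolding mat_bound_def
proof (intro conjI allI)
  fix v
  have "vec_norm n (mat_apply n (mat_mult n A B) v) \<le> r * vec_norm n (mat_apply n B v)"
    using A by (simp add: mat_apply_mult mat_bound_def)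
  also have "\<dots> \<le> r * (s * vec_norm n v)"
    using A B by (intro mult_left_mono) (auto simp: mat_bound_def)
  finally show "vec_norm n (mat_apply n (mat_mult n A B) v) \<le> r * s * vec_norm n v"
    by (simp add: mult.assoc)
qed (use assms in \<open>simp add: mat_bound_def\<close>)

text \<open>Tested on a vector with a single nonzero component. It turns bounds on matrices into
  norm bounds on the entries, where limits are taken.\<close>

lemma mat_bound_entry:
  fixes A :: "nat \<Rightarrow> nat \<Rightarrow> ('h::real_normed_vector \<Rightarrow>\<^sub>L 'h)"
  assumes A: "mat_bound n r A" and ij: "i < n" "j < n"
  shows "norm (A i j) \<le> r"
proof (rule norm_blinfun_bound)
  fix x :: 'h
  define v where "v = (\<lambda>k. if k = j then x else 0)"
  have "norm (blinfun_apply (A i j) x) = norm (mat_apply n A v i)"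
    using ij by (simp add: mat_apply_def v_def if_distrib[of "blinfun_apply _"] blinfun.zero_right cong: if_cong)
  also have "\<dots> \<le> vec_norm n (mat_apply n A v)"
    unfolding vec_norm_def using ij
    by (intro member_le_L2_set[where f = "\<lambda>i. norm (mat_apply n A v i)"]) auto
  also have "\<dots> \<le> r * vec_norm n v"
    using A by (simp add: mat_bound_def)
  also have "vec_norm n v = norm x"
    using ij by (simp add: vec_norm_def L2_set_def v_def if_distrib[of norm] if_distrib[of "\<lambda>x. x\<^sup>2"] cong: if_cong)
  finally show "norm (blinfun_apply (A i j) x) \<le> r * norm x" .
qed (use A in \<open>simp add: mat_bound_def\<close>)

text \<open>With w = B u one has \<beta>(u, w) = \<open>(vec_norm n w)\<^sup>2\<close>. Positivity
  of \<beta> at u - w gives 2 \<beta>(u, w) \<le> \<beta>(u, u) + \<beta>(w, w), and the upper bound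
  on the diagonal turns this into
  \<open>(vec_norm n w)\<^sup>2 \<le> (vec_norm n u)\<^sup>2\<close>.\<close>

lemma contraction_if_between_0_1:
  fixes B :: "nat \<Rightarrow> nat \<Rightarrow> ('h::real_inner \<Rightarrow>\<^sub>L 'h)"
  assumes sym: "\<And>i j u w. i < n \<Longrightarrow> j < n \<Longrightarrow> blinfun_apply (B i j) u \<bullet> w = u \<bullet> blinfun_apply (B j i) w"
    and pos: "\<And>v. 0 \<le> (\<Sum>i<n. mat_apply n B v i \<bullet> v i)"
    and le: "\<And>v. (\<Sum>i<n. mat_apply n B v i \<bullet> v i) \<le> (\<Sum>i<n. (norm (v i))\<^sup>2)"
  shows "mat_bound n 1 B"
proof -
  define \<beta> where "\<beta> u w = (\<Sum>i<n. mat_apply n B u i \<bullet> w i)" for u w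
  have \<beta>_sym: "\<beta> u w = \<beta> w u" for u w
  proof -
    have "\<beta> u w = (\<Sum>i<n. \<Sum>j<n. blinfun_apply (B i j) (u j) \<bullet> w i)"
      by (simp add: \<beta>_def mat_apply_def inner_sum_left)
    also have "\<dots> = (\<Sum>i<n. \<Sum>j<n. blinfun_apply (B j i) (w i) \<bullet> u j)"
      by (intro sum.cong refl) (metis sym inner_commute lessThan_iff)
    also have "\<dots> = (\<Sum>j<n. \<Sum>i<n. blinfun_apply (B j i) (w i) \<bullet> u j)"
      by (rule sum.swap)
    also have "\<dots> = \<beta> w u"
      by (simp add: \<beta>_def mat_apply_def inner_sum_left)
    finally show ?thesis .
  qed
  have \<beta>_diff: "\<beta> (\<lambda>i. u i - w i) (\<lambda>i. u i - w i) = \<beta> u u - \<beta> u w - \<beta> w u + \<beta> w w" for u w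
    by (simp add: \<beta>_def mat_apply_def blinfun.diff_right sum_subtractf inner_diff_left inner_diff_right)
  have "vec_norm n (mat_apply n B u) \<le> vec_norm n u" for u
  proof -
    define w where "w = mat_apply n B u"
    have s: "\<beta> u w = (vec_norm n w)\<^sup>2"
      by (simp add: \<beta>_def w_def vec_norm_power2 power2_norm_eq_inner)
    have "0 \<le> \<beta> u u - 2 * \<beta> u w + \<beta> w w"
      using pos[of "\<lambda>i. u i - w i"] \<beta>_diff[of u w] \<beta>_sym[of w u] by (simp add: \<beta>_def)
    moreover have "\<beta> u u \<le> (vec_norm n u)\<^sup>2" "\<beta> w w \<le> (vec_norm n w)\<^sup>2"
      using le[of u] le[of w] by (simp_all add: \<beta>_def vec_norm_power2)
    ultimately have "(vec_norm n w)\<^sup>2 \<le> (vec_norm n u)\<^sup>2"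
      using s by linarith
    then show ?thesis
      unfolding w_def by (rule power2_le_imp_le) simp
  qed
  then show ?thesis
    by (simp add: mat_bound_def)
qed

text \<open>The fixed points of \<open>Y \<mapsto> (B + Y\<^sup>2) / 2\<close> satisfy \<open>(1 - Y)\<^sup>2 = 1 - B\<close>. For a contraction \<open>B\<close>
  the increments of the iteration are bounded by those of the scalar iteration with \<open>B = 1\<close>.\<close>

primrec sqrt_iter :: "nat \<Rightarrow> (nat \<Rightarrow> nat \<Rightarrow> ('h::real_normed_vector \<Rightarrow>\<^sub>L 'h)) \<Rightarrow> nat \<Rightarrow>
    nat \<Rightarrow> nat \<Rightarrow> ('h \<Rightarrow>\<^sub>L 'h)" where
  "sqrt_iter n B 0 = (\<lambda>i j. 0)"
| "sqrt_iter n B (Suc m) = (\<lambda>i j. (1/2) *\<^sub>R (B i j + mat_mult n (sqrt_iter n B m) (sqrt_iter n B m) i j))"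

primrec sqrt_iter1 :: "nat \<Rightarrow> real" where
  "sqrt_iter1 0 = 0"
| "sqrt_iter1 (Suc m) = (1 + (sqrt_iter1 m)\<^sup>2) / 2"

lemma sqrt_iter1_bounds: "0 \<le> sqrt_iter1 m \<and> sqrt_iter1 m \<le> 1"
proof (induction m)
  case (Suc m)
  then have "(sqrt_iter1 m)\<^sup>2 \<le> 1"
    by (simp add: power_le_one)
  then show ?case by simp
qed simp

lemma sqrt_iter1_le_Suc: "sqrt_iter1 m \<le> sqrt_iter1 (Suc m)"
proof -
  have "0 \<le> (1 - sqrt_iter1 m)\<^sup>2" by simp
  then show ?thesis by (simp add: power2_diff)
qed

lemma sqrt_iter_bound:
  assumes B: "mat_bound n 1 B"
  shows "mat_bound n (sqrt_iter1 m) (sqrt_iter n B m)"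
proof (induction m)
  case (Suc m)
  have "mat_bound n (\<bar>1/2\<bar> * (1 + sqrt_iter1 m * sqrt_iter1 m)) (sqrt_iter n B (Suc m))"
    unfolding sqrt_iter.simps by (intro mat_bound_scaleR mat_bound_add mat_bound_mult B Suc.IH)
  then show ?case
    by (simp add: power2_eq_square)
qed (simp add: mat_bound_zero)

text \<open>Y Y - Z Z = Y (Y - Z) + (Y - Z) Z holds in any ring, commutative or not. The scalar
  iteration satisfies the same recursion with equality, so the bounds propagate.\<close>

lemma sqrt_iter_diff_bound:
  assumes B: "mat_bound n 1 B"
  shows "mat_bound n (sqrt_iter1 (Suc m) - sqrt_iter1 m)
     (\<lambda>i j. sqrt_iter n B (Suc m) i j - sqrt_iter n B m i j)"
proof (induction m)
  case 0
  have "mat_bound n (\<bar>1/2\<bar> * 1) (\<lambda>i j. (1/2) *\<^sub>R B i j)"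
    by (intro mat_bound_scaleR B)
  then show ?case
    by (simp add: mat_mult_def)
next
  case (Suc m)
  define D where "D = (\<lambda>i j. sqrt_iter n B (Suc m) i j - sqrt_iter n B m i j)"
  define d where "d = sqrt_iter1 (Suc m) - sqrt_iter1 m"
  have D: "mat_bound n d D"
    using Suc.IH by (simp only: D_def d_def)
  let ?Y = "sqrt_iter n B (Suc m)" and ?Z = "sqrt_iter n B m"
  have "sqrt_iter n B (Suc (Suc m)) i j - ?Y i j =
      (1/2) *\<^sub>R (mat_mult n ?Y D i j + mat_mult n D ?Z i j)" for i j
  proof -
    have "sqrt_iter n B (Suc (Suc m)) i j - ?Y i j =
        (1/2) *\<^sub>R (mat_mult n ?Y ?Y i j - mat_mult n ?Z ?Z i j)"
      unfolding sqrt_iter.simps(2)[of n B "Suc m"] sqrt_iter.simps(2)[of n B m]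
      by (simp only: scaleR_diff_right[symmetric] add_diff_cancel_left)
    also have "mat_mult n ?Y ?Y i j - mat_mult n ?Z ?Z i j = mat_mult n ?Y D i j + mat_mult n D ?Z i j"
      unfolding mat_mult_def D_def sum_subtractf[symmetric] sum.distrib[symmetric]
      by (intro sum.cong refl)
        (simp only: bounded_bilinear.diff_left[OF bounded_bilinear_blinfun_compose]
          bounded_bilinear.diff_right[OF bounded_bilinear_blinfun_compose], simp)
    finally show ?thesis .
  qed
  moreover have "mat_bound n (\<bar>1/2\<bar> * (sqrt_iter1 (Suc m) * d + d * sqrt_iter1 m))
      (\<lambda>i j. (1/2) *\<^sub>R (mat_mult n ?Y D i j + mat_mult n D ?Z i j))"
    by (intro mat_bound_scaleR mat_bound_add mat_bound_mult D sqrt_iter_bound[OF B])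
  moreover have "\<bar>1/2\<bar> * (sqrt_iter1 (Suc m) * d + d * sqrt_iter1 m) =
      sqrt_iter1 (Suc (Suc m)) - sqrt_iter1 (Suc m)"
    unfolding d_def sqrt_iter1.simps(2)[of "Suc m"]
    by (simp add: power2_eq_square field_simps)
  ultimately show ?case
    by (simp only:)
qed

text \<open>The increments may decay slower than any geometric sequence; they are summable because
  their majorants telescope to a convergent sequence.\<close>

lemma convergent_if_increments_le:
  fixes u :: "nat \<Rightarrow> 'b::banach" and r :: "nat \<Rightarrow> real"
  assumes r: "convergent r" and le: "\<And>m. norm (u (Suc m) - u m) \<le> r (Suc m) - r m"
  shows "convergent u"
proof -
  have "summable (\<lambda>m. r (Suc m) - r m)"
    using r telescope_summable unfolding convergent_def by blast
  then have "summable (\<lambda>m. u (Suc m) - u m)"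
    by (rule summable_comparison_test'[where N = 0]) (use le in auto)
  then have "convergent (\<lambda>m. \<Sum>k<m. u (Suc k) - u k)"
    by (simp add: summable_iff_convergent)
  then have "convergent (\<lambda>m. u m - u 0)"
    by (simp add: sum_lessThan_telescope)
  then show ?thesis
    using convergent_diff_const_right_iff by blast
qed

lemma sqrt_iter_convergent:
  fixes B :: "nat \<Rightarrow> nat \<Rightarrow> ('h::banach \<Rightarrow>\<^sub>L 'h)"
  assumes B: "mat_bound n 1 B" and ij: "i < n" "j < n"
  shows "convergent (\<lambda>m. sqrt_iter n B m i j)"
proof (rule convergent_if_increments_le)
  show "convergent sqrt_iter1"
    using Bseq_monoseq_convergent[of sqrt_iter1] sqrt_iter1_bounds sqrt_iter1_le_Suc
    by (metis BseqI' abs_of_nonneg incseq_SucI incseq_imp_monoseq real_norm_def)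
  show "norm (sqrt_iter n B (Suc m) i j - sqrt_iter n B m i j) \<le> sqrt_iter1 (Suc m) - sqrt_iter1 m" for m
    by (rule mat_bound_entry[OF sqrt_iter_diff_bound[OF B] ij])
qed

definition id_mat :: "nat \<Rightarrow> nat \<Rightarrow> ('h::real_normed_vector \<Rightarrow>\<^sub>L 'h)" where
  "id_mat i j = (if i = j then id_blinfun else 0)"

text \<open>Under the fixed point equation 2 L = B + L L the right-hand side collapses to 1 -
  B.\<close>

lemma mat_mult_id_minus:
  fixes L :: "nat \<Rightarrow> nat \<Rightarrow> ('a::real_normed_vector \<Rightarrow>\<^sub>L 'a)"
  assumes "i < n" "j < n"
  shows "mat_mult n (\<lambda>i j. id_mat i j - L i j) (\<lambda>i j. id_mat i j - L i j) i j =
    id_mat i j - 2 *\<^sub>R L i j + mat_mult n L L i j"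
proof -
  interpret c: bounded_bilinear "blinfun_compose :: ('a \<Rightarrow>\<^sub>L 'a) \<Rightarrow> ('a \<Rightarrow>\<^sub>L 'a) \<Rightarrow> ('a \<Rightarrow>\<^sub>L 'a)"
    by (rule bounded_bilinear_blinfun_compose)
  have "(\<Sum>k<n. id_mat i k o\<^sub>L M k) = M i" "(\<Sum>k<n. M k o\<^sub>L id_mat k j) = M j"
    for M :: "nat \<Rightarrow> ('a \<Rightarrow>\<^sub>L 'a)"
  proof -
    have "(\<Sum>k<n. id_mat i k o\<^sub>L M k) = (\<Sum>k<n. if k = i then M i else 0)"
      by (rule sum.cong) (auto simp: id_mat_def c.zero_left intro!: blinfun_eqI)
    then show "(\<Sum>k<n. id_mat i k o\<^sub>L M k) = M i"
      using assms by simp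
    have "(\<Sum>k<n. M k o\<^sub>L id_mat k j) = (\<Sum>k<n. if k = j then M j else 0)"
      by (rule sum.cong) (auto simp: id_mat_def c.zero_right intro!: blinfun_eqI)
    then show "(\<Sum>k<n. M k o\<^sub>L id_mat k j) = M j"
      using assms by simp
  qed
  note id = this
  show ?thesis
    unfolding mat_mult_def c.diff_left c.diff_right sum_subtractf id
    by (simp add: scaleR_2 algebra_simps)
qed

lemma compose_scaleR:
  "(a *\<^sub>R S) o\<^sub>L (b *\<^sub>R T) = (a * b) *\<^sub>R (S o\<^sub>L T)"
  by (rule blinfun_eqI) (simp add: blinfun.scaleR_left blinfun.scaleR_right)

text \<open>For K large, B = 1 - A / K lies between 0 and 1, hence is a contraction. The limit L of
  the iteration satisfies (1 - L)(1 - L) = A / K, so \<open>sqrt K\<close> times 1 - L is a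
  self-adjoint square root of A. Since the entries are bounded, one K serves all x.\<close>

lemma wmfuns_mat_positiveI:
  fixes A :: "nat \<Rightarrow> nat \<Rightarrow> 'x::topological_space \<Rightarrow> ('h::chilbert_space \<Rightarrow>\<^sub>L 'h)"
  assumes sep: "separable_space (euclidean :: 'h topology)"
    and wm: "\<And>i j. i < n \<Longrightarrow> j < n \<Longrightarrow> A i j \<in> wmfuns"
    and adj: "\<And>i j x u w. i < n \<Longrightarrow> j < n \<Longrightarrow>
      cinner (blinfun_apply (A i j x) u) w = cinner u (blinfun_apply (A j i x) w)"
    and pos: "\<And>x v. 0 \<le> Re (\<Sum>i<n. \<Sum>j<n. cinner (blinfun_apply (A i j x) (v j)) (v i))"
  shows "wmfuns_mat_positive n A"
proof -
  have "\<exists>C. \<forall>i\<in>{..<n}. \<forall>j\<in>{..<n}. \<forall>x. norm (A i j x) \<le> C"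
  proof -
    have "bounded (\<Union>i\<in>{..<n}. \<Union>j\<in>{..<n}. range (A i j))"
      using wm by (intro bounded_UN finite_lessThan ballI) (auto simp: wmfuns_def)
    then show ?thesis
      unfolding bounded_iff by fastforce
  qed
  then obtain C where C: "\<And>i j x. i < n \<Longrightarrow> j < n \<Longrightarrow> norm (A i j x) \<le> C"
    by blast
  \<comment> \<open>The form of A has n * n terms, each at most \<open>\<bar>C\<bar>\<close> times
    the squared norm of v. The summand 1 keeps K positive when n or C is 0; the absolute value
    covers n = 0, where C is unconstrained.\<close>
  define K where "K = real n * (real n * \<bar>C\<bar>) + 1"
  have K: "K > 0"
    by (simp add: K_def add_nonneg_pos)
  define q where "q x v = (\<Sum>i<n. mat_apply n (\<lambda>i j. A i j x) v i \<bullet> v i)" for x v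
  have q_eq: "q x v = Re (\<Sum>i<n. \<Sum>j<n. cinner (blinfun_apply (A i j x) (v j)) (v i))" for x v
    by (simp add: q_def mat_apply_def inner_eq_Re_cinner cinner.sum_left)
  have q_le: "q x v \<le> K * (\<Sum>i<n. (norm (v i))\<^sup>2)" for x v
  proof -
    define V where "V = (\<Sum>i<n. (norm (v i))\<^sup>2)"
    have V: "(norm (v i))\<^sup>2 \<le> V" if "i < n" for i
      unfolding V_def using that by (intro member_le_sum) auto
    have "q x v = (\<Sum>i<n. \<Sum>j<n. blinfun_apply (A i j x) (v j) \<bullet> v i)"
      by (simp add: q_def mat_apply_def inner_sum_left)
    also have "\<dots> \<le> (\<Sum>i<n. \<Sum>j<n. \<bar>C\<bar> * V)"
    proof (intro sum_mono)
      fix i j assume "i \<in> {..<n}" "j \<in> {..<n}"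
      then have ij: "i < n" "j < n" by auto
      have "blinfun_apply (A i j x) (v j) \<bullet> v i \<le> norm (blinfun_apply (A i j x) (v j)) * norm (v i)"
        by (rule norm_cauchy_schwarz)
      also have "\<dots> \<le> (\<bar>C\<bar> * norm (v j)) * norm (v i)"
      proof (intro mult_right_mono norm_ge_zero)
        have "norm (blinfun_apply (A i j x) (v j)) \<le> norm (A i j x) * norm (v j)"
          by (rule norm_blinfun)
        also have "\<dots> \<le> \<bar>C\<bar> * norm (v j)"
          using C[OF ij, of x] by (intro mult_right_mono) auto
        finally show "norm (blinfun_apply (A i j x) (v j)) \<le> \<bar>C\<bar> * norm (v j)" .
      qed
      also have "\<dots> = \<bar>C\<bar> * (norm (v j) * norm (v i))"
        by simp
      also have "\<dots> \<le> \<bar>C\<bar> * V"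
      proof (rule mult_left_mono)
        show "norm (v j) * norm (v i) \<le> V"
          using V[OF ij(1)] V[OF ij(2)] sum_squares_bound[of "norm (v j)" "norm (v i)"] by simp
      qed simp
      finally show "blinfun_apply (A i j x) (v j) \<bullet> v i \<le> \<bar>C\<bar> * V" .
    qed
    also have "\<dots> \<le> K * V"
      using sum_nonneg[of "{..<n}" "\<lambda>i. (norm (v i))\<^sup>2"]
      by (simp add: K_def V_def distrib_right)
    finally show ?thesis by (simp add: V_def)
  qed
  define B where "B x = (\<lambda>i j. id_mat i j - (1 / K) *\<^sub>R A i j x)" for x
  have B: "mat_bound n 1 (B x)" for x
  proof (rule contraction_if_between_0_1)
    have sym: "blinfun_apply (A i j x) u \<bullet> w = u \<bullet> blinfun_apply (A j i x) w" if "i < n" "j < n" for i j u w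
      using adj[OF that] by (simp add: inner_eq_Re_cinner)
    show "blinfun_apply (B x i j) u \<bullet> w = u \<bullet> blinfun_apply (B x j i) w" if "i < n" "j < n" for i j u w
      using sym[OF that]
      by (simp add: B_def id_mat_def blinfun.diff_left blinfun.scaleR_left inner_diff_left inner_diff_right)
    have form: "(\<Sum>i<n. mat_apply n (B x) v i \<bullet> v i) = (\<Sum>i<n. (norm (v i))\<^sup>2) - q x v / K" for v
    proof -
      have "mat_apply n (B x) v i = v i - (1 / K) *\<^sub>R mat_apply n (\<lambda>i j. A i j x) v i" if "i < n" for i
      proof -
        have "(\<Sum>j<n. blinfun_apply (id_mat i j) (v j)) = (\<Sum>j<n. if j = i then v i else 0)"
          by (rule sum.cong) (auto simp: id_mat_def)
        then show ?thesis
          using that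
          by (simp add: mat_apply_def B_def blinfun.diff_left blinfun.scaleR_left sum_subtractf scaleR_sum_right)
      qed
      then show ?thesis
        by (simp add: q_def inner_diff_left sum_subtractf power2_norm_eq_inner sum_divide_distrib)
    qed
    show "0 \<le> (\<Sum>i<n. mat_apply n (B x) v i \<bullet> v i)" for v
      using q_le[of x v] K unfolding form by (simp add: divide_le_eq mult.commute)
    show "(\<Sum>i<n. mat_apply n (B x) v i \<bullet> v i) \<le> (\<Sum>i<n. (norm (v i))\<^sup>2)" for v
      using pos[where x = x and v = v] K unfolding form q_eq by simp
  qed
  have id_bops: "(id_mat i j :: 'h \<Rightarrow>\<^sub>L 'h) \<in> bops" for i j
    by (simp add: id_mat_def)
  define Y where "Y m x = sqrt_iter n (B x) m" for m x
  define L where "L x i j = lim (\<lambda>m. Y m x i j)" for x i j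
  have lim: "(\<lambda>m. Y m x i j) \<longlonglongrightarrow> L x i j" if "i < n" "j < n" for x i j
    using sqrt_iter_convergent[OF B that] unfolding Y_def L_def by (simp add: convergent_LIMSEQ_iff)
  \<comment> \<open>The properties are proved together: measurability of a product uses complex
    linearity of its factors, and the adjoint of entry (i, j) is entry (j, i), which is why i and j
    vary in the induction.\<close>
  have Y_props: "(\<forall>x. Y m x i j \<in> bops) \<and> weakly_measurable (\<lambda>x. Y m x i j) \<and>
      (\<forall>x u w. cinner (blinfun_apply (Y m x i j) u) w = cinner u (blinfun_apply (Y m x j i) w))"
    if "i < n" "j < n" for m i j
    using that
  proof (induction m arbitrary: i j)
    case 0
    then show ?case
      by (simp add: Y_def weakly_measurable_const cinner.zero_left cinner.zero_right)
  next
    case (Suc m)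
    have YS: "Y (Suc m) x i j = (1/2) *\<^sub>R (B x i j + (\<Sum>k<n. Y m x i k o\<^sub>L Y m x k j))" for x i j
      by (simp add: Y_def mat_mult_def)
    have IH: "Y m x i j \<in> bops" "weakly_measurable (\<lambda>x. Y m x i j)"
        "cinner (blinfun_apply (Y m x i j) u) w = cinner u (blinfun_apply (Y m x j i) w)"
      if "i < n" "j < n" for i j x u w
      using Suc.IH[OF that] by blast+
    have Bb: "B x i j \<in> bops" for x
      using wm[OF Suc.prems] unfolding B_def by (intro bops_diff bops_scaleR id_bops) (auto simp: wmfuns_def)
    have Bm: "weakly_measurable (\<lambda>x. B x i j)"
      using wm[OF Suc.prems] unfolding B_def wmfuns_def
      by (intro weakly_measurable_diff weakly_measurable_scaleR weakly_measurable_const) auto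
    have Badj: "cinner (blinfun_apply (B x i j) u) w = cinner u (blinfun_apply (B x j i) w)" for x u w
      using adj[OF Suc.prems]
      by (simp add: B_def id_mat_def blinfun.diff_left blinfun.scaleR_left cinner.diff_left
          cinner.diff_right cinner.scaleR_left cinner.scaleR_right blinfun.zero_left
          cinner.zero_left cinner.zero_right)
    have "cinner (blinfun_apply (Y (Suc m) x i j) u) w = cinner u (blinfun_apply (Y (Suc m) x j i) w)" for x u w
      unfolding YS using Suc.prems
      by (simp add: blinfun.scaleR_left blinfun.add_left blinfun.sum_left cinner.scaleR_left
          cinner.scaleR_right cinner_add_left cinner_add_right Badj cinner.sum_left cinner.sum_right IH)
    moreover have "\<forall>x. Y (Suc m) x i j \<in> bops"
      unfolding YS using Suc.prems
      by (intro allI bops_scaleR bops_add bops_sum bops_compose IH Bb) auto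
    moreover have "weakly_measurable (\<lambda>x. Y (Suc m) x i j)"
      unfolding YS using Suc.prems
      by (intro weakly_measurable_scaleR weakly_measurable_add weakly_measurable_sum
          weakly_measurable_compose[OF sep] IH Bm) auto
    ultimately show ?case by blast
  qed
  have Lb: "L x i j \<in> bops" if "i < n" "j < n" for x i j
    by (rule bops_limit[OF _ lim[OF that]]) (use Y_props[OF that] in blast)
  have Lm: "weakly_measurable (\<lambda>x. L x i j)" if "i < n" "j < n" for i j
    by (rule weakly_measurable_LIMSEQ[OF _ lim[OF that]]) (use Y_props[OF that] in blast)
  have Ladj: "cinner (blinfun_apply (L x i j) u) w = cinner u (blinfun_apply (L x j i) w)"
    if "i < n" "j < n" for i j x u w
  proof (rule LIMSEQ_unique)
    show "(\<lambda>m. cinner (blinfun_apply (Y m x i j) u) w) \<longlonglongrightarrow> cinner (blinfun_apply (L x i j) u) w"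
      by (intro cinner.tendsto blinfun.tendsto tendsto_const lim that)
    have "(\<lambda>m. cinner u (blinfun_apply (Y m x j i) w)) \<longlonglongrightarrow> cinner u (blinfun_apply (L x j i) w)"
      by (intro cinner.tendsto blinfun.tendsto tendsto_const lim that)
    then show "(\<lambda>m. cinner (blinfun_apply (Y m x i j) u) w) \<longlonglongrightarrow> cinner u (blinfun_apply (L x j i) w)"
      using Y_props[OF that] by simp
  qed
  have Lnorm: "norm (L x i j) \<le> 1" if "i < n" "j < n" for x i j
  proof (rule LIMSEQ_le_const2[OF tendsto_norm[OF lim[OF that]]])
    show "\<exists>N. \<forall>m\<ge>N. norm (Y m x i j) \<le> 1"
      using mat_bound_entry[OF sqrt_iter_bound[OF B] that] sqrt_iter1_bounds
      unfolding Y_def by (meson order_trans)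
  qed
  have Lfix: "2 *\<^sub>R L x i j = B x i j + mat_mult n (L x) (L x) i j" if "i < n" "j < n" for x i j
  proof (rule LIMSEQ_unique)
    show "(\<lambda>m. 2 *\<^sub>R Y (Suc m) x i j) \<longlonglongrightarrow> 2 *\<^sub>R L x i j"
      by (intro tendsto_intros LIMSEQ_Suc lim that)
    have "(\<lambda>m. B x i j + mat_mult n (Y m x) (Y m x) i j) \<longlonglongrightarrow> B x i j + mat_mult n (L x) (L x) i j"
      unfolding mat_mult_def using that
      by (intro tendsto_intros bounded_bilinear.tendsto[OF bounded_bilinear_blinfun_compose] lim) auto
    then show "(\<lambda>m. 2 *\<^sub>R Y (Suc m) x i j) \<longlonglongrightarrow> B x i j + mat_mult n (L x) (L x) i j"
      by (simp add: Y_def)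
  qed
  define G where "G i j x = sqrt K *\<^sub>R (id_mat i j - L x i j)" for i j x
  have Gb: "G i j x \<in> bops" if "i < n" "j < n" for i j x
    unfolding G_def by (intro bops_scaleR bops_diff id_bops Lb that)
  have Gwm: "G i j \<in> wmfuns" if "i < n" "j < n" for i j
  proof -
    have "norm (G i j x) \<le> sqrt K * 2" for x
    proof -
      have "norm (id_mat i j - L x i j) \<le> norm (id_mat i j :: 'h \<Rightarrow>\<^sub>L 'h) + norm (L x i j)"
        by (rule norm_triangle_ineq4)
      also have "norm (id_mat i j :: 'h \<Rightarrow>\<^sub>L 'h) \<le> 1"
        using norm_blinfun_id_le by (auto simp: id_mat_def)
      finally show ?thesis
        using Lnorm[OF that, of x] K by (simp add: G_def mult_left_mono)
    qed
    then have "bounded (range (G i j))"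
      by (auto simp: bounded_iff)
    moreover have "weakly_measurable (G i j)"
      unfolding G_def
      by (intro weakly_measurable_scaleR weakly_measurable_diff weakly_measurable_const Lm that)
    ultimately show ?thesis
      using Gb[OF that] by (simp add: wmfuns_def)
  qed
  have Gadj: "cadjoint (G i j x) = G j i x" if "i < n" "j < n" for i j x
  proof (rule cadjoint_eqI)
    show "G j i x \<in> bops" by (intro Gb that)
    show "cinner (blinfun_apply (G i j x) u) w = cinner u (blinfun_apply (G j i x) w)" for u w
      using Ladj[OF that, of x u w]
      by (simp add: G_def id_mat_def blinfun.diff_left blinfun.scaleR_left cinner.diff_left
          cinner.diff_right cinner.scaleR_left cinner.scaleR_right blinfun.zero_left
          cinner.zero_left cinner.zero_right)
  qed
  have GG: "A i j x = (\<Sum>k<n. cadjoint (G k i x) o\<^sub>L G k j x)" if "i < n" "j < n" for i j x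
  proof -
    have "(\<Sum>k<n. cadjoint (G k i x) o\<^sub>L G k j x) = (\<Sum>k<n. G i k x o\<^sub>L G k j x)"
      using that by (intro sum.cong refl) (simp add: Gadj)
    also have "\<dots> = K *\<^sub>R mat_mult n (\<lambda>i j. id_mat i j - L x i j) (\<lambda>i j. id_mat i j - L x i j) i j"
      using K by (simp add: G_def mat_mult_def compose_scaleR scaleR_sum_right)
    also have "\<dots> = K *\<^sub>R (id_mat i j - B x i j)"
      unfolding mat_mult_id_minus[OF that] Lfix[OF that] by simp
    also have "\<dots> = A i j x"
      using K by (simp add: B_def)
    finally show ?thesis by simp
  qed
  show ?thesis
    unfolding wmfuns_mat_positive_def
    using Gwm GG by (intro exI[of _ G]) auto
qed


subsection \<open>Riemann sums over a countable base\<close>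

text \<open>One enumeration is chosen for the whole type, so that atoms and tags are the same for
  every QPM; in particular they do not vary with x in a channel.\<close>

definition base_seq :: "nat \<Rightarrow> 'a::second_countable_topology set" where
  "base_seq = (SOME B. topological_basis (range B))"

lemma base_seq: "topological_basis (range (base_seq :: nat \<Rightarrow> 'a::second_countable_topology set))"
proof -
  obtain B :: "'a set set" where B: "countable B" "topological_basis B"
    using ex_countable_basis by auto
  then have "B \<noteq> {}"
    using topological_basisE[OF B(2) open_UNIV UNIV_I] by blast
  then have "range (from_nat_into B) = B"
    using B(1) by (rule range_from_nat_into)
  with B(2) show ?thesis
    unfolding base_seq_def by (metis someI_ex)
qed

text \<open>Only the part of \<open>S\<close> below m matters, and distinct subsets of
  \<open>{..<m}\<close> give disjoint atoms; sums therefore run over \<open>Pow {..<m}\<close>. Some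
  of these atoms may be empty.\<close>

definition atom :: "nat \<Rightarrow> nat set \<Rightarrow> 'a::second_countable_topology set" where
  "atom m S = {a. \<forall>i<m. a \<in> base_seq i \<longleftrightarrow> i \<in> S}"

text \<open>An empty atom receives an unspecified point; its term in a Riemann sum is weighted by
  the value on the empty set, which is 0 for a measure.\<close>

definition atom_tag :: "nat \<Rightarrow> nat set \<Rightarrow> 'a::second_countable_topology" where
  "atom_tag m S = (SOME a. a \<in> atom m S)"

definition atom_index :: "nat \<Rightarrow> 'a::second_countable_topology \<Rightarrow> nat set" where
  "atom_index m a = {i. i < m \<and> a \<in> base_seq i}"

lemma atom_borel [measurable]: "atom m S \<in> sets borel"
proof -
  have [measurable]: "base_seq i \<in> sets borel" for i
    using base_seq topological_basis_open by (intro borel_open) blast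
  have "atom m S = {a \<in> space borel. \<forall>i\<in>{..<m}. a \<in> base_seq i \<longleftrightarrow> i \<in> S}"
    by (auto simp: atom_def)
  also have "\<dots> \<in> sets borel"
    by measurable
  finally show ?thesis .
qed

lemma atom_iff: "S \<subseteq> {..<m} \<Longrightarrow> a \<in> atom m S \<longleftrightarrow> S = atom_index m a"
  by (auto simp: atom_def atom_index_def)

lemma atom_index_subset: "atom_index m a \<in> Pow {..<m}"
  by (auto simp: atom_index_def)

lemma mem_atom_index: "a \<in> atom m (atom_index m a)"
  using atom_index_subset[of m a] by (simp add: atom_iff)

lemma atom_tag_mem:
  fixes a :: "'a::second_countable_topology"
  shows "a \<in> atom m S \<Longrightarrow> (atom_tag m S :: 'a) \<in> atom m S"
  unfolding atom_tag_def by (rule someI[of "\<lambda>a. a \<in> atom m S"])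

lemma disjoint_atoms: "S \<in> Pow {..<m} \<Longrightarrow> T \<in> Pow {..<m} \<Longrightarrow> S \<noteq> T \<Longrightarrow> atom m S \<inter> atom m T = {}"
  by (auto simp: atom_iff)

definition atom_osc_le :: "nat \<Rightarrow> ('a::second_countable_topology \<Rightarrow> complex) \<Rightarrow> real \<Rightarrow> bool" where
  "atom_osc_le m f e \<longleftrightarrow> (\<forall>S. \<forall>a\<in>atom m S. \<forall>b\<in>atom m S. cmod (f a - f b) \<le> e)"

text \<open>By compactness finitely many base sets, each mapped by f into a ball of radius e / 2,
  cover the space. Once m exceeds their indices, two points of an atom lie in a common one of
  them.\<close>

lemma eventually_atom_osc_le:
  fixes f :: "'a::second_countable_topology \<Rightarrow> complex"
  assumes cpt: "compact (UNIV :: 'a set)" and f: "continuous_on UNIV f" and e: "e > 0"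
  shows "eventually (\<lambda>m. atom_osc_le m f e) sequentially"
proof -
  define J where "J = {i. \<exists>c. f ` base_seq i \<subseteq> ball c (e / 2)}"
  have "\<exists>i\<in>J. a \<in> base_seq i" for a :: 'a
  proof -
    have "open (f -` ball (f a) (e / 2))"
      using f by (intro open_vimage) auto
    moreover have "a \<in> f -` ball (f a) (e / 2)"
      using e by simp
    ultimately obtain B where "B \<in> range base_seq" "a \<in> B" "B \<subseteq> f -` ball (f a) (e / 2)"
      using topological_basisE[OF base_seq] by metis
    then show ?thesis
      unfolding J_def by (auto simp: subset_eq)
  qed
  then have "(UNIV :: 'a set) \<subseteq> (\<Union>i\<in>J. base_seq i)"
    by auto
  moreover have "open (base_seq i :: 'a set)" for i :: nat
    using base_seq topological_basis_open by blast
  ultimately obtain C where C: "C \<subseteq> J" "finite C" "(UNIV :: 'a set) \<subseteq> (\<Union>i\<in>C. base_seq i)"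
    using compactE_image[OF cpt, of J base_seq] by metis
  obtain M where M: "\<And>i. i \<in> C \<Longrightarrow> i < M"
    using C(2) finite_nat_bounded by (metis lessThan_iff subset_eq)
  have "atom_osc_le m f e" if "M \<le> m" for m
    unfolding atom_osc_le_def
  proof (intro allI ballI)
    fix S and a b :: 'a assume ab: "a \<in> atom m S" "b \<in> atom m S"
    obtain i where i: "i \<in> C" "a \<in> base_seq i"
      using C(3) by auto
    then have "b \<in> base_seq i"
      using ab M[OF i(1)] that by (auto simp: atom_def)
    moreover obtain c where "f ` base_seq i \<subseteq> ball c (e / 2)"
      using i C(1) by (auto simp: J_def)
    ultimately have "dist c (f a) < e / 2" "dist c (f b) < e / 2"
      using i(2) by auto
    then have "dist (f a) (f b) \<le> e"
      using dist_triangle3[of "f a" "f b" c] by linarith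
    then show "cmod (f a - f b) \<le> e"
      by (simp add: dist_norm)
  qed
  then show ?thesis
    by (auto simp: eventually_sequentially)
qed

section \<open>Integrals as limits of Riemann sums\<close>

lemma cfuns_bounded:
  fixes f :: "'a::topological_space \<Rightarrow> complex"
  assumes "compact (UNIV :: 'a set)" "f \<in> cfuns"
  obtains C where "0 \<le> C" "\<And>a. cmod (f a) \<le> C"
proof -
  have "compact (range f)"
    using assms by (auto simp: cfuns_def intro: compact_continuous_image)
  then have "bounded (range f)"
    by (rule compact_imp_bounded)
  then obtain C where "\<And>a. cmod (f a) \<le> C"
    unfolding bounded_iff by blast
  then show thesis
    using that[of C] norm_ge_zero order_trans by blast
qed

lemma cfuns_measurable: "f \<in> cfuns \<Longrightarrow> sets M = sets borel \<Longrightarrow> f \<in> borel_measurable M"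
  by (simp add: cfuns_def borel_measurable_continuous_onI cong: measurable_cong_sets)

lemma cfuns_integrable:
  fixes f :: "'a::topological_space \<Rightarrow> complex"
  assumes "compact (UNIV :: 'a set)" "f \<in> cfuns" "finite_measure M" "sets M = sets borel"
  shows "integrable M f"
proof -
  obtain C where "\<And>a. cmod (f a) \<le> C"
    using cfuns_bounded assms(1,2) by blast
  then show ?thesis
    using assms by (intro finite_measure.integrable_const_bound[where B = C])
      (auto intro: cfuns_measurable)
qed

definition riemann_sum :: "('a::second_countable_topology \<Rightarrow> complex) \<Rightarrow> ('a set \<Rightarrow> complex) \<Rightarrow> nat \<Rightarrow> complex" where
  "riemann_sum f \<mu> m = (\<Sum>S\<in>Pow {..<m}. f (atom_tag m S) * \<mu> (atom m S))"

lemma sum_measure_atoms: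
  fixes M :: "'a::second_countable_topology measure"
  assumes M: "finite_measure M" "sets M = sets borel"
  shows "(\<Sum>S\<in>Pow {..<m}. measure M (atom m S)) = measure M UNIV"
proof -
  interpret finite_measure M by fact
  have "measure M (\<Union>S\<in>Pow {..<m}. atom m S) = (\<Sum>S\<in>Pow {..<m}. measure M (atom m S))"
    by (rule finite_measure_finite_Union) (auto simp: M disjoint_family_on_def atom_iff)
  moreover have "(\<Union>S\<in>Pow {..<m}. atom m S :: 'a set) = UNIV"
    using atom_index_subset mem_atom_index by (intro set_eqI iffI UNIV_I UN_I)
  ultimately show ?thesis by simp
qed

text \<open>The Riemann sum is the integral of the step function g that takes the tag value of f on
  each atom, and f - g is bounded by e. The error depends on the measure only through its total
  mass, which later yields convergence in operator norm.\<close>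

lemma riemann_sum_error:
  fixes f :: "'a::second_countable_topology \<Rightarrow> complex"
  assumes cpt: "compact (UNIV :: 'a set)" and f: "f \<in> cfuns"
    and M: "finite_measure M" "sets M = sets borel" and osc: "atom_osc_le m f e"
  shows "cmod (integral\<^sup>L M f - riemann_sum f (\<lambda>\<alpha>. of_real (measure M \<alpha>)) m) \<le> e * measure M UNIV"
proof -
  interpret finite_measure M by fact
  have sp: "space M = UNIV"
    using sets_eq_imp_space_eq[OF M(2)] by simp
  define g where "g a = (\<Sum>S\<in>Pow {..<m}. indicat_real (atom m S) a *\<^sub>R f (atom_tag m S))" for a :: 'a
  have g_eq: "g a = f (atom_tag m (atom_index m a))" for a
  proof -
    have "g a = (\<Sum>S\<in>Pow {..<m}. if S = atom_index m a then f (atom_tag m S) else 0)"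
      unfolding g_def by (rule sum.cong) (auto simp: atom_iff indicator_def)
    then show ?thesis
      using atom_index_subset[of m a] by simp
  qed
  have int_ind: "integrable M (\<lambda>a. indicat_real (atom m S) a *\<^sub>R c)"
    "integral\<^sup>L M (\<lambda>a. indicat_real (atom m S) a *\<^sub>R c) = c * of_real (measure M (atom m S))" for c :: complex and S
    using M(2) by (simp_all add: emeasure_eq_measure sp scaleR_conv_of_real)
  have int_g: "integrable M g"
    unfolding g_def by (intro Bochner_Integration.integrable_sum int_ind)
  have "integral\<^sup>L M g = riemann_sum f (\<lambda>\<alpha>. of_real (measure M \<alpha>)) m"
    unfolding g_def riemann_sum_def by (subst Bochner_Integration.integral_sum) (auto simp only: int_ind)
  then have "integral\<^sup>L M f - riemann_sum f (\<lambda>\<alpha>. of_real (measure M \<alpha>)) m = integral\<^sup>L M (\<lambda>a. f a - g a)"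
    using int_g cfuns_integrable[OF cpt f M] by simp
  also have "cmod \<dots> \<le> integral\<^sup>L M (\<lambda>a. cmod (f a - g a))"
    by (rule integral_norm_bound)
  also have "\<dots> \<le> integral\<^sup>L M (\<lambda>a. e)"
  proof (rule integral_mono)
    show "integrable M (\<lambda>a. cmod (f a - g a))"
      using int_g cfuns_integrable[OF cpt f M] by simp
    show "cmod (f a - g a) \<le> e" for a
      using osc mem_atom_index[of a m] atom_tag_mem[OF mem_atom_index[of a m]]
      unfolding atom_osc_le_def g_eq by blast
  qed simp
  also have "\<dots> = e * measure M UNIV"
    by (simp add: sp)
  finally show ?thesis .
qed

lemma riemann_sum_tendsto_integral:
  fixes f :: "'a::second_countable_topology \<Rightarrow> complex"
  assumes cpt: "compact (UNIV :: 'a set)" and f: "f \<in> cfuns"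
    and M: "finite_measure M" "sets M = sets borel"
  shows "riemann_sum f (\<lambda>\<alpha>. of_real (measure M \<alpha>)) \<longlonglongrightarrow> integral\<^sup>L M f"
proof (rule tendstoI)
  fix e :: real assume e: "e > 0"
  \<comment> \<open>The added 1 avoids a zero denominator and makes the final inequality
    strict.\<close>
  define d where "d = e / (measure M UNIV + 1)"
  have pos: "measure M UNIV + 1 > 0"
    by (simp add: add_nonneg_pos)
  then have d: "d > 0" "d * measure M UNIV < e"
    using e by (simp_all add: d_def field_simps)
  show "\<forall>\<^sub>F m in sequentially. dist (riemann_sum f (\<lambda>\<alpha>. of_real (measure M \<alpha>)) m) (integral\<^sup>L M f) < e"
    using eventually_atom_osc_le[OF cpt f[unfolded cfuns_def mem_Collect_eq] d(1)]
  proof eventually_elim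
    case (elim m)
    show ?case
      using riemann_sum_error[OF cpt f M elim] d(2) by (simp add: dist_norm norm_minus_commute)
  qed
qed

text \<open>The Riemann sums involve \<mu> alone, so their limit shows that the integral is the same
  for every decomposition into four measures.\<close>

lemma has_cmeasure_integral_tendsto:
  fixes f :: "'a::second_countable_topology \<Rightarrow> complex"
  assumes cpt: "compact (UNIV :: 'a set)" and f: "f \<in> cfuns" and I: "has_cmeasure_integral \<mu> f I"
  shows "riemann_sum f \<mu> \<longlonglongrightarrow> I"
proof -
  obtain m1 m2 m3 m4 :: "'a measure" where
    m: "\<forall>m\<in>{m1, m2, m3, m4}. finite_measure m \<and> sets m = sets borel \<and> integrable m f" and
    \<mu>: "\<forall>\<alpha>\<in>sets borel. \<mu> \<alpha> =
           complex_of_real (measure m1 \<alpha> - measure m2 \<alpha>)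
           + \<i> * complex_of_real (measure m3 \<alpha> - measure m4 \<alpha>)" and
    I: "I = (integral\<^sup>L m1 f - integral\<^sup>L m2 f) + \<i> * (integral\<^sup>L m3 f - integral\<^sup>L m4 f)"
    using I unfolding has_cmeasure_integral_def by blast
  let ?R = "\<lambda>M. riemann_sum f (\<lambda>\<alpha>. of_real (measure M \<alpha>))"
  have "(\<lambda>m. (?R m1 m - ?R m2 m) + \<i> * (?R m3 m - ?R m4 m)) \<longlonglongrightarrow> I"
    unfolding I using m by (intro tendsto_intros riemann_sum_tendsto_integral[OF cpt f]) auto
  also have "(\<lambda>m. (?R m1 m - ?R m2 m) + \<i> * (?R m3 m - ?R m4 m)) = riemann_sum f \<mu>"
  proof
    fix m
    have "riemann_sum f \<mu> m = (\<Sum>S\<in>Pow {..<m}. f (atom_tag m S) *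
        (complex_of_real (measure m1 (atom m S) - measure m2 (atom m S))
           + \<i> * complex_of_real (measure m3 (atom m S) - measure m4 (atom m S))))"
      unfolding riemann_sum_def using \<mu> by (intro sum.cong refl) simp
    then show "(?R m1 m - ?R m2 m) + \<i> * (?R m3 m - ?R m4 m) = riemann_sum f \<mu> m"
      by (simp add: riemann_sum_def sum_distrib_left sum_subtractf[symmetric] sum.distrib[symmetric] algebra_simps)
  qed
  finally show ?thesis .
qed

subsection \<open>Integration against a quantum probability measure\<close>

text \<open>The factor 1/4 is absorbed into the vectors, which gives exactly the shape (m1 - m2) +
  \<open>\<i>\<close> (m3 - m4) demanded by \<open>has_cmeasure_integral\<close>.\<close>

lemma polarization_half:
  assumes "sesquilinear b"
  shows "b x y = b ((1/2) *\<^sub>R (x + y)) ((1/2) *\<^sub>R (x + y)) - b ((1/2) *\<^sub>R (x - y)) ((1/2) *\<^sub>R (x - y))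
    + \<i> * (b ((1/2) *\<^sub>R (x + \<i> *\<^sub>C y)) ((1/2) *\<^sub>R (x + \<i> *\<^sub>C y))
           - b ((1/2) *\<^sub>R (x - \<i> *\<^sub>C y)) ((1/2) *\<^sub>R (x - \<i> *\<^sub>C y)))"
proof -
  have half: "b ((1/2) *\<^sub>R z) ((1/2) *\<^sub>R z) = b z z / 4" for z
    by (simp add: sesquilinearD[OF assms] flip: scaleC_of_real)
  show ?thesis
    unfolding half using polarization[OF assms, of x y]
    by (simp add: polar_def diff_divide_distrib add_divide_distrib)
qed

lemma bops_eqI:
  fixes S T :: "'h::chilbert_space \<Rightarrow>\<^sub>L 'h"
  assumes "S \<in> bops" "T \<in> bops"
    and "\<And>z. cinner (blinfun_apply S z) z = cinner (blinfun_apply T z) z"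
  shows "S = T"
proof (rule blinfun_cinner_eqI)
  fix x y
  show "cinner (blinfun_apply S x) y = cinner (blinfun_apply T x) y"
    using polarization[OF sesquilinear_cinner_apply[OF assms(1)], of x y]
      polarization[OF sesquilinear_cinner_apply[OF assms(2)], of x y] assms(3) by simp
qed

text \<open>The type of bounded maps carries real scalars; this is multiplication by a complex
  one.\<close>

definition cscale_op :: "complex \<Rightarrow> ('h::chilbert_space \<Rightarrow>\<^sub>L 'h) \<Rightarrow> ('h \<Rightarrow>\<^sub>L 'h)" where
  "cscale_op c T = Blinfun (scaleC c) o\<^sub>L T"

lemma cscale_op_apply [simp]: "blinfun_apply (cscale_op c T) x = c *\<^sub>C blinfun_apply T x"
  by (simp add: cscale_op_def bounded_linear_Blinfun_apply scaleC.bounded_linear_right)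

lemma bops_cscale: "T \<in> bops \<Longrightarrow> cscale_op c T \<in> bops"
  by (simp add: bops_def scaleC_scaleC mult.commute)

definition qpm_sum :: "('a::second_countable_topology set \<Rightarrow> ('h::chilbert_space \<Rightarrow>\<^sub>L 'h)) \<Rightarrow>
    ('a \<Rightarrow> complex) \<Rightarrow> nat \<Rightarrow> ('h \<Rightarrow>\<^sub>L 'h)" where
  "qpm_sum E f m = (\<Sum>S\<in>Pow {..<m}. cscale_op (f (atom_tag m S)) (E (atom m S)))"

lemma cinner_qpm_sum:
  "cinner (blinfun_apply (qpm_sum E f m) x) y = riemann_sum f (qpm_coeff E x y) m"
  by (simp add: qpm_sum_def riemann_sum_def qpm_coeff_def blinfun.sum_left cinner.sum_left cinner_scaleC_left)

lemma qpm_sum_apply: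
  "blinfun_apply (qpm_sum E f m) x = (\<Sum>S\<in>Pow {..<m}. f (atom_tag m S) *\<^sub>C blinfun_apply (E (atom m S)) x)"
  by (simp add: qpm_sum_def blinfun.sum_left)

text \<open>Only diagonal coefficients are positive and thus measures; the other coefficients are
  reached through \<open>polarization_half\<close>.\<close>

definition diag_measure :: "('a::topological_space set \<Rightarrow> ('h::chilbert_space \<Rightarrow>\<^sub>L 'h)) \<Rightarrow> 'h \<Rightarrow> 'a measure" where
  "diag_measure E z = measure_of UNIV (sets borel) (\<lambda>\<alpha>. ennreal (Re (qpm_coeff E z z \<alpha>)))"

context
  fixes E :: "'a::topological_space set \<Rightarrow> ('h::chilbert_space \<Rightarrow>\<^sub>L 'h)"
  assumes E: "qpm E"
begin

lemma qpm_positive: "\<alpha> \<in> sets borel \<Longrightarrow> positive_op (E \<alpha>)"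
  using E by (simp add: qpm_def)

lemma qpm_bops: "\<alpha> \<in> sets borel \<Longrightarrow> E \<alpha> \<in> bops"
  using qpm_positive by (simp add: positive_op_def)

lemma qpm_UNIV: "E UNIV = id_blinfun"
  using E by (simp add: qpm_def)

lemma qpm_coeff_diag_real:
  assumes "\<alpha> \<in> sets borel"
  shows "qpm_coeff E z z \<alpha> = complex_of_real (Re (qpm_coeff E z z \<alpha>))" "0 \<le> Re (qpm_coeff E z z \<alpha>)"
proof -
  have "qpm_coeff E z z \<alpha> \<in> \<real>\<^sub>\<ge>\<^sub>0"
    using qpm_positive[OF assms] by (simp add: positive_op_def qpm_coeff_def)
  then show "qpm_coeff E z z \<alpha> = complex_of_real (Re (qpm_coeff E z z \<alpha>))" "0 \<le> Re (qpm_coeff E z z \<alpha>)"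
    by (auto simp: complex_nonneg_Reals_iff complex_eq_iff)
qed

lemma qpm_coeff_sums:
  fixes \<alpha> :: "nat \<Rightarrow> 'a set"
  assumes "range \<alpha> \<subseteq> sets borel" "disjoint_family \<alpha>"
  shows "(\<lambda>n. qpm_coeff E x y (\<alpha> n)) sums qpm_coeff E x y (\<Union>n. \<alpha> n)"
proof -
  \<comment> \<open>Sequences with a single nonzero term turn the normal functional of the weak*
    topology into one matrix coefficient.\<close>
  define \<xi> :: "nat \<Rightarrow> 'h" where "\<xi> k = (if k = 0 then x else 0)" for k
  define \<eta> :: "nat \<Rightarrow> 'h" where "\<eta> k = (if k = 0 then y else 0)" for k
  have fin: "summable (\<lambda>k. (norm (\<xi> k))\<^sup>2)" "summable (\<lambda>k. (norm (\<eta> k))\<^sup>2)"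
    by (rule summable_finite[of "{0}"]; simp add: \<xi>_def \<eta>_def)+
  have eval: "(\<Sum>k. cinner (blinfun_apply T (\<xi> k)) (\<eta> k)) = cinner (blinfun_apply T x) y" for T
    by (subst suminf_finite[of "{0}"]) (simp_all add: \<xi>_def \<eta>_def cinner.zero_right)
  have "weak_star_tendsto (\<lambda>N. \<Sum>n<N. E (\<alpha> n)) (E (\<Union>n. \<alpha> n)) sequentially"
    using E assms by (simp add: qpm_def)
  then have "(\<lambda>N. cinner (blinfun_apply (\<Sum>n<N. E (\<alpha> n)) x) y) \<longlonglongrightarrow> cinner (blinfun_apply (E (\<Union>n. \<alpha> n)) x) y"
    using fin unfolding weak_star_tendsto_def eval[symmetric] by blast
  then show ?thesis
    by (simp add: sums_def qpm_coeff_def blinfun.sum_left cinner.sum_left)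
qed

text \<open>The constant sequence of empty sets is disjoint, and a constant series converges only if
  its term is 0.\<close>

lemma qpm_coeff_empty: "qpm_coeff E x y {} = 0"
proof -
  have "(\<lambda>n::nat. qpm_coeff E x y {}) sums qpm_coeff E x y {}"
    using qpm_coeff_sums[of "\<lambda>_. {}" x y] by (simp add: disjoint_family_on_def)
  then show ?thesis
    using sums_summable summable_const_iff by blast
qed

lemma
  shows sets_diag_measure [simp, measurable_cong]: "sets (diag_measure E z) = sets borel"
    and space_diag_measure [simp]: "space (diag_measure E z) = UNIV"
    and emeasure_diag_measure:
      "\<alpha> \<in> sets borel \<Longrightarrow> emeasure (diag_measure E z) \<alpha> = ennreal (Re (qpm_coeff E z z \<alpha>))"
proof -
  have sa: "sigma_algebra UNIV (sets (borel :: 'a measure))"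
    using sets.sigma_algebra_axioms[of "borel :: 'a measure"] by simp
  then have ss: "sigma_sets UNIV (sets borel) = sets (borel :: 'a measure)"
    by (rule sigma_algebra.sigma_sets_eq)
  show s: "sets (diag_measure E z) = sets borel"
    unfolding diag_measure_def by (simp add: ss)
  show "space (diag_measure E z) = UNIV"
    unfolding diag_measure_def by simp
  assume \<alpha>: "\<alpha> \<in> sets borel"
  have "measure_space UNIV (sets borel) (\<lambda>\<alpha>. ennreal (Re (qpm_coeff E z z \<alpha>)))"
    unfolding measure_space_def
  proof (intro conjI sa)
    show "positive (sets borel) (\<lambda>\<alpha>. ennreal (Re (qpm_coeff E z z \<alpha>)))"
      by (simp add: positive_def qpm_coeff_empty)
    show "countably_additive (sets borel) (\<lambda>\<alpha>. ennreal (Re (qpm_coeff E z z \<alpha>)))"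
      unfolding countably_additive_def
    proof (intro allI impI)
      fix A :: "nat \<Rightarrow> 'a set"
      assume A: "range A \<subseteq> sets borel" "disjoint_family A" "\<Union> (range A) \<in> sets borel"
      have "(\<lambda>n. Re (qpm_coeff E z z (A n))) sums Re (qpm_coeff E z z (\<Union>n. A n))"
        by (rule sums_Re[OF qpm_coeff_sums[OF A(1,2)]])
      moreover have "0 \<le> Re (qpm_coeff E z z (A n))" for n
        using A(1) by (intro qpm_coeff_diag_real) auto
      ultimately show "(\<Sum>n. ennreal (Re (qpm_coeff E z z (A n)))) = ennreal (Re (qpm_coeff E z z (\<Union> (range A))))"
        by (simp add: suminf_ennreal2 sums_iff)
    qed
  qed
  then show "emeasure (diag_measure E z) \<alpha> = ennreal (Re (qpm_coeff E z z \<alpha>))"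
    using \<alpha> by (intro emeasure_measure_of[OF diag_measure_def])
       (auto simp: measure_space_def s)
qed

lemma measure_diag_measure:
  "\<alpha> \<in> sets borel \<Longrightarrow> complex_of_real (measure (diag_measure E z) \<alpha>) = qpm_coeff E z z \<alpha>"
  using qpm_coeff_diag_real[of \<alpha> z] by (simp add: measure_def emeasure_diag_measure)

lemma measure_diag_measure_UNIV: "measure (diag_measure E z) UNIV = (norm z)\<^sup>2"
proof -
  have "complex_of_real (measure (diag_measure E z) UNIV) = complex_of_real ((norm z)\<^sup>2)"
    by (simp add: measure_diag_measure qpm_coeff_def qpm_UNIV cinner_self)
  then show ?thesis
    using of_real_eq_iff by blast
qed

lemma finite_diag_measure: "finite_measure (diag_measure E z)"
  by (rule finite_measureI) (simp add: emeasure_diag_measure)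

lemma qpm_Un:
  assumes "\<alpha> \<in> sets borel" "\<beta> \<in> sets borel" "\<alpha> \<inter> \<beta> = {}"
  shows "E (\<alpha> \<union> \<beta>) = E \<alpha> + E \<beta>"
proof (rule bops_eqI)
  fix z
  interpret finite_measure "diag_measure E z" by (rule finite_diag_measure)
  have "complex_of_real (measure (diag_measure E z) (\<alpha> \<union> \<beta>)) =
      complex_of_real (measure (diag_measure E z) \<alpha>) + complex_of_real (measure (diag_measure E z) \<beta>)"
    using assms by (simp add: finite_measure_Union)
  then show "cinner (blinfun_apply (E (\<alpha> \<union> \<beta>)) z) z = cinner (blinfun_apply (E \<alpha> + E \<beta>) z) z"
    using assms by (simp add: measure_diag_measure qpm_coeff_def blinfun.add_left cinner_add_left)
qed (use assms qpm_bops in \<open>auto intro: bops_add\<close>)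

end

section \<open>The operator integral as a norm limit of sums\<close>

context
  fixes E :: "'a::second_countable_topology set \<Rightarrow> ('h::chilbert_space \<Rightarrow>\<^sub>L 'h)"
  assumes E: "qpm E" and cpt: "compact (UNIV :: 'a set)"
begin

lemma bops_qpm_sum: "qpm_sum E f m \<in> bops"
  unfolding qpm_sum_def by (intro bops_sum bops_cscale qpm_bops[OF E] atom_borel)

lemma riemann_sum_diag:
  "riemann_sum f (qpm_coeff E z z) m = riemann_sum f (\<lambda>\<alpha>. of_real (measure (diag_measure E z) \<alpha>)) m"
  by (simp add: riemann_sum_def measure_diag_measure[OF E])

text \<open>On the diagonal the bound is C times the total mass of \<open>diag_measure\<close>; the
  2 is the constant of \<open>sesquilinear_bound\<close>.\<close>

lemma norm_qpm_sum_le: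
  assumes C: "\<And>a. cmod (f a) \<le> C" "0 \<le> C"
  shows "norm (qpm_sum E f m) \<le> 2 * C"
proof (rule norm_blinfun_le_cinnerI)
  fix x y
  have "cmod (riemann_sum f (qpm_coeff E z z) m) \<le> C * (norm z)\<^sup>2" for z
  proof -
    have "cmod (riemann_sum f (qpm_coeff E z z) m) \<le>
        (\<Sum>S\<in>Pow {..<m}. cmod (f (atom_tag m S) * of_real (measure (diag_measure E z) (atom m S))))"
      by (subst riemann_sum_diag) (unfold riemann_sum_def, rule norm_sum)
    also have "\<dots> \<le> (\<Sum>S\<in>Pow {..<m}. C * measure (diag_measure E z) (atom m S))"
      using C by (intro sum_mono) (auto simp: norm_mult intro!: mult_right_mono)
    also have "\<dots> = C * measure (diag_measure E z) UNIV"
      by (simp add: sum_measure_atoms[OF finite_diag_measure[OF E] sets_diag_measure[OF E]] flip: sum_distrib_left)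
    finally show ?thesis
      by (simp add: measure_diag_measure_UNIV[OF E])
  qed
  then show "cmod (cinner (blinfun_apply (qpm_sum E f m) x) y) \<le> 2 * C * norm x * norm y"
    by (intro sesquilinear_bound[OF sesquilinear_cinner_apply[OF bops_qpm_sum]] C)
       (simp add: cinner_qpm_sum)
qed (use C in simp)

text \<open>All sums are compared with the same diagonal integral. The mass of
  \<open>diag_measure E z\<close> is \<open>(norm z)\<^sup>2\<close>, so the error is uniform on the
  unit ball and the sums are Cauchy in operator norm.\<close>

lemma qpm_sum_convergent:
  assumes f: "f \<in> cfuns"
  shows "convergent (qpm_sum E f)"
proof (rule Cauchy_convergent, rule metric_CauchyI)
  fix e :: real assume e: "e > 0"
  \<comment> \<open>Two sums, each within e / 8 of the integral, differ by e / 4 on the diagonal;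
    \<open>sesquilinear_bound\<close> doubles this to e / 2 < e.\<close>
  have "eventually (\<lambda>m. atom_osc_le m f (e / 8)) sequentially"
    using f e by (intro eventually_atom_osc_le[OF cpt]) (auto simp: cfuns_def)
  then obtain M where M: "\<And>m. m \<ge> M \<Longrightarrow> atom_osc_le m f (e / 8)"
    by (auto simp: eventually_sequentially)
  show "\<exists>M. \<forall>m\<ge>M. \<forall>n\<ge>M. dist (qpm_sum E f m) (qpm_sum E f n) < e"
  proof (intro exI allI impI)
    fix m n assume mn: "m \<ge> M" "n \<ge> M"
    have "norm (qpm_sum E f m - qpm_sum E f n) \<le> 2 * (e / 4)"
    proof (rule norm_blinfun_le_cinnerI)
      fix x y
      have "cmod (riemann_sum f (qpm_coeff E z z) m - riemann_sum f (qpm_coeff E z z) n) \<le> e / 4 * (norm z)\<^sup>2" for z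
      proof -
        let ?I = "integral\<^sup>L (diag_measure E z) f"
        have err: "cmod (?I - riemann_sum f (qpm_coeff E z z) k) \<le> e / 8 * (norm z)\<^sup>2" if "k \<ge> M" for k
          using riemann_sum_error[OF cpt f finite_diag_measure[OF E] sets_diag_measure[OF E] M[OF that], of z]
          by (simp add: riemann_sum_diag measure_diag_measure_UNIV[OF E])
        have "cmod ((?I - riemann_sum f (qpm_coeff E z z) n) - (?I - riemann_sum f (qpm_coeff E z z) m)) \<le>
            e / 8 * (norm z)\<^sup>2 + e / 8 * (norm z)\<^sup>2"
          by (intro order_trans[OF norm_triangle_ineq4] add_mono err mn)
        then show ?thesis
          by simp
      qed
      then show "cmod (cinner (blinfun_apply (qpm_sum E f m - qpm_sum E f n) x) y) \<le> 2 * (e / 4) * norm x * norm y"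
        using e
        by (intro sesquilinear_bound[OF sesquilinear_cinner_apply[OF bops_diff[OF bops_qpm_sum bops_qpm_sum]]])
           (simp_all add: cinner_qpm_sum blinfun.diff_left cinner.diff_left)
    qed (use e in simp)
    then show "dist (qpm_sum E f m) (qpm_sum E f n) < e"
      using e by (simp add: dist_norm)
  qed
qed

lemma has_qpm_integral_unique:
  assumes f: "f \<in> cfuns" and S: "has_qpm_integral E f S" and T: "has_qpm_integral E f T"
  shows "S = T"
proof (rule blinfun_cinner_eqI)
  fix x y
  show "cinner (blinfun_apply S x) y = cinner (blinfun_apply T x) y"
    using S T unfolding has_qpm_integral_def
    by (intro LIMSEQ_unique[OF has_cmeasure_integral_tendsto[OF cpt f] has_cmeasure_integral_tendsto[OF cpt f]])
      blast+
qed

text \<open>The diagonal measures at the four vectors of \<open>polarization_half\<close> decompose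
  all coefficients of E at once, and the same identity for \<open>T\<close> matches the
  integrals.\<close>

lemma has_qpm_integralI_diag:
  assumes f: "f \<in> cfuns" and T: "T \<in> bops"
    and diag: "\<And>z. cinner (blinfun_apply T z) z = integral\<^sup>L (diag_measure E z) f"
  shows "has_qpm_integral E f T"
  unfolding has_qpm_integral_def has_cmeasure_integral_def
proof (intro conjI allI T)
  fix x y
  let ?M1 = "diag_measure E ((1/2) *\<^sub>R (x + y))" and ?M2 = "diag_measure E ((1/2) *\<^sub>R (x - y))"
    and ?M3 = "diag_measure E ((1/2) *\<^sub>R (x + \<i> *\<^sub>C y))" and ?M4 = "diag_measure E ((1/2) *\<^sub>R (x - \<i> *\<^sub>C y))"
  show "\<exists>m1 m2 m3 m4.
          (\<forall>m\<in>{m1, m2, m3, m4}. finite_measure m \<and> sets m = sets borel \<and> integrable m f) \<and>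
          (\<forall>\<alpha>\<in>sets borel. qpm_coeff E x y \<alpha> =
              complex_of_real (measure m1 \<alpha> - measure m2 \<alpha>) +
              \<i> * complex_of_real (measure m3 \<alpha> - measure m4 \<alpha>)) \<and>
          cinner (blinfun_apply T x) y =
          integral\<^sup>L m1 f - integral\<^sup>L m2 f + \<i> * (integral\<^sup>L m3 f - integral\<^sup>L m4 f)"
  proof (rule exI[of _ ?M1], rule exI[of _ ?M2], rule exI[of _ ?M3], rule exI[of _ ?M4], intro conjI ballI)
    fix \<alpha> :: "'a set" assume \<alpha>: "\<alpha> \<in> sets borel"
    show "qpm_coeff E x y \<alpha> = complex_of_real (measure ?M1 \<alpha> - measure ?M2 \<alpha>) +
        \<i> * complex_of_real (measure ?M3 \<alpha> - measure ?M4 \<alpha>)"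
      unfolding of_real_diff measure_diag_measure[OF E \<alpha>] unfolding qpm_coeff_def
      by (rule polarization_half[OF sesquilinear_cinner_apply[OF qpm_bops[OF E \<alpha>]]])
  next
    show "cinner (blinfun_apply T x) y =
        integral\<^sup>L ?M1 f - integral\<^sup>L ?M2 f + \<i> * (integral\<^sup>L ?M3 f - integral\<^sup>L ?M4 f)"
      unfolding diag[symmetric] by (rule polarization_half[OF sesquilinear_cinner_apply[OF T]])
  qed (use finite_diag_measure[OF E] sets_diag_measure[OF E] cfuns_integrable[OF cpt f] in auto)
qed

text \<open>The norm limit of the sums has the right diagonal and so is an integral; uniqueness
  identifies it with the definite description \<open>qpm_map\<close>.\<close>

lemma
  assumes f: "f \<in> cfuns"
  shows qpm_map_tendsto: "qpm_sum E f \<longlonglongrightarrow> qpm_map E f"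
    and qpm_map_has_integral: "has_qpm_integral E f (qpm_map E f)"
    and bops_qpm_map: "qpm_map E f \<in> bops"
    and qpm_map_diag: "cinner (blinfun_apply (qpm_map E f) z) z = integral\<^sup>L (diag_measure E z) f"
proof -
  obtain T where T: "qpm_sum E f \<longlonglongrightarrow> T"
    using qpm_sum_convergent[OF f] by (auto simp: convergent_def)
  have Tb: "T \<in> bops"
    by (rule bops_limit[OF bops_qpm_sum T])
  have diag: "cinner (blinfun_apply T z) z = integral\<^sup>L (diag_measure E z) f" for z
  proof (rule LIMSEQ_unique)
    show "(\<lambda>m. riemann_sum f (qpm_coeff E z z) m) \<longlonglongrightarrow> cinner (blinfun_apply T z) z"
      unfolding cinner_qpm_sum[symmetric] by (intro cinner.tendsto blinfun.tendsto tendsto_const T)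
    show "(\<lambda>m. riemann_sum f (qpm_coeff E z z) m) \<longlonglongrightarrow> integral\<^sup>L (diag_measure E z) f"
      unfolding riemann_sum_diag
      by (rule riemann_sum_tendsto_integral[OF cpt f finite_diag_measure[OF E] sets_diag_measure[OF E]])
  qed
  have int: "has_qpm_integral E f T"
    by (rule has_qpm_integralI_diag[OF f Tb diag])
  then have "qpm_map E f = T"
    unfolding qpm_map_def using has_qpm_integral_unique[OF f] by blast
  with T int Tb diag show "qpm_sum E f \<longlonglongrightarrow> qpm_map E f" "has_qpm_integral E f (qpm_map E f)" "qpm_map E f \<in> bops"
    "cinner (blinfun_apply (qpm_map E f) z) z = integral\<^sup>L (diag_measure E z) f"
    by simp_all
qed

lemma norm_qpm_map_le:
  assumes "f \<in> cfuns" "\<And>a. cmod (f a) \<le> C" "0 \<le> C"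
  shows "norm (qpm_map E f) \<le> 2 * C"
  using norm_qpm_sum_le[OF assms(2,3)]
  by (intro LIMSEQ_le_const2[OF tendsto_norm[OF qpm_map_tendsto[OF assms(1)]]]) auto

lemma qpm_map_one: "qpm_map E (\<lambda>_. 1) = id_blinfun"
proof (rule bops_eqI)
  have one: "(\<lambda>_. 1) \<in> cfuns"
    by (simp add: cfuns_def)
  show "qpm_map E (\<lambda>_. 1) \<in> bops"
    by (rule bops_qpm_map[OF one])
  show "cinner (blinfun_apply (qpm_map E (\<lambda>_. 1)) z) z = cinner (blinfun_apply id_blinfun z) z" for z
    by (simp add: qpm_map_diag[OF one] space_diag_measure[OF E] measure_diag_measure_UNIV[OF E] cinner_self
        scaleR_conv_of_real)
qed simp

lemma qpm_map_add:
  assumes "f \<in> cfuns" "g \<in> cfuns" "(\<lambda>a. f a + g a) \<in> cfuns"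
  shows "qpm_map E (\<lambda>a. f a + g a) = qpm_map E f + qpm_map E g"
proof (rule LIMSEQ_unique[OF qpm_map_tendsto[OF assms(3)]])
  have "qpm_sum E (\<lambda>a. f a + g a) = (\<lambda>m. qpm_sum E f m + qpm_sum E g m)"
    by (rule ext, rule blinfun_eqI) (simp add: qpm_sum_apply blinfun.add_left scaleC_add_left sum.distrib)
  then show "qpm_sum E (\<lambda>a. f a + g a) \<longlonglongrightarrow> qpm_map E f + qpm_map E g"
    using tendsto_add[OF qpm_map_tendsto[OF assms(1)] qpm_map_tendsto[OF assms(2)]]
    by simp
qed

lemma qpm_map_scale:
  assumes "f \<in> cfuns" "(\<lambda>a. c * f a) \<in> cfuns"
  shows "blinfun_apply (qpm_map E (\<lambda>a. c * f a)) x = c *\<^sub>C blinfun_apply (qpm_map E f) x"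
proof (rule LIMSEQ_unique)
  show "(\<lambda>m. blinfun_apply (qpm_sum E (\<lambda>a. c * f a) m) x) \<longlonglongrightarrow> blinfun_apply (qpm_map E (\<lambda>a. c * f a)) x"
    by (intro blinfun.tendsto tendsto_const qpm_map_tendsto assms)
  have "blinfun_apply (qpm_sum E (\<lambda>a. c * f a) m) x = c *\<^sub>C blinfun_apply (qpm_sum E f m) x" for m
    by (simp add: qpm_sum_apply scaleC.sum_right scaleC_scaleC)
  then show "(\<lambda>m. blinfun_apply (qpm_sum E (\<lambda>a. c * f a) m) x) \<longlonglongrightarrow> c *\<^sub>C blinfun_apply (qpm_map E f) x"
    by (simp only:) (intro scaleC.tendsto blinfun.tendsto tendsto_const qpm_map_tendsto assms)
qed

lemma qpm_map_adjoint:
  assumes "f \<in> cfuns" "(\<lambda>a. cnj (f a)) \<in> cfuns"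
  shows "cinner (blinfun_apply (qpm_map E f) x) y = cinner x (blinfun_apply (qpm_map E (\<lambda>a. cnj (f a))) y)"
proof (rule LIMSEQ_unique)
  show "(\<lambda>m. cinner (blinfun_apply (qpm_sum E f m) x) y) \<longlonglongrightarrow> cinner (blinfun_apply (qpm_map E f) x) y"
    by (intro cinner.tendsto blinfun.tendsto tendsto_const qpm_map_tendsto assms)
  have "cinner (blinfun_apply (qpm_sum E f m) x) y = cinner x (blinfun_apply (qpm_sum E (\<lambda>a. cnj (f a)) m) y)" for m
    by (simp add: qpm_sum_apply cinner.sum_left cinner.sum_right cinner_scaleC_left cinner_scaleC_right
        positive_op_selfadjoint[OF qpm_positive[OF E atom_borel]])
  then show "(\<lambda>m. cinner (blinfun_apply (qpm_sum E f m) x) y) \<longlonglongrightarrow>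
      cinner x (blinfun_apply (qpm_map E (\<lambda>a. cnj (f a))) y)"
    by (simp only:) (intro cinner.tendsto blinfun.tendsto tendsto_const qpm_map_tendsto assms)
qed

end


subsection \<open>From channels to maps\<close>

lemma cfuns_intros [intro]:
  assumes "f \<in> cfuns" "g \<in> cfuns"
  shows "(\<lambda>a. f a + g a) \<in> cfuns" "(\<lambda>a. f a * g a) \<in> cfuns"
  using assms by (auto simp: cfuns_def intro: continuous_intros)

lemma cfuns_const [intro]: "(\<lambda>a. c) \<in> cfuns"
  and cfuns_cmult [intro]: "f \<in> cfuns \<Longrightarrow> (\<lambda>a. c * f a) \<in> cfuns"
  and cfuns_cnj [intro]: "f \<in> cfuns \<Longrightarrow> (\<lambda>a. cnj (f a)) \<in> cfuns"
  by (auto simp: cfuns_def intro: continuous_intros)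

lemma cfuns_sum [intro]: "(\<And>i. i \<in> I \<Longrightarrow> f i \<in> cfuns) \<Longrightarrow> (\<lambda>a. \<Sum>i\<in>I. f i a) \<in> cfuns"
  by (induction I rule: infinite_finite_induct) auto

context
  fixes E :: "'x::topological_space \<Rightarrow> 'a::second_countable_topology set \<Rightarrow> ('h::chilbert_space \<Rightarrow>\<^sub>L 'h)"
  assumes E: "info_channel E" and cpt: "compact (UNIV :: 'a set)"
begin

lemma info_channel_qpm: "qpm (E x)"
  using E by (simp add: info_channel_def)

lemma weakly_measurable_qpm_sum: "weakly_measurable (\<lambda>x. qpm_sum (E x) f m)"
  unfolding weakly_measurable_def cinner_qpm_sum riemann_sum_def qpm_coeff_def
  using E weakly_measurableD atom_borel unfolding info_channel_def
  by (intro allI borel_measurable_sum borel_measurable_times borel_measurable_const) blast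

lemma channel_map_wmfuns:
  assumes f: "f \<in> cfuns"
  shows "channel_map E f \<in> wmfuns"
proof -
  obtain C where C: "0 \<le> C" "\<And>a. cmod (f a) \<le> C"
    using cfuns_bounded[OF cpt f] by blast
  have "norm (channel_map E f x) \<le> 2 * C" for x
    unfolding channel_map_def by (rule norm_qpm_map_le[OF info_channel_qpm cpt f C(2,1)])
  then have "bounded (range (channel_map E f))"
    by (auto simp: bounded_iff)
  moreover have "weakly_measurable (channel_map E f)"
    using qpm_map_tendsto[OF info_channel_qpm cpt f]
    unfolding channel_map_def[abs_def]
    by (rule weakly_measurable_LIMSEQ[OF weakly_measurable_qpm_sum])
  ultimately show ?thesis
    using bops_qpm_map[OF info_channel_qpm cpt f] by (simp add: wmfuns_def channel_map_def)
qed

lemma channel_map_well_definedI: "channel_map_well_defined E"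
  unfolding channel_map_well_defined_def
  using channel_map_wmfuns qpm_map_has_integral[OF info_channel_qpm cpt]
    has_qpm_integral_unique[OF info_channel_qpm cpt] by blast

lemma unital_channel_map: "unital_map (channel_map E)"
  by (simp add: unital_map_def channel_map_def qpm_map_one[OF info_channel_qpm cpt])

lemma clinear_channel_map: "clinear_map (channel_map E)"
  unfolding clinear_map_def channel_map_def
  using channel_map_wmfuns unfolding channel_map_def[abs_def]
  by (auto intro!: qpm_map_add[OF info_channel_qpm cpt] qpm_map_scale[OF info_channel_qpm cpt]
      cfuns_intros cfuns_cmult)

text \<open>At each tag M has the form G* G. Putting the scalars G k j into the vectors gives w k S,
  and the double sum becomes a sum over S and k of diagonal coefficients of the positive operators
  \<open>E x (atom m S)\<close>.\<close>

lemma qpm_sum_matrix_positive: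
  fixes G :: "nat \<Rightarrow> nat \<Rightarrow> 'a \<Rightarrow> complex" and v :: "nat \<Rightarrow> 'h"
  assumes M: "\<And>i j. i < n \<Longrightarrow> j < n \<Longrightarrow> M i j = (\<lambda>a. \<Sum>k<n. cnj (G k i a) * G k j a)"
  shows "0 \<le> Re (\<Sum>i<n. \<Sum>j<n. cinner (blinfun_apply (qpm_sum (E x) (M i j) m) (v j)) (v i))"
proof -
  define w where "w k S = (\<Sum>j<n. G k j (atom_tag m S) *\<^sub>C v j)" for k S
  have w: "cinner (blinfun_apply T (w k S)) (w k S) =
      (\<Sum>i<n. \<Sum>j<n. cnj (G k i (atom_tag m S)) * G k j (atom_tag m S) * cinner (blinfun_apply T (v j)) (v i))"
    if "T \<in> bops" for k S T
    by (simp add: w_def blinfun.sum_right bops_apply_scaleC[OF that] cinner.sum_left cinner.sum_right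
        cinner_scaleC_left cinner_scaleC_right sum_distrib_left mult_ac)
  have "(\<Sum>i<n. \<Sum>j<n. cinner (blinfun_apply (qpm_sum (E x) (M i j) m) (v j)) (v i)) =
      (\<Sum>i<n. \<Sum>j<n. \<Sum>S\<in>Pow {..<m}. \<Sum>k<n. cnj (G k i (atom_tag m S)) * G k j (atom_tag m S) *
        cinner (blinfun_apply (E x (atom m S)) (v j)) (v i))"
    by (intro sum.cong refl)
       (simp add: cinner_qpm_sum riemann_sum_def qpm_coeff_def M sum_distrib_right)
  also have "\<dots> = (\<Sum>i<n. \<Sum>S\<in>Pow {..<m}. \<Sum>j<n. \<Sum>k<n. cnj (G k i (atom_tag m S)) * G k j (atom_tag m S) *
        cinner (blinfun_apply (E x (atom m S)) (v j)) (v i))"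
    by (intro sum.cong refl sum.swap)
  also have "\<dots> = (\<Sum>S\<in>Pow {..<m}. \<Sum>i<n. \<Sum>j<n. \<Sum>k<n. cnj (G k i (atom_tag m S)) * G k j (atom_tag m S) *
        cinner (blinfun_apply (E x (atom m S)) (v j)) (v i))"
    by (rule sum.swap)
  also have "\<dots> = (\<Sum>S\<in>Pow {..<m}. \<Sum>i<n. \<Sum>k<n. \<Sum>j<n. cnj (G k i (atom_tag m S)) * G k j (atom_tag m S) *
        cinner (blinfun_apply (E x (atom m S)) (v j)) (v i))"
    by (intro sum.cong refl sum.swap)
  also have "\<dots> = (\<Sum>S\<in>Pow {..<m}. \<Sum>k<n. \<Sum>i<n. \<Sum>j<n. cnj (G k i (atom_tag m S)) * G k j (atom_tag m S) *
        cinner (blinfun_apply (E x (atom m S)) (v j)) (v i))"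
    by (intro sum.cong refl sum.swap)
  also have "\<dots> = (\<Sum>S\<in>Pow {..<m}. \<Sum>k<n. qpm_coeff (E x) (w k S) (w k S) (atom m S))"
    by (simp add: qpm_coeff_def w[OF qpm_bops[OF info_channel_qpm atom_borel]])
  finally show ?thesis
    by (simp add: sum_nonneg qpm_coeff_diag_real(2)[OF info_channel_qpm atom_borel])
qed

lemma completely_positive_channel_map:
  assumes sep: "separable_space (euclidean :: 'h topology)"
  shows "completely_positive (channel_map E)"
  unfolding completely_positive_def
proof (intro conjI allI impI clinear_channel_map)
  fix n and M :: "nat \<Rightarrow> nat \<Rightarrow> 'a \<Rightarrow> complex"
  assume "cfuns_mat_positive n M"
  then obtain G where G: "\<And>i j. i < n \<Longrightarrow> j < n \<Longrightarrow> G i j \<in> cfuns"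
    and M: "\<And>i j. i < n \<Longrightarrow> j < n \<Longrightarrow> M i j = (\<lambda>a. \<Sum>k<n. cnj (G k i a) * G k j a)"
    unfolding cfuns_mat_positive_def by blast
  have Mc: "M i j \<in> cfuns" if "i < n" "j < n" for i j
    unfolding M[OF that] using that G by (intro cfuns_sum cfuns_intros cfuns_cnj) auto
  show "wmfuns_mat_positive n (\<lambda>i j. channel_map E (M i j))"
  proof (rule wmfuns_mat_positiveI[OF sep])
    fix i j assume ij: "i < n" "j < n"
    show "channel_map E (M i j) \<in> wmfuns"
      by (intro channel_map_wmfuns Mc ij)
    have "(\<lambda>a. cnj (M i j a)) = M j i"
      using ij by (simp add: M mult.commute)
    then show "cinner (blinfun_apply (channel_map E (M i j) x) u) w =
        cinner u (blinfun_apply (channel_map E (M j i) x) w)" for x u w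
      using qpm_map_adjoint[OF info_channel_qpm cpt Mc[OF ij] cfuns_cnj[OF Mc[OF ij]], of x u w]
      by (simp add: channel_map_def)
  next
    fix x and v :: "nat \<Rightarrow> 'h"
    have "(\<lambda>m. Re (\<Sum>i<n. \<Sum>j<n. cinner (blinfun_apply (qpm_sum (E x) (M i j) m) (v j)) (v i))) \<longlonglongrightarrow>
        Re (\<Sum>i<n. \<Sum>j<n. cinner (blinfun_apply (channel_map E (M i j) x) (v j)) (v i))"
      unfolding channel_map_def
      by (intro tendsto_Re tendsto_sum cinner.tendsto blinfun.tendsto tendsto_const
          qpm_map_tendsto[OF info_channel_qpm cpt] Mc) auto
    then show "0 \<le> Re (\<Sum>i<n. \<Sum>j<n. cinner (blinfun_apply (channel_map E (M i j) x) (v j)) (v i))"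
      by (rule LIMSEQ_le_const) (intro exI[of _ 0] allI impI qpm_sum_matrix_positive[where G = G] M)
  qed
qed

end

section \<open>Spectral measures and multiplicativity\<close>

lemma blinfun_compose_assoc: "(S o\<^sub>L T) o\<^sub>L U = S o\<^sub>L (T o\<^sub>L U)"
  by (rule blinfun_eqI) simp

text \<open>The sum of the idempotents P and Q is idempotent, so PQ = - QP. Multiplying by P on the
  left and reusing this relation gives PQ = - PQP = QP, hence PQ = - PQ.\<close>

lemma spectral_measure_disjoint:
  assumes E: "spectral_measure E" and \<alpha>: "\<alpha> \<in> sets borel" and \<beta>: "\<beta> \<in> sets borel" and disj: "\<alpha> \<inter> \<beta> = {}"
  shows "E \<alpha> o\<^sub>L E \<beta> = 0"
proof -
  have q: "qpm E" and idem: "E \<gamma> o\<^sub>L E \<gamma> = E \<gamma>" if "\<gamma> \<in> sets borel" for \<gamma>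
    using E that by (auto simp: spectral_measure_def projection_op_def)
  interpret c: bounded_bilinear "blinfun_compose :: ('b \<Rightarrow>\<^sub>L 'b) \<Rightarrow> ('b \<Rightarrow>\<^sub>L 'b) \<Rightarrow> ('b \<Rightarrow>\<^sub>L 'b)"
    by (rule bounded_bilinear_blinfun_compose)
  let ?P = "E \<alpha>" and ?Q = "E \<beta>"
  have Un: "E (\<alpha> \<union> \<beta>) = ?P + ?Q"
    by (rule qpm_Un[OF q[OF \<alpha>] \<alpha> \<beta> disj])
  have "(?P + ?Q) o\<^sub>L (?P + ?Q) = ?P + ?Q"
    using idem[of "\<alpha> \<union> \<beta>"] \<alpha> \<beta> by (simp add: Un)
  then have PQ: "?P o\<^sub>L ?Q = - (?Q o\<^sub>L ?P)"
    by (simp add: c.add_left c.add_right idem \<alpha> \<beta> algebra_simps add_eq_0_iff)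
  have "?P o\<^sub>L ?Q = ?P o\<^sub>L (?P o\<^sub>L ?Q)"
    by (simp add: blinfun_compose_assoc[symmetric] idem \<alpha>)
  also have "\<dots> = - ((?P o\<^sub>L ?Q) o\<^sub>L ?P)"
    using arg_cong[OF PQ, of "\<lambda>T. ?P o\<^sub>L T"] by (simp add: c.minus_right blinfun_compose_assoc)
  also have "\<dots> = (?Q o\<^sub>L ?P) o\<^sub>L ?P"
    by (simp only: PQ c.minus_left minus_minus)
  also have "\<dots> = ?Q o\<^sub>L ?P"
    by (simp add: blinfun_compose_assoc idem \<alpha>)
  finally have "?P o\<^sub>L ?Q = ?Q o\<^sub>L ?P" .
  with PQ have "?P o\<^sub>L ?Q = - (?P o\<^sub>L ?Q)"
    by (simp only:)
  then have "(1 + 1) *\<^sub>R (?P o\<^sub>L ?Q) = 0"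
    unfolding scaleR_add_left scaleR_one using eq_neg_iff_add_eq_0 by blast
  then show ?thesis by simp
qed

text \<open>Holds exactly for each m: both functions are sampled at the same tags, and orthogonality
  of the atoms leaves only the diagonal of the double sum.\<close>

lemma qpm_sum_mult:
  assumes E: "spectral_measure E"
  shows "qpm_sum E (\<lambda>a. f a * g a) m = qpm_sum E f m o\<^sub>L qpm_sum E g m"
proof (rule blinfun_eqI)
  fix x
  have q: "qpm E" and idem: "E \<gamma> o\<^sub>L E \<gamma> = E \<gamma>" if "\<gamma> \<in> sets borel" for \<gamma>
    using E that by (auto simp: spectral_measure_def projection_op_def)
  have bops: "E (atom m S) \<in> bops" for S
    by (rule qpm_bops[OF q[OF atom_borel] atom_borel])
  have prod: "blinfun_apply (E (atom m S)) (blinfun_apply (E (atom m T)) x) =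
      (if T = S then blinfun_apply (E (atom m S)) x else 0)"
    if "S \<in> Pow {..<m}" "T \<in> Pow {..<m}" for S T
  proof (cases "T = S")
    case True
    then show ?thesis
      using arg_cong[OF idem[OF atom_borel], of "\<lambda>T. blinfun_apply T x"] by simp
  next
    case False
    then show ?thesis
      using arg_cong[OF spectral_measure_disjoint[OF E atom_borel atom_borel disjoint_atoms[OF that]],
          of "\<lambda>T. blinfun_apply T x"] by simp
  qed
  have "blinfun_apply (qpm_sum E f m o\<^sub>L qpm_sum E g m) x =
      (\<Sum>S\<in>Pow {..<m}. \<Sum>T\<in>Pow {..<m}. f (atom_tag m S) *\<^sub>C (g (atom_tag m T) *\<^sub>C
        blinfun_apply (E (atom m S)) (blinfun_apply (E (atom m T)) x)))"
    by (simp add: qpm_sum_apply blinfun.sum_right bops_apply_scaleC[OF bops] scaleC.sum_right)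
       (rule sum.swap)
  also have "\<dots> = (\<Sum>S\<in>Pow {..<m}. \<Sum>T\<in>Pow {..<m}. if T = S then
        (f (atom_tag m S) * g (atom_tag m S)) *\<^sub>C blinfun_apply (E (atom m S)) x else 0)"
    by (intro sum.cong refl) (auto simp: prod scaleC_scaleC scaleC.zero_right simp del: Pow_iff)
  also have "\<dots> = blinfun_apply (qpm_sum E (\<lambda>a. f a * g a) m) x"
    by (simp add: qpm_sum_apply)
  finally show "blinfun_apply (qpm_sum E (\<lambda>a. f a * g a) m) x = blinfun_apply (qpm_sum E f m o\<^sub>L qpm_sum E g m) x"
    by simp
qed

lemma star_hom_channel_map:
  fixes E :: "'x::topological_space \<Rightarrow> 'a::second_countable_topology set \<Rightarrow> ('h::chilbert_space \<Rightarrow>\<^sub>L 'h)"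
  assumes E: "info_channel E" and pv: "projection_valued E" and cpt: "compact (UNIV :: 'a set)"
  shows "star_hom (channel_map E)"
  unfolding star_hom_def channel_map_def
proof (intro conjI ballI allI)
  show "clinear_map (\<lambda>f x. qpm_map (E x) f)"
    using clinear_channel_map[OF E cpt] by (simp add: channel_map_def[abs_def])
next
  fix f g :: "'a \<Rightarrow> complex" and x assume fg: "f \<in> cfuns" "g \<in> cfuns"
  note q = info_channel_qpm[OF E cpt, of x]
  have sm: "spectral_measure (E x)"
    using pv by (simp add: projection_valued_def)
  show "qpm_map (E x) (\<lambda>a. f a * g a) = qpm_map (E x) f o\<^sub>L qpm_map (E x) g"
  proof (rule LIMSEQ_unique[OF qpm_map_tendsto[OF q cpt cfuns_intros(2)[OF fg]]])
    show "qpm_sum (E x) (\<lambda>a. f a * g a) \<longlonglongrightarrow> (qpm_map (E x) f o\<^sub>L qpm_map (E x) g)"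
      unfolding qpm_sum_mult[OF sm]
      by (intro bounded_bilinear.tendsto[OF bounded_bilinear_blinfun_compose] qpm_map_tendsto[OF q cpt] fg)
  qed
next
  fix f :: "'a \<Rightarrow> complex" and x assume f: "f \<in> cfuns"
  note q = info_channel_qpm[OF E cpt, of x]
  show "qpm_map (E x) (\<lambda>a. cnj (f a)) = cadjoint (qpm_map (E x) f)"
    using f
    by (intro cadjoint_eqI[symmetric] qpm_map_adjoint[OF q cpt] bops_qpm_map[OF q cpt]) auto
qed


subsection \<open>Positive functionals on continuous functions are integrals\<close>

text \<open>Urysohn's lemma yields, for each point of \<open>U\<close>, a function that is positive
  there and 0 outside \<open>U\<close>; the Lindelof property leaves countably many.\<close>

lemma open_eq_Union_positive_sets:
  fixes U :: "'a::{t2_space, second_countable_topology} set"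
  assumes cpt: "compact (UNIV :: 'a set)" and U: "open U"
  obtains \<F> :: "('a \<Rightarrow> real) set" where "countable \<F>"
    "\<And>f. f \<in> \<F> \<Longrightarrow> continuous_on UNIV f \<and> (\<forall>a. 0 \<le> f a)" "U = (\<Union>f\<in>\<F>. {a. 0 < f a})"
proof -
  define P where "P f \<longleftrightarrow> continuous_on UNIV f \<and> (\<forall>a. 0 \<le> f a) \<and> (\<forall>a. a \<notin> U \<longrightarrow> f a = 0)" for f :: "'a \<Rightarrow> real"
  have "Hausdorff_space (euclidean :: 'a topology)"
    unfolding Hausdorff_space_def disjnt_def using hausdorff by (metis open_openin)
  then have normal: "normal_space (euclidean :: 'a topology)"
    using cpt by (intro compact_Hausdorff_or_regular_imp_normal_space) (auto simp: compact_space_def)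
  have ex: "\<exists>f. P f \<and> f a > 0" if "a \<in> U" for a
  proof -
    have "closedin euclidean (- U)" "closedin euclidean {a}" "disjnt (- U) {a}"
      using U that by (auto simp: disjnt_def closed_Compl simp flip: closed_closedin)
    then obtain f where f: "continuous_map euclidean (top_of_set {0..1}) f" "f ` (- U) \<subseteq> {0::real}" "f ` {a} \<subseteq> {1}"
      by (rule Urysohn_lemma[OF normal _ _ _ zero_le_one])
    then have "continuous_on UNIV f" "\<forall>a. 0 \<le> f a"
      by (auto simp: continuous_map_in_subtopology image_subset_iff)
    with f show ?thesis
      by (intro exI[of _ f]) (auto simp: P_def)
  qed
  have "open {a. 0 < f a}" if "P f" for f
    using that unfolding P_def by (intro open_Collect_less continuous_on_const) auto
  then have "open S" if "S \<in> (\<lambda>f. {a. 0 < f a}) ` Collect P" for S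
    using that by auto
  then obtain \<G> where \<G>: "\<G> \<subseteq> (\<lambda>f. {a. 0 < f a}) ` Collect P" "countable \<G>"
      "\<Union>\<G> = (\<Union>f\<in>Collect P. {a. 0 < f a})"
    by (rule Lindelof)
  obtain \<F> where \<F>: "\<F> \<subseteq> Collect P" "countable \<F>" "\<G> = (\<lambda>f. {a. 0 < f a}) ` \<F>"
    using countable_subset_image[of \<G> "\<lambda>f. {a. 0 < f a}" "Collect P"] \<G>(1,2) by metis
  have "U = (\<Union>f\<in>\<F>. {a. 0 < f a})"
  proof -
    have "U = (\<Union>f\<in>Collect P. {a. 0 < f a})"
      using ex by (fastforce simp: P_def)
    then show ?thesis
      using \<G>(3) \<F>(3) by simp
  qed
  with \<F> show thesis
    by (intro that[of \<F>]) (auto simp: P_def)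
qed

text \<open>Coverings by nonnegative continuous functions instead of open sets, as in Daniell's
  construction: the infimum of their costs is the upper integral of the indicator of
  \<open>S\<close>.\<close>

definition cover_by :: "(nat \<Rightarrow> 'a::topological_space \<Rightarrow> real) \<Rightarrow> 'a set \<Rightarrow> bool" where
  "cover_by g S \<longleftrightarrow> (\<forall>n. continuous_on UNIV (g n)) \<and> (\<forall>n a. 0 \<le> g n a) \<and> (\<forall>a\<in>S. 1 \<le> (\<Sum>n. ennreal (g n a)))"

section \<open>The outer measure of a positive functional\<close>

locale positive_functional =
  fixes L :: "('a::{t2_space, second_countable_topology} \<Rightarrow> real) \<Rightarrow> real"
  assumes cpt: "compact (UNIV :: 'a set)"
    and L_add: "\<And>f g. continuous_on UNIV f \<Longrightarrow> continuous_on UNIV g \<Longrightarrow> L (\<lambda>a. f a + g a) = L f + L g"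
    and L_scale: "\<And>f c. continuous_on UNIV f \<Longrightarrow> L (\<lambda>a. c * f a) = c * L f"
    and L_nonneg: "\<And>f. continuous_on UNIV f \<Longrightarrow> (\<And>a. 0 \<le> f a) \<Longrightarrow> 0 \<le> L f"
begin

lemma L_diff:
  assumes "continuous_on UNIV f" "continuous_on UNIV g"
  shows "L (\<lambda>a. f a - g a) = L f - L g"
  using L_add[OF assms(1) continuous_on_mult_left[OF assms(2), of "-1"]] L_scale[OF assms(2), of "-1"]
  by simp

lemma L_mono:
  assumes "continuous_on UNIV f" "continuous_on UNIV g" "\<And>a. f a \<le> g a"
  shows "L f \<le> L g"
  using L_nonneg[of "\<lambda>a. g a - f a"] L_diff[OF assms(2,1)] assms
  by (auto intro: continuous_on_diff)

lemma L_zero: "L (\<lambda>a. 0) = 0"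
  using L_scale[of "\<lambda>a. 0" 0] by simp

lemma L_sum:
  assumes "\<And>i. i \<in> I \<Longrightarrow> continuous_on UNIV (f i)"
  shows "L (\<lambda>a. \<Sum>i\<in>I. f i a) = (\<Sum>i\<in>I. L (f i))"
  using assms
  by (induction I rule: infinite_finite_induct) (simp_all add: L_zero L_add continuous_on_sum)

lemma L_const: "L (\<lambda>a. c) = c * L (\<lambda>a. 1)"
  using L_scale[of "\<lambda>a. 1" c] by simp

lemma L_one_nonneg: "0 \<le> L (\<lambda>a. 1)"
  by (rule L_nonneg) auto

definition cost :: "(nat \<Rightarrow> 'a \<Rightarrow> real) \<Rightarrow> ennreal" where
  "cost g = (\<Sum>n. ennreal (L (g n)))"

definition \<mu> :: "'a set \<Rightarrow> ennreal" where
  "\<mu> S = (INF g\<in>{g. cover_by g S}. cost g)"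

lemma \<mu>_le: "cover_by g S \<Longrightarrow> \<mu> S \<le> cost g"
  unfolding \<mu>_def by (intro INF_lower) simp

lemma \<mu>_le_L:
  assumes "continuous_on UNIV f" "\<And>a. 0 \<le> f a" "\<And>a. a \<in> S \<Longrightarrow> 1 \<le> f a"
  shows "\<mu> S \<le> ennreal (L f)"
proof -
  define g where "g n = (if n = (0::nat) then f else (\<lambda>a. 0))" for n
  have s: "(\<Sum>n. ennreal (g n a)) = ennreal (f a)" for a
    by (subst suminf_finite[of "{0}"]) (auto simp: g_def)
  have "cover_by g S"
    using assms unfolding cover_by_def s by (auto simp: g_def)
  moreover have "cost g = ennreal (L f)"
    unfolding cost_def by (subst suminf_finite[of "{0}"]) (auto simp: g_def L_zero)
  ultimately show ?thesis
    using \<mu>_le by metis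
qed

lemma \<mu>_mono: "S \<subseteq> T \<Longrightarrow> \<mu> S \<le> \<mu> T"
  unfolding \<mu>_def by (intro INF_superset_mono) (auto simp: cover_by_def)

lemma \<mu>_empty: "\<mu> {} = 0"
  using \<mu>_le_L[of "\<lambda>a. 0" "{}"] by (simp add: L_zero)

lemma \<mu>_subadditive: "\<mu> (\<Union>i. A i) \<le> (\<Sum>i. \<mu> (A i))" for A :: "nat \<Rightarrow> 'a set"
proof (rule ennreal_le_epsilon)
  fix e :: real assume e: "0 < e" and fin: "(\<Sum>i. \<mu> (A i)) < top"
  have "\<exists>g. cover_by g (A i) \<and> cost g < \<mu> (A i) + ennreal (e * (1/2) ^ Suc i)" for i
  proof -
    have "\<mu> (A i) \<noteq> \<infinity>"
      using ennreal_suminf_lessD[OF fin, of i] by (simp add: less_top)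
    then show ?thesis
      using INF_approx_ennreal[of "e * (1/2) ^ Suc i" "\<mu> (A i)" cost "{g. cover_by g (A i)}"] e
      unfolding \<mu>_def by (simp add: Bex_def)
  qed
  then obtain g where g: "\<And>i. cover_by (g i) (A i)"
      "\<And>i. cost (g i) < \<mu> (A i) + ennreal (e * (1/2) ^ Suc i)"
    by metis
  define h where "h k = g (fst (prod_decode k)) (snd (prod_decode k))" for k
  have dbl: "(\<Sum>k. F (h k)) = (\<Sum>i. \<Sum>n. F (g i n))" for F :: "_ \<Rightarrow> ennreal"
    using suminf_ennreal_2dimen[of "\<lambda>i. \<Sum>n. F (g i n)" "\<lambda>(i, n). F (g i n)"]
    by (simp add: h_def split_beta)
  have "cover_by h (\<Union>i. A i)"
    unfolding cover_by_def
  proof (intro conjI allI ballI)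
    show "continuous_on UNIV (h n)" "0 \<le> h n a" for n a
      using g(1) by (auto simp: h_def cover_by_def)
    fix a assume "a \<in> (\<Union>i. A i)"
    then obtain i where "a \<in> A i" by blast
    then have "1 \<le> (\<Sum>n. ennreal (g i n a))"
      using g(1)[of i] by (auto simp: cover_by_def)
    also have "\<dots> \<le> (\<Sum>i. \<Sum>n. ennreal (g i n a))"
      using sum_le_suminf[of "\<lambda>i. \<Sum>n. ennreal (g i n a)" "{i}"] by simp
    also have "\<dots> = (\<Sum>k. ennreal (h k a))"
      using dbl[of "\<lambda>f. ennreal (f a)"] by simp
    finally show "1 \<le> (\<Sum>n. ennreal (h n a))" .
  qed
  then have "\<mu> (\<Union>i. A i) \<le> cost h"
    by (rule \<mu>_le)
  also have "\<dots> = (\<Sum>i. cost (g i))"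
    using dbl[of "\<lambda>f. ennreal (L f)"] by (simp add: cost_def)
  also have "\<dots> \<le> (\<Sum>i. \<mu> (A i) + ennreal (e * (1/2) ^ Suc i))"
    using g(2) by (intro suminf_le) (auto intro: less_imp_le)
  also have "\<dots> = (\<Sum>i. \<mu> (A i)) + (\<Sum>i. ennreal (e * (1/2) ^ Suc i))"
    by (rule suminf_add[symmetric]) auto
  also have "(\<Sum>i. ennreal (e * (1/2) ^ Suc i)) = ennreal e"
    using e sums_mult[OF power_half_series, of e]
    by (intro suminf_ennreal_eq) auto
  finally show "\<mu> (\<Union>i. A i) \<le> (\<Sum>i. \<mu> (A i)) + ennreal e" .
qed

lemma outer_measure_space_\<mu>: "outer_measure_space (Pow UNIV) \<mu>"
  unfolding outer_measure_space_def positive_def increasing_def countably_subadditive_def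
  using \<mu>_empty \<mu>_mono \<mu>_subadditive by auto

text \<open>Dini: the increasing open sets \<open>f - e < \<Sum>\<^sub>n\<^sub><\<^sub>N g\<^sub>n\<close> cover the compact space, so one of them
  is everything.\<close>

lemma L_le_cost:
  assumes f: "continuous_on UNIV f" and g: "\<And>n. continuous_on UNIV (g n)" "\<And>n a. 0 \<le> g n a"
    and le: "\<And>a. ennreal (f a) \<le> (\<Sum>n. ennreal (g n a))"
  shows "ennreal (L f) \<le> cost g"
proof (rule ennreal_le_epsilon)
  fix e :: real assume e: "0 < e"
  \<comment> \<open>A uniform error d changes the functional by d times its value at 1, which must
    stay below e; the added 1 covers the zero functional.\<close>
  define d where "d = e / (L (\<lambda>a. 1) + 1)"
  have d: "d > 0" "d * L (\<lambda>a. 1) \<le> e"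
    using e L_one_nonneg by (simp_all add: d_def field_simps)
  define W where "W N = {a. f a - d < (\<Sum>n<N. g n a)}" for N
  have "open (W N)" for N
    unfolding W_def using f g by (intro open_Collect_less continuous_intros) auto
  moreover have "UNIV \<subseteq> (\<Union>N\<in>UNIV. W N)"
  proof
    fix a
    show "a \<in> (\<Union>N\<in>UNIV. W N)"
    \<comment> \<open>Where f a - d is negative, \<open>ennreal\<close> would truncate it; there the
      empty sum already exceeds it.\<close>
    proof (cases "f a < d")
      case True
      then have "a \<in> W 0" by (simp add: W_def)
      then show ?thesis by blast
    next
      case False
      then have "ennreal (f a - d) < ennreal (f a)"
        using d by (intro ennreal_lessI) auto
      also have "\<dots> \<le> (SUP N. \<Sum>n<N. ennreal (g n a))"
        using le[of a] by (simp add: suminf_eq_SUP)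
      finally obtain N where "ennreal (f a - d) < (\<Sum>n<N. ennreal (g n a))"
        by (auto simp: less_SUP_iff)
      then have "ennreal (f a - d) < ennreal (\<Sum>n<N. g n a)"
        using g(2) by (simp add: sum_ennreal)
      then have "a \<in> W N"
        using False by (simp add: W_def ennreal_less_iff)
      then show ?thesis by blast
    qed
  qed
  ultimately obtain C where C: "finite C" "UNIV \<subseteq> (\<Union>N\<in>C. W N)"
    using compactE_image[OF cpt, of UNIV W] by metis
  obtain N where N: "\<And>k. k \<in> C \<Longrightarrow> k < N"
    using C(1) finite_nat_bounded by (metis lessThan_iff subset_eq)
  have "f a \<le> (\<Sum>n<N. g n a) + d" for a
  proof -
    obtain k where k: "k \<in> C" "a \<in> W k"
      using C(2) by blast
    have "(\<Sum>n<k. g n a) \<le> (\<Sum>n<N. g n a)"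
      using N[OF k(1)] g(2) by (intro sum_mono2) auto
    with k(2) show ?thesis
      by (simp add: W_def)
  qed
  then have "L f \<le> L (\<lambda>a. (\<Sum>n<N. g n a) + d)"
    using f g by (intro L_mono continuous_intros) auto
  also have "\<dots> = (\<Sum>n<N. L (g n)) + d * L (\<lambda>a. 1)"
    using g by (simp add: L_add continuous_on_sum L_sum L_const[of d])
  finally have "ennreal (L f) \<le> ennreal ((\<Sum>n<N. L (g n)) + e)"
    using d by (intro ennreal_leI) linarith
  also have "\<dots> = (\<Sum>n<N. ennreal (L (g n))) + ennreal e"
    using L_nonneg g e by (simp add: ennreal_plus sum_nonneg sum_ennreal)
  also have "\<dots> \<le> cost g + ennreal e"
    unfolding cost_def by (intro add_right_mono sum_le_suminf) auto
  finally show "ennreal (L f) \<le> cost g + ennreal e" .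
qed

lemma \<mu>_UNIV: "\<mu> UNIV = ennreal (L (\<lambda>a. 1))"
proof (rule antisym)
  show "\<mu> UNIV \<le> ennreal (L (\<lambda>a. 1))"
    by (rule \<mu>_le_L) auto
  show "ennreal (L (\<lambda>a. 1)) \<le> \<mu> UNIV"
    unfolding \<mu>_def
    by (intro INF_greatest L_le_cost) (auto simp: cover_by_def)
qed

text \<open>For \<open>U = {f > 0}\<close> take \<open>h\<^sub>k = min 1 (k f)\<close>, increasing to the indicator of \<open>U\<close>. A cover
  \<open>g\<close> of \<open>S\<close> splits into the cover \<open>g\<^sub>n (1 - h\<^sub>k)\<close> of \<open>S - U\<close> and, as \<open>k\<close> grows, the telescoping
  cover \<open>g\<^sub>n (h\<^sub>k\<^sub>+\<^sub>1 - h\<^sub>k)\<close> of \<open>S \<inter> U\<close>.\<close>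

lemma \<mu>_split:
  fixes f :: "'a \<Rightarrow> real"
  assumes f: "continuous_on UNIV f" "\<And>a. 0 \<le> f a"
  shows "\<mu> (S \<inter> {a. 0 < f a}) + \<mu> (S - {a. 0 < f a}) \<le> \<mu> S"
proof -
  define U where "U = {a. 0 < f a}"
  have "\<mu> (S \<inter> U) + \<mu> (S - U) \<le> cost g" if g: "cover_by g S" for g
  proof -
    have gc: "continuous_on UNIV (g n)" and g0: "0 \<le> g n a" for n a
      using g by (auto simp: cover_by_def)
    define h where "h k a = min 1 (real k * f a)" for k a
    have hc: "continuous_on UNIV (h k)" for k
      unfolding h_def using f(1) by (intro continuous_intros)
    have h01: "0 \<le> h k a" "h k a \<le> 1" for k a
      using f(2) by (auto simp: h_def)
    have h_Suc: "h k a \<le> h (Suc k) a" for k a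
      using f(2)[of a] by (simp add: h_def algebra_simps min_le_iff_disj)
    have h0: "h 0 a = 0" for a
      by (simp add: h_def)
    have hU: "\<exists>k. h k a = 1" if "a \<in> U" for a
    proof -
      obtain k where "1 / f a < real k"
        using reals_Archimedean2 by blast
      then have "1 \<le> real k * f a"
        using that by (simp add: U_def field_simps)
      then show ?thesis
        by (auto simp: h_def min_def)
    qed
    have hN: "h k a = 0" if "a \<notin> U" for a k
      using that f(2)[of a] by (simp add: U_def h_def)
    have L_g: "0 \<le> L (\<lambda>a. g n a * r a)" if "continuous_on UNIV r" "\<And>a. 0 \<le> r a" for r n
      using g0 that by (intro L_nonneg continuous_on_mult gc) auto
    define p where "p k = cost (\<lambda>n a. g n a * h k a)" for k
    define q where "q k = cost (\<lambda>n a. g n a * (1 - h k a))" for k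
    have pq: "p k + q k = cost g" for k
    proof -
      have "ennreal (L (\<lambda>a. g n a * h k a)) + ennreal (L (\<lambda>a. g n a * (1 - h k a))) = ennreal (L (g n))" for n
      proof -
        have "L (g n) = L (\<lambda>a. g n a * h k a + g n a * (1 - h k a))"
          by (simp add: algebra_simps)
        also have "\<dots> = L (\<lambda>a. g n a * h k a) + L (\<lambda>a. g n a * (1 - h k a))"
          by (intro L_add continuous_intros gc hc)
        finally show ?thesis
          using L_g[of "h k" n] L_g[of "\<lambda>a. 1 - h k a" n] hc h01
          by (simp add: ennreal_plus[symmetric] continuous_on_diff del: ennreal_plus)
      qed
      then show ?thesis
        unfolding p_def q_def cost_def by (subst suminf_add) auto
    qed
    have out: "\<mu> (S - U) \<le> q k" for k
      unfolding q_def
    proof (rule \<mu>_le)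
      show "cover_by (\<lambda>n a. g n a * (1 - h k a)) (S - U)"
        using g h01 hN g0 unfolding cover_by_def
        by (auto intro!: continuous_intros gc hc)
    qed
    have ins: "\<mu> (S \<inter> U) \<le> (SUP k. p k)"
    proof -
      define w where "w j = (\<lambda>a. g (snd (prod_decode j)) a *
        (h (Suc (fst (prod_decode j))) a - h (fst (prod_decode j)) a))" for j
      have dbl: "(\<Sum>j. F (w j)) = (\<Sum>k. \<Sum>n. F (\<lambda>a. g n a * (h (Suc k) a - h k a)))"
        for F :: "_ \<Rightarrow> ennreal"
        using suminf_ennreal_2dimen[of "\<lambda>k. \<Sum>n. F (\<lambda>a. g n a * (h (Suc k) a - h k a))"
            "\<lambda>(k, n). F (\<lambda>a. g n a * (h (Suc k) a - h k a))"]
        by (simp add: w_def split_beta)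
      \<comment> \<open>Used for two choices of \<open>F\<close>, evaluation at a point and the
        functional \<open>L\<close>. The telescoping is phrased with sums because subtraction in
        \<open>ennreal\<close> is truncated.\<close>
      have partial: "(\<Sum>k<K. \<Sum>n. F (\<lambda>a. g n a * (h (Suc k) a - h k a))) = (\<Sum>n. F (\<lambda>a. g n a * h K a))"
        if F0: "\<And>n. F (\<lambda>a. g n a * h 0 a) = 0"
          and FS: "\<And>n k. F (\<lambda>a. g n a * (h (Suc k) a - h k a)) + F (\<lambda>a. g n a * h k a) = F (\<lambda>a. g n a * h (Suc k) a)"
        for F :: "_ \<Rightarrow> ennreal" and K
      proof (induction K)
        case 0
        then show ?case by (simp add: F0)
      next
        case (Suc K)
        then have "(\<Sum>k<Suc K. \<Sum>n. F (\<lambda>a. g n a * (h (Suc k) a - h k a))) =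
            (\<Sum>n. F (\<lambda>a. g n a * (h (Suc K) a - h K a))) + (\<Sum>n. F (\<lambda>a. g n a * h K a))"
          by (simp add: add.commute)
        also have "\<dots> = (\<Sum>n. F (\<lambda>a. g n a * (h (Suc K) a - h K a)) + F (\<lambda>a. g n a * h K a))"
          by (rule suminf_add) auto
        finally show ?case
          by (simp add: FS)
      qed
      have "cover_by w (S \<inter> U)"
        unfolding cover_by_def
      proof (intro conjI allI ballI)
        show "continuous_on UNIV (w j)" for j
          unfolding w_def by (intro continuous_intros gc hc)
        show "0 \<le> w j a" for j a
          using g0 h_Suc by (simp add: w_def)
        fix a assume a: "a \<in> S \<inter> U"
        then obtain K where K: "h K a = 1"
          using hU by blast
        have "1 \<le> (\<Sum>n. ennreal (g n a * h K a))"
          using g a K by (auto simp: cover_by_def)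
        also have "\<dots> = (\<Sum>k<K. \<Sum>n. ennreal (g n a * (h (Suc k) a - h k a)))"
          using g0 h01 h_Suc
          by (intro partial[of "\<lambda>f. ennreal (f a)", symmetric])
             (auto simp: h0 ennreal_plus[symmetric] algebra_simps mult_left_mono simp del: ennreal_plus)
        also have "\<dots> \<le> (\<Sum>k. \<Sum>n. ennreal (g n a * (h (Suc k) a - h k a)))"
          by (intro sum_le_suminf) auto
        also have "\<dots> = (\<Sum>j. ennreal (w j a))"
          using dbl[of "\<lambda>f. ennreal (f a)"] by simp
        finally show "1 \<le> (\<Sum>j. ennreal (w j a))" .
      qed
      then have "\<mu> (S \<inter> U) \<le> cost w"
        by (rule \<mu>_le)
      also have "\<dots> = (\<Sum>k. \<Sum>n. ennreal (L (\<lambda>a. g n a * (h (Suc k) a - h k a))))"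
        using dbl[of "\<lambda>f. ennreal (L f)"] by (simp add: cost_def)
      also have "\<dots> = (SUP K. \<Sum>k<K. \<Sum>n. ennreal (L (\<lambda>a. g n a * (h (Suc k) a - h k a))))"
        by (rule suminf_eq_SUP)
      also have "\<dots> = (SUP K. p K)"
      proof (intro SUP_cong refl)
        fix K
        have "ennreal (L (\<lambda>a. g n a * (h (Suc k) a - h k a))) + ennreal (L (\<lambda>a. g n a * h k a)) =
            ennreal (L (\<lambda>a. g n a * h (Suc k) a))" for n k
        proof -
          have "L (\<lambda>a. g n a * h (Suc k) a) = L (\<lambda>a. g n a * (h (Suc k) a - h k a) + g n a * h k a)"
            by (simp add: algebra_simps)
          also have "\<dots> = L (\<lambda>a. g n a * (h (Suc k) a - h k a)) + L (\<lambda>a. g n a * h k a)"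
            by (intro L_add continuous_intros gc hc)
          finally show ?thesis
            using L_g[of "h k" n] L_g[of "\<lambda>a. h (Suc k) a - h k a" n] hc h01 h_Suc
            by (simp add: ennreal_plus[symmetric] continuous_on_diff del: ennreal_plus)
        qed
        then show "(\<Sum>k<K. \<Sum>n. ennreal (L (\<lambda>a. g n a * (h (Suc k) a - h k a)))) = p K"
          unfolding p_def cost_def
          by (intro partial[of "\<lambda>f. ennreal (L f)"]) (simp_all add: h0 L_zero)
      qed
      finally show ?thesis .
    qed
    have "\<mu> (S \<inter> U) + \<mu> (S - U) \<le> (SUP k. p k) + \<mu> (S - U)"
      using ins by (rule add_right_mono)
    also have "\<dots> = (SUP k. p k + \<mu> (S - U))"
      by (rule ennreal_SUP_add_left[symmetric]) simp
    also have "\<dots> \<le> cost g"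
    proof (rule SUP_least)
      fix k
      show "p k + \<mu> (S - U) \<le> cost g"
        using add_left_mono[OF out[of k], of "p k"] by (simp add: pq)
    qed
    finally show ?thesis .
  qed
  then show ?thesis
    unfolding \<mu>_def[of S] U_def by (intro INF_greatest) auto
qed

text \<open>By \<open>\<mu>_split\<close> the sets {f > 0} are Caratheodory measurable; countable
  unions of them give the open sets and these generate the Borel sets.\<close>

lemma ex_measure: "\<exists>M. sets M = sets (borel :: 'a measure) \<and> (\<forall>\<alpha>\<in>sets borel. emeasure M \<alpha> = \<mu> \<alpha>)"
proof -
  interpret P: sigma_algebra UNIV "Pow (UNIV :: 'a set)"
    by (rule sigma_algebra_Pow)
  define \<Lambda> where "\<Lambda> = lambda_system UNIV (Pow UNIV) \<mu>"
  have ms: "measure_space UNIV \<Lambda> \<mu>"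
    unfolding \<Lambda>_def by (rule P.caratheodory_lemma[OF outer_measure_space_\<mu>])
  then interpret \<Lambda>: sigma_algebra UNIV \<Lambda>
    by (simp add: measure_space_def)
  have pos_sets: "{a. 0 < f a} \<in> \<Lambda>" if "continuous_on UNIV f" "\<And>a. 0 \<le> f a" for f :: "'a \<Rightarrow> real"
  proof -
    have "\<mu> (S \<inter> {a. 0 < f a}) + \<mu> (S - {a. 0 < f a}) = \<mu> S" for S
    proof (rule antisym[OF \<mu>_split[OF that]])
      have "subadditive (Pow UNIV) \<mu>"
        using outer_measure_space_\<mu> unfolding outer_measure_space_def
        by (intro P.countably_subadditive_subadditive) auto
      then have "\<mu> ((S \<inter> {a. 0 < f a}) \<union> (S - {a. 0 < f a})) \<le> \<mu> (S \<inter> {a. 0 < f a}) + \<mu> (S - {a. 0 < f a})"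
        by (rule subadditiveD) auto
      then show "\<mu> S \<le> \<mu> (S \<inter> {a. 0 < f a}) + \<mu> (S - {a. 0 < f a})"
        by (simp add: Int_Diff_Un)
    qed
    then show ?thesis
      unfolding \<Lambda>_def P.lambda_system_eq by simp
  qed
  have "U \<in> \<Lambda>" if "open U" for U
  proof (rule open_eq_Union_positive_sets[OF cpt that])
    fix \<F> :: "('a \<Rightarrow> real) set"
    assume \<F>: "countable \<F>"
      "\<And>f. f \<in> \<F> \<Longrightarrow> continuous_on UNIV f \<and> (\<forall>a. 0 \<le> f a)" "U = (\<Union>f\<in>\<F>. {a. 0 < f a})"
    show "U \<in> \<Lambda>"
      unfolding \<F>(3) using \<F>(1,2) pos_sets by (intro \<Lambda>.countable_UN') auto
  qed
  then have sub: "sets borel \<subseteq> \<Lambda>"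
    unfolding sets_borel by (intro \<Lambda>.sigma_sets_subset) auto
  have sa: "sigma_algebra UNIV (sets (borel :: 'a measure))"
    using sets.sigma_algebra_axioms[of "borel :: 'a measure"] by simp
  have ms': "measure_space UNIV (sets borel) \<mu>"
    by (rule measure_down[OF ms sa sub])
  define M where "M = measure_of UNIV (sets borel) \<mu>"
  have s: "sets M = sets borel"
    unfolding M_def using sigma_algebra.sigma_sets_eq[OF sa] by simp
  moreover have "emeasure M \<alpha> = \<mu> \<alpha>" if "\<alpha> \<in> sets borel" for \<alpha>
    using that ms' by (intro emeasure_measure_of[OF M_def]) (auto simp: measure_space_def s)
  ultimately show ?thesis by blast
qed

text \<open>Covers bound \<mu> from above, so the integral is first shown to be at most
  \<open>L f\<close> for f between 0 and 1. As M has total mass \<open>L (\<lambda>a. 1)\<close>,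
  the same bound for 1 - f is the reverse inequality.\<close>

theorem riesz_markov:
  "\<exists>M. finite_measure M \<and> sets M = sets (borel :: 'a measure) \<and>
    (\<forall>f. continuous_on UNIV f \<longrightarrow> integral\<^sup>L M f = L f)"
proof -
  obtain M where M: "sets M = sets (borel :: 'a measure)" "\<And>\<alpha>. \<alpha> \<in> sets borel \<Longrightarrow> emeasure M \<alpha> = \<mu> \<alpha>"
    using ex_measure by blast
  have sp: "space M = UNIV"
    using sets_eq_imp_space_eq[OF M(1)] by simp
  interpret finite_measure M
    by (rule finite_measureI) (simp add: sp M(2) \<mu>_UNIV)
  have mUNIV: "measure M UNIV = L (\<lambda>a. 1)"
    by (simp add: measure_def M(2) \<mu>_UNIV L_one_nonneg)
  have m_le: "measure M \<alpha> \<le> L f"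
    if "\<alpha> \<in> sets borel" "continuous_on UNIV f" "\<And>a. 0 \<le> f a" "\<And>a. a \<in> \<alpha> \<Longrightarrow> 1 \<le> f a" for \<alpha> f
  proof -
    have "\<mu> \<alpha> \<le> ennreal (L f)"
      using that(2-4) by (rule \<mu>_le_L)
    then show ?thesis
      using L_nonneg[OF that(2,3)] by (simp add: M(2)[OF that(1), symmetric] emeasure_eq_measure)
  qed
  have meas [measurable]: "f \<in> borel_measurable M" if "continuous_on UNIV f" for f :: "'a \<Rightarrow> real"
    using that M(1) by (simp add: borel_measurable_continuous_onI cong: measurable_cong_sets)
  have bdd: "\<exists>C>0. \<forall>a. \<bar>f a\<bar> \<le> C" if "continuous_on UNIV f" for f :: "'a \<Rightarrow> real"
  proof -
    have "bounded (range f)"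
      using that cpt by (intro compact_imp_bounded compact_continuous_image)
    then obtain C where C: "\<bar>f a\<bar> \<le> C" for a
      unfolding bounded_iff by auto
    have "\<bar>f a\<bar> \<le> \<bar>C\<bar> + 1" for a
      using C[of a] by linarith
    then show ?thesis
      by (intro exI[of _ "\<bar>C\<bar> + 1"]) simp
  qed
  have int: "integrable M f" if f: "continuous_on UNIV f" for f :: "'a \<Rightarrow> real"
  proof -
    obtain C where "\<And>a. \<bar>f a\<bar> \<le> C"
      using bdd[OF f] by blast
    then show ?thesis
      using meas[OF f] by (intro integrable_const_bound[where B = C]) auto
  qed
  have le: "integral\<^sup>L M f \<le> L f"
    if f: "continuous_on UNIV f" and f01: "\<And>a. 0 \<le> f a" "\<And>a. f a \<le> 1" for f
  proof (rule field_le_epsilon)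
    fix e :: real assume e: "0 < e"
    obtain N :: nat where N: "L (\<lambda>a. 1) / e < real N"
      using reals_Archimedean2 by blast
    have N0: "0 < real N"
      using N e L_one_nonneg by (meson divide_nonneg_pos le_less_trans)
    have Ne: "L (\<lambda>a. 1) / real N \<le> e"
      using N N0 e by (simp add: field_simps)
    \<comment> \<open>Horizontal slices of f of height 1 / N: the k-th vanishes outside A k and
      equals 1 / N on A (k + 1). This bounds its integral by the first set and its
      \<open>L\<close>-value from below by the second.\<close>
    define c where "c k a = min (f a) (real (Suc k) / N) - min (f a) (real k / N)" for k a
    have cc: "continuous_on UNIV (c k)" for k
      unfolding c_def using f by (intro continuous_intros)
    have c0: "0 \<le> c k a" for k a
      using N0 by (simp add: c_def min_def field_simps)
    have f_eq: "f = (\<lambda>a. \<Sum>k<N. c k a)"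
    proof
      fix a
      have "(\<Sum>k<N. c k a) = min (f a) (real N / N) - min (f a) (real 0 / N)"
        unfolding c_def by (rule sum_lessThan_telescope)
      then show "f a = (\<Sum>k<N. c k a)"
        using f01[of a] N0 by simp
    qed
    define A where "A k = {a. real k / N \<le> f a}" for k
    have A: "A k \<in> sets borel" for k
      unfolding A_def using f by (intro borel_closed closed_Collect_le continuous_intros)
    have c_le: "c k a \<le> (1 / N) * indicator (A k) a" for k a
    proof -
      have "real (Suc k) / N = real k / N + 1 / N"
        by (simp add: add_divide_distrib)
      then show ?thesis
        using N0 by (auto simp: c_def A_def indicator_def min_def)
    qed
    have AL: "measure M (A (Suc k)) / N \<le> L (c k)" for k
    proof -
      have "measure M (A (Suc k)) \<le> L (\<lambda>a. real N * c k a)"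
      proof (rule m_le[OF A])
        show "1 \<le> real N * c k a" if "a \<in> A (Suc k)" for a
        proof -
          have "real k / N \<le> real (Suc k) / N"
            using N0 by (simp add: divide_right_mono)
          then have "c k a = real (Suc k) / N - real k / N"
            using that by (simp add: A_def c_def min_def)
          then show ?thesis
            using N0 by (simp add: field_simps)
        qed
      qed (use c0 N0 cc in \<open>auto intro: continuous_intros\<close>)
      then show ?thesis
        using N0 by (simp add: L_scale[OF cc] field_simps)
    qed
    have ind: "integrable M (\<lambda>a. (1 / N) * indicator (A k) a)"
      "integral\<^sup>L M (\<lambda>a. (1 / N) * indicator (A k) a) = measure M (A k) / N" for k
      using A M(1) by (simp_all add: sp emeasure_eq_measure)
    have "integral\<^sup>L M f = (\<Sum>k<N. integral\<^sup>L M (c k))"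
      by (subst f_eq) (intro Bochner_Integration.integral_sum int cc)
    also have "\<dots> \<le> (\<Sum>k<N. measure M (A k) / N)"
      unfolding ind(2)[symmetric] by (intro sum_mono integral_mono int cc ind c_le)
    \<comment> \<open>Padding by one term allows the shift from A k to A (k + 1). What remains is
      the total mass divided by N, at most e by the choice of N.\<close>
    also have "\<dots> \<le> (\<Sum>k<Suc N. measure M (A k) / N)"
      by simp
    also have "\<dots> = measure M (A 0) / N + (\<Sum>k<N. measure M (A (Suc k)) / N)"
      by (rule sum.lessThan_Suc_shift)
    also have "\<dots> \<le> e + (\<Sum>k<N. L (c k))"
    proof (intro add_mono sum_mono AL)
      have "A 0 = UNIV"
        using f01 by (auto simp: A_def)
      then show "measure M (A 0) / N \<le> e"
        using Ne by (simp add: mUNIV)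
    qed
    also have "(\<Sum>k<N. L (c k)) = L f"
      by (subst f_eq) (simp add: L_sum cc)
    finally show "integral\<^sup>L M f \<le> L f + e"
      by simp
  qed
  have eq: "integral\<^sup>L M f = L f"
    if f: "continuous_on UNIV f" and f01: "\<And>a. 0 \<le> f a" "\<And>a. f a \<le> 1" for f
  proof (rule antisym[OF le[OF that]])
    have "integral\<^sup>L M (\<lambda>a. 1 - f a) \<le> L (\<lambda>a. 1 - f a)"
      using f01 f by (intro le continuous_intros) (auto simp: algebra_simps)
    then show "L f \<le> integral\<^sup>L M f"
      using int[OF f] by (simp add: L_diff f sp mUNIV)
  qed
  have "integral\<^sup>L M f = L f" if f: "continuous_on UNIV f" for f
  proof -
    obtain C where C: "C > 0" "\<And>a. \<bar>f a\<bar> \<le> C"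
      using bdd[OF f] by blast
    \<comment> \<open>The affine rescaling of the range [-C, C] to [0, 1].\<close>
    define g where "g a = (1 / (2 * C)) * (f a + C)" for a
    have g: "continuous_on UNIV g"
      unfolding g_def using f by (intro continuous_intros)
    have f_eq: "f = (\<lambda>a. 2 * C * g a + (- C))"
      using C(1) by (auto simp: g_def field_simps)
    have "0 \<le> g a \<and> g a \<le> 1" for a
      using C(1) C(2)[of a] by (auto simp: g_def field_simps abs_le_iff)
    then have "integral\<^sup>L M g = L g"
      by (intro eq g) auto
    then show ?thesis
      using int[OF g] L_add[of "\<lambda>a. 2 * C * g a" "\<lambda>a. - C"] L_scale[OF g, of "2 * C"] L_const[of "- C"] g
      by (subst (1 2) f_eq) (simp add: sp mUNIV continuous_on_mult_left)
  qed
  then show ?thesis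
    using finite_measure_axioms M(1) by blast
qed

end


subsection \<open>From positive maps to channels\<close>

text \<open>The sets {f > 0} are stable under intersection, by the minimum of two functions, and
  generate the Borel sets by \<open>open_eq_Union_positive_sets\<close>, so the Dynkin principle
  applies. The base case then concerns sets whose indicators are limits of continuous
  functions.\<close>

lemma borel_induct_positive_sets [consumes 2, case_names basic compl union]:
  fixes \<alpha> :: "'a::{t2_space, second_countable_topology} set"
  assumes cpt: "compact (UNIV :: 'a set)" and \<alpha>: "\<alpha> \<in> sets borel"
    and basic: "\<And>f :: 'a \<Rightarrow> real. continuous_on UNIV f \<Longrightarrow> (\<And>a. 0 \<le> f a) \<Longrightarrow> P {a. 0 < f a}"
    and compl: "\<And>\<beta>. \<beta> \<in> sets borel \<Longrightarrow> P \<beta> \<Longrightarrow> P (- \<beta>)"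
    and union: "\<And>A :: nat \<Rightarrow> 'a set. disjoint_family A \<Longrightarrow> range A \<subseteq> sets borel \<Longrightarrow> (\<And>i. P (A i)) \<Longrightarrow> P (\<Union>i. A i)"
  shows "P \<alpha>"
proof -
  define G where "G = {{a. 0 < f a} | f :: 'a \<Rightarrow> real. continuous_on UNIV f \<and> (\<forall>a. 0 \<le> f a)}"
  have G_open: "open S" if "S \<in> G" for S
    using that unfolding G_def by (auto intro: open_Collect_less)
  have int: "Int_stable G"
  proof (rule Int_stableI)
    fix S T assume "S \<in> G" "T \<in> G"
    then obtain f g :: "'a \<Rightarrow> real" where fg: "S = {a. 0 < f a}" "T = {a. 0 < g a}"
      "continuous_on UNIV f" "continuous_on UNIV g" "\<forall>a. 0 \<le> f a" "\<forall>a. 0 \<le> g a"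
      unfolding G_def by auto
    have "S \<inter> T = {a. 0 < min (f a) (g a)}"
      unfolding fg by auto
    then show "S \<inter> T \<in> G"
      unfolding G_def using fg by (auto intro!: exI[of _ "\<lambda>a. min (f a) (g a)"] continuous_on_min)
  qed
  interpret sigma_algebra UNIV "sigma_sets UNIV G"
    by (rule sigma_algebra_sigma_sets) simp
  have gen: "sigma_sets UNIV G = sets borel"
  proof
    have "G \<subseteq> sets borel"
      using G_open by auto
    then show "sigma_sets UNIV G \<subseteq> sets borel"
      using sets.sigma_sets_subset[of G borel] by simp
    have "U \<in> sigma_sets UNIV G" if "open U" for U
    proof (rule open_eq_Union_positive_sets[OF cpt that])
      fix \<F> :: "('a \<Rightarrow> real) set"
      assume \<F>: "countable \<F>"
        "\<And>f. f \<in> \<F> \<Longrightarrow> continuous_on UNIV f \<and> (\<forall>a. 0 \<le> f a)" "U = (\<Union>f\<in>\<F>. {a. 0 < f a})"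
      show "U \<in> sigma_sets UNIV G"
        unfolding \<F>(3) using \<F>(1,2) by (intro countable_UN') (auto simp: G_def intro!: sigma_sets.Basic)
    qed
    then show "sets borel \<subseteq> sigma_sets UNIV G"
      unfolding sets_borel by (intro sigma_sets_subset) auto
  qed
  have empty: "P {}"
    using basic[of "\<lambda>a. 0"] by simp
  show ?thesis
  proof (rule sigma_sets_induct_disjoint[OF int, of UNIV \<alpha> P])
    show "\<alpha> \<in> sigma_sets UNIV G"
      using \<alpha> gen by simp
    show "P A" if "A \<in> G" for A
      using that basic unfolding G_def by auto
  qed (use empty compl union in \<open>auto simp: gen Compl_eq_Diff_UNIV\<close>)
qed

text \<open>For nonnegative f these functions increase with k to the indicator of {f > 0}; they are
  complex-valued so that \<Phi> can be applied.\<close>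

definition plateau :: "('a \<Rightarrow> real) \<Rightarrow> nat \<Rightarrow> 'a \<Rightarrow> complex" where
  "plateau f k a = complex_of_real (min 1 (real k * f a))"

lemma plateau_cfuns: "continuous_on UNIV f \<Longrightarrow> plateau f k \<in> cfuns"
  unfolding plateau_def[abs_def] cfuns_def by (auto intro!: continuous_intros)

lemma plateau_bounds:
  assumes "\<And>a. 0 \<le> f a"
  shows "plateau f k a \<in> \<real>\<^sub>\<ge>\<^sub>0" "cmod (plateau f k a) \<le> 1"
  using assms[of a] by (simp_all add: plateau_def)

lemma plateau_tendsto:
  assumes "\<And>a. 0 \<le> f a"
  shows "(\<lambda>k. plateau f k a) \<longlonglongrightarrow> of_real (indicat_real {a. 0 < f a} a)"
proof (cases "0 < f a")
  case True
  obtain K where K: "1 / f a < real K"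
    using reals_Archimedean2 by blast
  have "plateau f k a = 1" if "k \<ge> K" for k
  proof -
    have "1 / f a \<le> real k"
      using K that by linarith
    then have "1 \<le> real k * f a"
      using True by (simp add: field_simps)
    then show ?thesis
      by (simp add: plateau_def)
  qed
  then have "eventually (\<lambda>k. plateau f k a = of_real (indicat_real {a. 0 < f a} a)) sequentially"
    using True by (auto simp: eventually_sequentially)
  then show ?thesis
    by (rule tendsto_eventually)
next
  case False
  then have "f a = 0"
    using assms[of a] by linarith
  then show ?thesis
    by (simp add: plateau_def)
qed

lemma sesquilinear_limit:
  assumes "\<And>n::nat. sesquilinear (b n)" "\<And>x y. (\<lambda>n. b n x y) \<longlonglongrightarrow> c x y"
  shows "sesquilinear c"
proof -
  note D = sesquilinearD(1-4)[OF assms(1)]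
  show ?thesis
    unfolding sesquilinear_def
  proof (intro conjI allI)
    show "c (x + y) z = c x z + c y z" for x y z
      using LIMSEQ_unique[OF assms(2)[of "x + y" z, unfolded D] tendsto_add[OF assms(2) assms(2)]] .
    show "c x (y + z) = c x y + c x z" for x y z
      using LIMSEQ_unique[OF assms(2)[of x "y + z", unfolded D] tendsto_add[OF assms(2) assms(2)]] .
    show "c (k *\<^sub>C x) y = k * c x y" for k x y
      using LIMSEQ_unique[OF assms(2)[of "k *\<^sub>C x" y, unfolded D] tendsto_mult_left[OF assms(2)]] .
    show "c x (k *\<^sub>C y) = cnj k * c x y" for k x y
      using LIMSEQ_unique[OF assms(2)[of x "k *\<^sub>C y", unfolded D] tendsto_mult_left[OF assms(2)]] .
  qed
qed

lemma sesquilinear_diff: "sesquilinear b \<Longrightarrow> sesquilinear c \<Longrightarrow> sesquilinear (\<lambda>x y. b x y - c x y)"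
  by (simp add: sesquilinear_def algebra_simps)

lemma sesquilinear_sum: "(\<And>i. i \<in> I \<Longrightarrow> sesquilinear (b i)) \<Longrightarrow> sesquilinear (\<lambda>x y. \<Sum>i\<in>I. b i x y)"
  by (simp add: sesquilinear_def sum.distrib sum_distrib_left)

text \<open>Common ground of both converse statements: completely positive maps and *-homomorphisms
  each send nonnegative functions to positive operators.\<close>

locale positive_map =
  fixes \<Phi> :: "('a::{t2_space, second_countable_topology} \<Rightarrow> complex) \<Rightarrow> 'x::topological_space \<Rightarrow>
    ('h::chilbert_space \<Rightarrow>\<^sub>L 'h)"
  assumes cpt: "compact (UNIV :: 'a set)" and lin: "clinear_map \<Phi>" and unital: "unital_map \<Phi>"
    and pos: "\<And>f x. f \<in> cfuns \<Longrightarrow> (\<And>a. f a \<in> \<real>\<^sub>\<ge>\<^sub>0) \<Longrightarrow> positive_op (\<Phi> f x)"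
begin

lemma \<Phi>_wmfuns: "f \<in> cfuns \<Longrightarrow> \<Phi> f \<in> wmfuns"
  using lin by (simp add: clinear_map_def)

lemma \<Phi>_bops: "f \<in> cfuns \<Longrightarrow> \<Phi> f x \<in> bops"
  using \<Phi>_wmfuns by (simp add: wmfuns_def)

definition form :: "'x \<Rightarrow> 'h \<Rightarrow> ('a \<Rightarrow> complex) \<Rightarrow> complex" where
  "form x z f = cinner (blinfun_apply (\<Phi> f x) z) z"

lemma form_add: "f \<in> cfuns \<Longrightarrow> g \<in> cfuns \<Longrightarrow> form x z (\<lambda>a. f a + g a) = form x z f + form x z g"
  using lin by (simp add: form_def clinear_map_def blinfun.add_left cinner_add_left)

lemma form_scale: "f \<in> cfuns \<Longrightarrow> form x z (\<lambda>a. c * f a) = c * form x z f"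
  using lin by (simp add: form_def clinear_map_def cinner_scaleC_left)

lemma form_one: "form x z (\<lambda>a. 1) = of_real ((norm z)\<^sup>2)"
  using unital by (simp add: form_def unital_map_def cinner_self)

lemma form_nonneg: "f \<in> cfuns \<Longrightarrow> (\<And>a. f a \<in> \<real>\<^sub>\<ge>\<^sub>0) \<Longrightarrow> form x z f \<in> \<real>\<^sub>\<ge>\<^sub>0"
  using pos by (simp add: form_def positive_op_def)

lemma of_real_cfuns: "continuous_on UNIV g \<Longrightarrow> (\<lambda>a. complex_of_real (g a)) \<in> cfuns"
  by (auto simp: cfuns_def intro: continuous_intros)

text \<open>Adding a large constant makes g nonnegative, and \<open>form\<close> is real on
  constants.\<close>

lemma form_real:
  assumes g: "continuous_on UNIV g"
  shows "form x z (\<lambda>a. complex_of_real (g a)) = of_real (Re (form x z (\<lambda>a. complex_of_real (g a))))"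
proof -
  let ?f = "\<lambda>a. complex_of_real (g a)"
  obtain C where C: "0 \<le> C" "\<And>a. cmod (?f a) \<le> C"
    using cfuns_bounded[OF cpt of_real_cfuns[OF g]] by blast
  have "form x z (\<lambda>a. ?f a + of_real C * 1) \<in> \<real>\<^sub>\<ge>\<^sub>0"
  proof (rule form_nonneg)
    show "(\<lambda>a. ?f a + of_real C * 1) \<in> cfuns"
      by (intro cfuns_intros of_real_cfuns g cfuns_const)
    have "0 \<le> g a + C" for a
      using C(2)[of a] by simp
    then show "?f a + of_real C * 1 \<in> \<real>\<^sub>\<ge>\<^sub>0" for a
      by (simp flip: of_real_add)
  qed
  moreover have "form x z (\<lambda>a. ?f a + of_real C * 1) = form x z ?f + of_real (C * (norm z)\<^sup>2)"
    by (simp only: form_add form_scale form_one of_real_cfuns[OF g] cfuns_const cfuns_cmult of_real_mult)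
  ultimately have "Im (form x z ?f) = 0"
    by (simp add: complex_nonneg_Reals_iff)
  then show ?thesis
    by (simp add: complex_eq_iff)
qed

definition M :: "'x \<Rightarrow> 'h \<Rightarrow> 'a measure" where
  "M x z = (SOME m. finite_measure m \<and> sets m = sets borel \<and>
     (\<forall>g. continuous_on UNIV g \<longrightarrow> integral\<^sup>L m g = Re (form x z (\<lambda>a. complex_of_real (g a)))))"

lemma
  shows finite_M: "finite_measure (M x z)" and sets_M [simp, measurable_cong]: "sets (M x z) = sets borel"
    and integral_M_real: "continuous_on UNIV g \<Longrightarrow>
      integral\<^sup>L (M x z) g = Re (form x z (\<lambda>a. complex_of_real (g a)))"
proof -
  interpret positive_functional "\<lambda>g. Re (form x z (\<lambda>a. complex_of_real (g a)))"
  proof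
    fix f g :: "'a \<Rightarrow> real" and c :: real
    assume f: "continuous_on UNIV f"
    show "Re (form x z (\<lambda>a. complex_of_real (c * f a))) = c * Re (form x z (\<lambda>a. complex_of_real (f a)))"
      by (simp add: form_scale of_real_cfuns[OF f])
    show "0 \<le> Re (form x z (\<lambda>a. complex_of_real (f a)))" if "\<And>a. 0 \<le> f a"
      using form_nonneg[OF of_real_cfuns[OF f], of x z] that by (simp add: complex_nonneg_Reals_iff)
    assume g: "continuous_on UNIV g"
    show "Re (form x z (\<lambda>a. complex_of_real (f a + g a))) =
        Re (form x z (\<lambda>a. complex_of_real (f a))) + Re (form x z (\<lambda>a. complex_of_real (g a)))"
      by (simp add: form_add of_real_cfuns f g)
  qed (rule cpt)
  have "finite_measure (M x z) \<and> sets (M x z) = sets borel \<and>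
     (\<forall>g. continuous_on UNIV g \<longrightarrow> integral\<^sup>L (M x z) g = Re (form x z (\<lambda>a. complex_of_real (g a))))"
    unfolding M_def by (rule someI_ex[OF riesz_markov])
  then show "finite_measure (M x z)" "sets (M x z) = sets borel"
    "continuous_on UNIV g \<Longrightarrow> integral\<^sup>L (M x z) g = Re (form x z (\<lambda>a. complex_of_real (g a)))"
    by blast+
qed

lemma space_M [simp]: "space (M x z) = UNIV"
  using sets_eq_imp_space_eq[OF sets_M] by simp

lemma integral_M:
  assumes f: "f \<in> cfuns"
  shows "integral\<^sup>L (M x z) f = form x z f"
proof -
  have real: "integral\<^sup>L (M x z) (\<lambda>a. complex_of_real (g a)) = form x z (\<lambda>a. complex_of_real (g a))"
    if "continuous_on UNIV g" for g
    using integral_M_real[OF that] form_real[OF that] by simp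
  have c: "continuous_on UNIV (\<lambda>a. Re (f a))" "continuous_on UNIV (\<lambda>a. Im (f a))"
    using f unfolding cfuns_def by (auto intro: continuous_intros)
  note ci = of_real_cfuns[OF c(1)] of_real_cfuns[OF c(2)]
  note int = cfuns_integrable[OF cpt _ finite_M sets_M]
  have f_eq: "f = (\<lambda>a. complex_of_real (Re (f a)) + \<i> * complex_of_real (Im (f a)))"
    by (simp add: complex_eq_iff fun_eq_iff)
  have "integral\<^sup>L (M x z) f = integral\<^sup>L (M x z) (\<lambda>a. complex_of_real (Re (f a))) +
      integral\<^sup>L (M x z) (\<lambda>a. \<i> * complex_of_real (Im (f a)))"
    by (subst f_eq, rule Bochner_Integration.integral_add) (intro int ci cfuns_cmult)+
  also have "\<dots> = form x z (\<lambda>a. complex_of_real (Re (f a))) + \<i> * form x z (\<lambda>a. complex_of_real (Im (f a)))"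
    by (simp only: real c integral_mult_right_zero)
  also have "\<dots> = form x z f"
    by (subst (3) f_eq) (simp only: form_add form_scale ci cfuns_cmult)
  finally show ?thesis .
qed

lemma measure_M_UNIV: "measure (M x z) UNIV = (norm z)\<^sup>2"
  using integral_M_real[of "\<lambda>a. 1" x z] form_one[of x z] by simp

text \<open>Extends the coefficient of \<open>\<Phi> f x\<close> from continuous f to bounded Borel
  f, with the four measures of \<open>polarization_half\<close>.\<close>

definition eint :: "'x \<Rightarrow> 'h \<Rightarrow> 'h \<Rightarrow> ('a \<Rightarrow> complex) \<Rightarrow> complex" where
  "eint x \<xi> \<eta> f =
     integral\<^sup>L (M x ((1/2) *\<^sub>R (\<xi> + \<eta>))) f - integral\<^sup>L (M x ((1/2) *\<^sub>R (\<xi> - \<eta>))) f +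
     \<i> * (integral\<^sup>L (M x ((1/2) *\<^sub>R (\<xi> + \<i> *\<^sub>C \<eta>))) f - integral\<^sup>L (M x ((1/2) *\<^sub>R (\<xi> - \<i> *\<^sub>C \<eta>))) f)"

definition ecoeff :: "'x \<Rightarrow> 'h \<Rightarrow> 'h \<Rightarrow> 'a set \<Rightarrow> complex" where
  "ecoeff x \<xi> \<eta> \<alpha> = eint x \<xi> \<eta> (\<lambda>a. complex_of_real (indicat_real \<alpha> a))"

lemma eint_cfuns: "f \<in> cfuns \<Longrightarrow> eint x \<xi> \<eta> f = cinner (blinfun_apply (\<Phi> f x) \<xi>) \<eta>"
  using polarization_half[OF sesquilinear_cinner_apply[OF \<Phi>_bops], of f x \<xi> \<eta>]
  by (simp add: eint_def integral_M form_def)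

lemma eint_tendsto:
  fixes u :: "nat \<Rightarrow> 'a \<Rightarrow> complex"
  assumes u: "\<And>k. u k \<in> borel_measurable borel" and v: "v \<in> borel_measurable borel"
    and bound: "\<And>k a. cmod (u k a) \<le> 1" and lim: "\<And>a. (\<lambda>k. u k a) \<longlonglongrightarrow> v a"
  shows "(\<lambda>k. eint x \<xi> \<eta> (u k)) \<longlonglongrightarrow> eint x \<xi> \<eta> v"
proof -
  have "(\<lambda>k. integral\<^sup>L (M x z) (u k)) \<longlonglongrightarrow> integral\<^sup>L (M x z) v" for z
  proof (rule integral_dominated_convergence[where w = "\<lambda>_. 1"])
    interpret finite_measure "M x z" by (rule finite_M)
    show "integrable (M x z) (\<lambda>_. 1 :: real)" by simp
  qed (use u v bound lim in \<open>auto cong: measurable_cong_sets\<close>)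
  then show ?thesis
    unfolding eint_def by (intro tendsto_intros)
qed

lemma integral_M_indicator:
  "\<alpha> \<in> sets borel \<Longrightarrow> integral\<^sup>L (M x z) (\<lambda>a. complex_of_real (indicat_real \<alpha> a)) = of_real (measure (M x z) \<alpha>)"
  by simp

lemma ecoeff_measure:
  "\<alpha> \<in> sets borel \<Longrightarrow> ecoeff x \<xi> \<eta> \<alpha> =
     of_real (measure (M x ((1/2) *\<^sub>R (\<xi> + \<eta>))) \<alpha>) - of_real (measure (M x ((1/2) *\<^sub>R (\<xi> - \<eta>))) \<alpha>) +
     \<i> * (of_real (measure (M x ((1/2) *\<^sub>R (\<xi> + \<i> *\<^sub>C \<eta>))) \<alpha>) - of_real (measure (M x ((1/2) *\<^sub>R (\<xi> - \<i> *\<^sub>C \<eta>))) \<alpha>))"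
  unfolding ecoeff_def eint_def by (simp only: integral_M_indicator)

lemma ecoeff_sums:
  fixes A :: "nat \<Rightarrow> 'a set"
  assumes A: "range A \<subseteq> sets borel" "disjoint_family A"
  shows "(\<lambda>n. ecoeff x \<xi> \<eta> (A n)) sums ecoeff x \<xi> \<eta> (\<Union>n. A n)"
proof -
  have *: "(\<lambda>n. complex_of_real (measure (M x z) (A n))) sums complex_of_real (measure (M x z) (\<Union>n. A n))" for z
    using A by (intro sums_of_real finite_measure.finite_measure_UNION[OF finite_M]) auto
  have An: "A n \<in> sets borel" for n
    using A(1) by auto
  have "(\<Union>n. A n) \<in> sets borel"
    using A(1) by auto
  then show ?thesis
    unfolding ecoeff_measure[OF An] ecoeff_measure[OF \<open>(\<Union>n. A n) \<in> sets borel\<close>]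
    by (intro sums_add sums_diff sums_mult *)
qed

lemma ecoeff_Un:
  assumes "\<alpha> \<in> sets borel" "\<beta> \<in> sets borel" "\<alpha> \<inter> \<beta> = {}"
  shows "ecoeff x \<xi> \<eta> (\<alpha> \<union> \<beta>) = ecoeff x \<xi> \<eta> \<alpha> + ecoeff x \<xi> \<eta> \<beta>"
  using assms
  by (simp add: ecoeff_measure finite_measure.finite_measure_Union[OF finite_M] algebra_simps)

lemma ecoeff_UNIV: "ecoeff x \<xi> \<eta> UNIV = cinner \<xi> \<eta>"
  using eint_cfuns[OF cfuns_const[of 1], of x \<xi> \<eta>] unital by (simp add: ecoeff_def unital_map_def)

lemma ecoeff_Compl:
  assumes "\<alpha> \<in> sets borel"
  shows "ecoeff x \<xi> \<eta> (- \<alpha>) = cinner \<xi> \<eta> - ecoeff x \<xi> \<eta> \<alpha>"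
  using ecoeff_Un[of \<alpha> "- \<alpha>" x \<xi> \<eta>] assms by (simp add: ecoeff_UNIV borel_comp algebra_simps)

lemma positive_set_borel:
  fixes f :: "'a \<Rightarrow> real"
  shows "continuous_on UNIV f \<Longrightarrow> {a. 0 < f a} \<in> sets borel"
  by (intro borel_open open_Collect_less continuous_on_const)

lemma plateau_measurable:
  fixes f :: "'a \<Rightarrow> real"
  shows "continuous_on UNIV f \<Longrightarrow> plateau f k \<in> borel_measurable borel"
  using plateau_cfuns[of f k] cfuns_measurable by blast

lemma \<Phi>_plateau_tendsto:
  assumes f: "continuous_on UNIV f" "\<And>a. 0 \<le> f a"
  shows "(\<lambda>k. cinner (blinfun_apply (\<Phi> (plateau f k) x) \<xi>) \<eta>) \<longlonglongrightarrow> ecoeff x \<xi> \<eta> {a. 0 < f a}"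
  unfolding ecoeff_def eint_cfuns[OF plateau_cfuns[OF f(1)], symmetric]
  using positive_set_borel[OF f(1)]
  by (intro eint_tendsto plateau_measurable f plateau_tendsto plateau_bounds) auto

text \<open>The polarization formula alone gives neither claim: even for equal vectors it mixes the
  measures at four vectors. For {f > 0} both follow in the limit from the operators \<Phi> of the
  plateaus; complements and disjoint unions preserve them. The diagonal part later gives positivity
  and boundedness.\<close>

lemma ecoeff_sesquilinear:
  assumes "\<alpha> \<in> sets borel"
  shows "sesquilinear (\<lambda>\<xi> \<eta>. ecoeff x \<xi> \<eta> \<alpha>) \<and> (\<forall>\<xi>. ecoeff x \<xi> \<xi> \<alpha> = of_real (measure (M x \<xi>) \<alpha>))"
  using cpt assms
proof (induction rule: borel_induct_positive_sets)
  case (basic f)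
  have "sesquilinear (\<lambda>\<xi> \<eta>. ecoeff x \<xi> \<eta> {a. 0 < f a})"
    by (rule sesquilinear_limit[OF _ \<Phi>_plateau_tendsto[OF basic]])
       (intro sesquilinear_cinner_apply \<Phi>_bops plateau_cfuns basic)
  moreover have "ecoeff x \<xi> \<xi> {a. 0 < f a} = of_real (measure (M x \<xi>) {a. 0 < f a})" for \<xi>
  proof (rule LIMSEQ_unique[OF \<Phi>_plateau_tendsto[OF basic]])
    interpret finite_measure "M x \<xi>" by (rule finite_M)
    have "(\<lambda>k. integral\<^sup>L (M x \<xi>) (plateau f k)) \<longlonglongrightarrow>
        integral\<^sup>L (M x \<xi>) (\<lambda>a. complex_of_real (indicat_real {a. 0 < f a} a))"
      by (rule integral_dominated_convergence[where w = "\<lambda>_. 1"])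
         (use positive_set_borel[OF basic(1)] plateau_measurable[OF basic(1)] plateau_bounds[of f, OF basic(2)]
           plateau_tendsto[of f, OF basic(2)] in \<open>auto cong: measurable_cong_sets\<close>)
    then show "(\<lambda>k. cinner (blinfun_apply (\<Phi> (plateau f k) x) \<xi>) \<xi>) \<longlonglongrightarrow>
        complex_of_real (measure (M x \<xi>) {a. 0 < f a})"
      by (simp only: integral_M_indicator[OF positive_set_borel[OF basic(1)]]
          integral_M[OF plateau_cfuns[OF basic(1)]] form_def)
  qed
  ultimately show ?case by blast
next
  case (compl \<beta>)
  have "measure (M x \<xi>) (- \<beta>) = (norm \<xi>)\<^sup>2 - measure (M x \<xi>) \<beta>" for \<xi>
    using finite_measure.finite_measure_compl[OF finite_M, of \<beta> x \<xi>] compl(1)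
    by (simp add: measure_M_UNIV Compl_eq_Diff_UNIV)
  then show ?case
    using compl by (simp add: ecoeff_Compl cinner_self sesquilinear_diff sesquilinear_cinner)
next
  case (union A)
  have s: "(\<lambda>N. \<Sum>n<N. ecoeff x \<xi> \<eta> (A n)) \<longlonglongrightarrow> ecoeff x \<xi> \<eta> (\<Union>n. A n)" for \<xi> \<eta>
    using ecoeff_sums[OF union(2,1)] by (simp add: sums_def)
  have "sesquilinear (\<lambda>\<xi> \<eta>. ecoeff x \<xi> \<eta> (\<Union>n. A n))"
    by (rule sesquilinear_limit[OF _ s]) (use union(3) in \<open>auto intro: sesquilinear_sum\<close>)
  moreover have "ecoeff x \<xi> \<xi> (\<Union>n. A n) = of_real (measure (M x \<xi>) (\<Union>n. A n))" for \<xi>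
  proof (rule sums_unique2)
    show "(\<lambda>n. ecoeff x \<xi> \<xi> (A n)) sums ecoeff x \<xi> \<xi> (\<Union>n. A n)"
      by (rule ecoeff_sums[OF union(2,1)])
    show "(\<lambda>n. ecoeff x \<xi> \<xi> (A n)) sums complex_of_real (measure (M x \<xi>) (\<Union>n. A n))"
      using union finite_measure.finite_measure_UNION[OF finite_M, of A x \<xi>]
      by (simp add: sums_of_real)
  qed
  ultimately show ?case by blast
qed

lemma ecoeff_diag: "\<alpha> \<in> sets borel \<Longrightarrow> ecoeff x \<xi> \<xi> \<alpha> = of_real (measure (M x \<xi>) \<alpha>)"
  using ecoeff_sesquilinear by blast

section \<open>The operators of the channel\<close>

definition E :: "'x \<Rightarrow> 'a set \<Rightarrow> ('h \<Rightarrow>\<^sub>L 'h)" where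
  "E x \<alpha> = (SOME T. T \<in> bops \<and> (\<forall>\<xi> \<eta>. cinner (blinfun_apply T \<xi>) \<eta> = ecoeff x \<xi> \<eta> \<alpha>))"

lemma
  assumes \<alpha>: "\<alpha> \<in> sets borel"
  shows E_bops: "E x \<alpha> \<in> bops" and cinner_E: "cinner (blinfun_apply (E x \<alpha>) \<xi>) \<eta> = ecoeff x \<xi> \<eta> \<alpha>"
proof -
  interpret finite_measure "M x z" for z by (rule finite_M)
  have "cmod (ecoeff x z z \<alpha>) \<le> 1 * (norm z)\<^sup>2" for z
    using finite_measure_mono[of \<alpha> UNIV z] by (simp add: ecoeff_diag[OF \<alpha>] measure_M_UNIV)
  then have bound: "cmod (ecoeff x \<xi> \<eta> \<alpha>) \<le> 2 * 1 * norm \<xi> * norm \<eta>" for \<xi> \<eta>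
    using ecoeff_sesquilinear[OF \<alpha>] by (intro sesquilinear_bound) auto
  have "\<exists>T. T \<in> bops \<and> (\<forall>\<xi> \<eta>. cinner (blinfun_apply T \<xi>) \<eta> = ecoeff x \<xi> \<eta> \<alpha>)"
    using sesquilinear_operator_exists[OF _ bound] ecoeff_sesquilinear[OF \<alpha>] by blast
  then have "E x \<alpha> \<in> bops \<and> (\<forall>\<xi> \<eta>. cinner (blinfun_apply (E x \<alpha>) \<xi>) \<eta> = ecoeff x \<xi> \<eta> \<alpha>)"
    unfolding E_def by (rule someI_ex)
  then show "E x \<alpha> \<in> bops" "cinner (blinfun_apply (E x \<alpha>) \<xi>) \<eta> = ecoeff x \<xi> \<eta> \<alpha>"
    by blast+
qed

lemma positive_E: "\<alpha> \<in> sets borel \<Longrightarrow> positive_op (E x \<alpha>)"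
  by (simp add: positive_op_def E_bops cinner_E ecoeff_diag)

lemma E_UNIV: "E x UNIV = id_blinfun"
  by (rule blinfun_cinner_eqI) (simp add: cinner_E ecoeff_UNIV)

text \<open>Uniform in N, since disjointness keeps the diagonal below the total mass
  \<open>(norm z)\<^sup>2\<close>. It provides the majorant for the weak* limit.\<close>

lemma norm_sum_E_le:
  fixes A :: "nat \<Rightarrow> 'a set"
  assumes A: "range A \<subseteq> sets borel" "disjoint_family A"
  shows "cmod (cinner (blinfun_apply (\<Sum>n<N. E x (A n)) \<xi>) \<eta>) \<le> 2 * 1 * norm \<xi> * norm \<eta>"
proof (rule sesquilinear_bound)
  have An: "A n \<in> sets borel" for n
    using A(1) by auto
  show "sesquilinear (\<lambda>\<xi> \<eta>. cinner (blinfun_apply (\<Sum>n<N. E x (A n)) \<xi>) \<eta>)"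
    by (intro sesquilinear_cinner_apply bops_sum E_bops An)
  fix z
  interpret finite_measure "M x z" by (rule finite_M)
  have "cinner (blinfun_apply (\<Sum>n<N. E x (A n)) z) z = of_real (\<Sum>n<N. measure (M x z) (A n))"
    by (simp add: blinfun.sum_left cinner.sum_left cinner_E An ecoeff_diag)
  also have "(\<Sum>n<N. measure (M x z) (A n)) = measure (M x z) (\<Union>n<N. A n)"
    using A An by (intro finite_measure_finite_Union[symmetric])
      (auto simp: disjoint_family_on_def)
  finally show "cmod (cinner (blinfun_apply (\<Sum>n<N. E x (A n)) z) z) \<le> 1 * (norm z)\<^sup>2"
    using finite_measure_mono[of "\<Union>n<N. A n" UNIV] by (simp add: measure_M_UNIV)
qed simp

lemma qpm_E: "qpm (E x)"
  unfolding qpm_def weak_star_tendsto_def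
proof (intro conjI ballI allI impI positive_E E_UNIV)
  fix A :: "nat \<Rightarrow> 'a set" and \<xi> \<eta> :: "nat \<Rightarrow> 'h"
  assume A: "range A \<subseteq> sets borel" "disjoint_family A"
    and sum: "summable (\<lambda>k. (norm (\<xi> k))\<^sup>2)" "summable (\<lambda>k. (norm (\<eta> k))\<^sup>2)"
  have An: "A n \<in> sets borel" for n
    using A(1) by auto
  show "(\<lambda>N. \<Sum>k. cinner (blinfun_apply (\<Sum>n<N. E x (A n)) (\<xi> k)) (\<eta> k)) \<longlonglongrightarrow>
      (\<Sum>k. cinner (blinfun_apply (E x (\<Union>n. A n)) (\<xi> k)) (\<eta> k))"
  \<comment> \<open>Each coefficient converges by countable additivity. Tannery's theorem exchanges
    this limit with the sum over k; the factor 2 of the uniform bound is absorbed by 2 a b \<le> a a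
    + b b.\<close>
  proof (rule tannerys_theorem[THEN conjunct2, THEN conjunct2])
    show "(\<lambda>N. cinner (blinfun_apply (\<Sum>n<N. E x (A n)) (\<xi> k)) (\<eta> k)) \<longlonglongrightarrow>
        cinner (blinfun_apply (E x (\<Union>n. A n)) (\<xi> k)) (\<eta> k)" for k
      using ecoeff_sums[OF A, of x "\<xi> k" "\<eta> k"] An
      by (simp add: sums_def blinfun.sum_left cinner.sum_left cinner_E sets.countable_UN)
    show "summable (\<lambda>k. (norm (\<xi> k))\<^sup>2 + (norm (\<eta> k))\<^sup>2)"
      by (intro summable_add sum)
    have "cmod (cinner (blinfun_apply (\<Sum>n<N. E x (A n)) (\<xi> k)) (\<eta> k)) \<le> (norm (\<xi> k))\<^sup>2 + (norm (\<eta> k))\<^sup>2" for k N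
      using norm_sum_E_le[OF A, of x N "\<xi> k" "\<eta> k"] sum_squares_bound[of "norm (\<xi> k)" "norm (\<eta> k)"]
      by simp
    then show "\<forall>\<^sub>F (k, N) in sequentially \<times>\<^sub>F sequentially.
        cmod (cinner (blinfun_apply (\<Sum>n<N. E x (A n)) (\<xi> k)) (\<eta> k)) \<le> (norm (\<xi> k))\<^sup>2 + (norm (\<eta> k))\<^sup>2"
      by (intro always_eventually) auto
  qed simp
qed

lemma ecoeff_measurable:
  assumes "\<alpha> \<in> sets borel"
  shows "\<forall>\<xi> \<eta>. (\<lambda>x. ecoeff x \<xi> \<eta> \<alpha>) \<in> borel_measurable borel"
  using cpt assms
proof (induction rule: borel_induct_positive_sets)
  case (basic f)
  show ?case
  proof (intro allI)
    fix \<xi> \<eta>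
    show "(\<lambda>x. ecoeff x \<xi> \<eta> {a. 0 < f a}) \<in> borel_measurable borel"
      by (rule borel_measurable_LIMSEQ_metric[OF _ \<Phi>_plateau_tendsto[OF basic]])
         (use \<Phi>_wmfuns[OF plateau_cfuns[OF basic(1)]] in \<open>auto simp: wmfuns_def weakly_measurable_def\<close>)
  qed
next
  case (compl \<beta>)
  then show ?case
    by (auto simp: ecoeff_Compl intro!: borel_measurable_diff)
next
  case (union A)
  show ?case
  proof (intro allI)
    fix \<xi> \<eta>
    have "(\<lambda>x. \<Sum>n<N. ecoeff x \<xi> \<eta> (A n)) \<in> borel_measurable borel" for N
      using union(3) by (intro borel_measurable_sum) blast
    then show "(\<lambda>x. ecoeff x \<xi> \<eta> (\<Union>n. A n)) \<in> borel_measurable borel"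
      by (rule borel_measurable_LIMSEQ_metric) (use ecoeff_sums[OF union(2,1)] in \<open>simp add: sums_def\<close>)
  qed
qed

lemma info_channel_E: "info_channel E"
  using qpm_E ecoeff_measurable by (simp add: info_channel_def weakly_measurable_def cinner_E)

text \<open>The diagonal measures of \<open>E x\<close> are the measures \<open>M x z\<close>, so by
  \<open>integral_M\<close> the operator \<open>\<Phi> f x\<close> has the diagonal that
  characterizes the integral.\<close>

lemma \<Phi>_eq_channel_map:
  assumes f: "f \<in> cfuns"
  shows "\<Phi> f = channel_map E f"
proof
  fix x
  have "diag_measure (E x) z = M x z" for z
  proof (rule measure_eqI)
    show "sets (diag_measure (E x) z) = sets (M x z)"
      by (simp add: sets_diag_measure[OF qpm_E])
    fix \<alpha> assume "\<alpha> \<in> sets (diag_measure (E x) z)"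
    then have \<alpha>: "\<alpha> \<in> sets borel"
      by (simp add: sets_diag_measure[OF qpm_E])
    then show "emeasure (diag_measure (E x) z) \<alpha> = emeasure (M x z) \<alpha>"
      by (simp add: emeasure_diag_measure[OF qpm_E \<alpha>] qpm_coeff_def cinner_E ecoeff_diag
          finite_measure.emeasure_eq_measure[OF finite_M])
  qed
  then have "has_qpm_integral (E x) f (\<Phi> f x)"
    by (intro has_qpm_integralI_diag[OF qpm_E cpt f \<Phi>_bops[OF f]])
       (simp add: integral_M[OF f] form_def)
  then show "\<Phi> f x = channel_map E f x"
    unfolding channel_map_def
    using has_qpm_integral_unique[OF qpm_E cpt f] qpm_map_has_integral[OF qpm_E cpt f] by blast
qed

end

section \<open>Multiplicative maps give spectral measures\<close>

locale multiplicative_map = positive_map +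
  assumes mult: "\<And>f g x. f \<in> cfuns \<Longrightarrow> g \<in> cfuns \<Longrightarrow> \<Phi> (\<lambda>a. f a * g a) x = \<Phi> f x o\<^sub>L \<Phi> g x"
begin

text \<open>Multiplicativity of the spectral measure: first for two sets \<open>{f > 0}\<close>, \<open>{g > 0}\<close> by a
  double limit, then for arbitrary Borel sets in one argument after the other.\<close>

lemma ecoeff_E_positive_sets:
  fixes f g :: "'a \<Rightarrow> real"
  assumes f: "continuous_on UNIV f" "\<And>a. 0 \<le> f a" and g: "continuous_on UNIV g" "\<And>a. 0 \<le> g a"
  shows "ecoeff x (blinfun_apply (E x {a. 0 < g a}) \<xi>) \<eta> {a. 0 < f a} = ecoeff x \<xi> \<eta> ({a. 0 < f a} \<inter> {a. 0 < g a})"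
proof -
  let ?U = "{a. 0 < f a}" and ?V = "{a. 0 < g a}"
  note UV [measurable] = positive_set_borel[OF f(1)] positive_set_borel[OF g(1)]
  note pm [measurable] = plateau_measurable[OF f(1)] plateau_measurable[OF g(1)]
  have le1: "cmod (plateau f k a) * cmod (plateau g l b) \<le> 1" for k l a b
    using plateau_bounds(2)[of f k a] plateau_bounds(2)[of g l b] f(2) g(2) by (intro mult_le_one) auto
  \<comment> \<open>The inner limit, with k fixed: self-adjointness moves \<Phi> of the first
    plateau onto \<eta>, so the second plateau tends to \<open>E x ?V\<close> against fixed vectors.
    On the function side the same sequence converges by domination.\<close>
  have inner: "cinner (blinfun_apply (\<Phi> (plateau f k) x) (blinfun_apply (E x ?V) \<xi>)) \<eta> =
      eint x \<xi> \<eta> (\<lambda>a. plateau f k a * of_real (indicat_real ?V a))" for k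
  proof (rule LIMSEQ_unique)
    have fk: "plateau f k \<in> cfuns"
      by (rule plateau_cfuns[OF f(1)])
    have sa: "cinner (blinfun_apply (\<Phi> (plateau f k) x) u) w = cinner u (blinfun_apply (\<Phi> (plateau f k) x) w)" for u w
      using f(2) by (intro positive_op_selfadjoint pos fk plateau_bounds)
    have "(\<lambda>l. cinner (blinfun_apply (\<Phi> (plateau g l) x) \<xi>) (blinfun_apply (\<Phi> (plateau f k) x) \<eta>)) \<longlonglongrightarrow>
        cinner (blinfun_apply (E x ?V) \<xi>) (blinfun_apply (\<Phi> (plateau f k) x) \<eta>)"
      unfolding cinner_E[OF UV(2)] by (rule \<Phi>_plateau_tendsto[OF g])
    then show "(\<lambda>l. eint x \<xi> \<eta> (\<lambda>a. plateau f k a * plateau g l a)) \<longlonglongrightarrow>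
        cinner (blinfun_apply (\<Phi> (plateau f k) x) (blinfun_apply (E x ?V) \<xi>)) \<eta>"
      by (simp add: eint_cfuns cfuns_intros fk plateau_cfuns[OF g(1)] mult sa)
    show "(\<lambda>l. eint x \<xi> \<eta> (\<lambda>a. plateau f k a * plateau g l a)) \<longlonglongrightarrow>
        eint x \<xi> \<eta> (\<lambda>a. plateau f k a * of_real (indicat_real ?V a))"
      using le1 by (intro eint_tendsto tendsto_mult tendsto_const plateau_tendsto g(2)) (auto simp: norm_mult)
  qed
  show ?thesis
  proof (rule LIMSEQ_unique[OF \<Phi>_plateau_tendsto[OF f]])
    have "(\<lambda>k. eint x \<xi> \<eta> (\<lambda>a. plateau f k a * of_real (indicat_real ?V a))) \<longlonglongrightarrow>
        eint x \<xi> \<eta> (\<lambda>a. of_real (indicat_real ?U a) * of_real (indicat_real ?V a))"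
      by (intro eint_tendsto tendsto_mult tendsto_const plateau_tendsto f(2))
         (auto simp: norm_mult intro!: mult_le_one plateau_bounds f(2))
    also have "(\<lambda>a. complex_of_real (indicat_real ?U a) * of_real (indicat_real ?V a)) =
        (\<lambda>a. of_real (indicat_real (?U \<inter> ?V) a))"
      by (auto simp: indicator_def)
    finally show "(\<lambda>k. cinner (blinfun_apply (\<Phi> (plateau f k) x) (blinfun_apply (E x ?V) \<xi>)) \<eta>) \<longlonglongrightarrow>
        ecoeff x \<xi> \<eta> (?U \<inter> ?V)"
      unfolding inner ecoeff_def .
  qed
qed

lemma ecoeff_Compl_Int:
  assumes "\<alpha> \<in> sets borel" "\<beta> \<in> sets borel"
  shows "ecoeff x \<xi> \<eta> (- \<alpha> \<inter> \<beta>) = ecoeff x \<xi> \<eta> \<beta> - ecoeff x \<xi> \<eta> (\<alpha> \<inter> \<beta>)"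
proof -
  have "- \<alpha> \<inter> \<beta> \<in> sets borel" "\<alpha> \<inter> \<beta> \<in> sets borel"
    using assms borel_comp by auto
  then have "ecoeff x \<xi> \<eta> ((- \<alpha> \<inter> \<beta>) \<union> (\<alpha> \<inter> \<beta>)) = ecoeff x \<xi> \<eta> (- \<alpha> \<inter> \<beta>) + ecoeff x \<xi> \<eta> (\<alpha> \<inter> \<beta>)"
    by (rule ecoeff_Un) auto
  moreover have "(- \<alpha> \<inter> \<beta>) \<union> (\<alpha> \<inter> \<beta>) = \<beta>"
    by auto
  ultimately show ?thesis
    by simp
qed

lemma ecoeff_Int_sums:
  fixes A :: "nat \<Rightarrow> 'a set"
  assumes "range A \<subseteq> sets borel" "disjoint_family A" "\<beta> \<in> sets borel"
  shows "(\<lambda>n. ecoeff x \<xi> \<eta> (A n \<inter> \<beta>)) sums ecoeff x \<xi> \<eta> ((\<Union>n. A n) \<inter> \<beta>)"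
proof -
  have "(\<lambda>n. ecoeff x \<xi> \<eta> (A n \<inter> \<beta>)) sums ecoeff x \<xi> \<eta> (\<Union>n. A n \<inter> \<beta>)"
    using assms by (intro ecoeff_sums) (auto simp: disjoint_family_on_def)
  then show ?thesis
    by simp
qed

lemma ecoeff_E_positive_set:
  fixes g :: "'a \<Rightarrow> real"
  assumes \<alpha>: "\<alpha> \<in> sets borel" and g: "continuous_on UNIV g" "\<And>a. 0 \<le> g a"
  shows "\<forall>\<xi> \<eta>. ecoeff x (blinfun_apply (E x {a. 0 < g a}) \<xi>) \<eta> \<alpha> = ecoeff x \<xi> \<eta> (\<alpha> \<inter> {a. 0 < g a})"
  using cpt \<alpha>
proof (induction rule: borel_induct_positive_sets)
  case (basic f)
  then show ?case
    using ecoeff_E_positive_sets[OF basic g] by blast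
next
  case (compl \<beta>)
  then show ?case
    by (simp add: ecoeff_Compl ecoeff_Compl_Int positive_set_borel[OF g(1)] cinner_E)
next
  case (union A)
  show ?case
  proof (intro allI)
    fix \<xi> \<eta>
    have "(\<lambda>n. ecoeff x \<xi> \<eta> (A n \<inter> {a. 0 < g a})) sums
        ecoeff x (blinfun_apply (E x {a. 0 < g a}) \<xi>) \<eta> (\<Union>n. A n)"
      using ecoeff_sums[OF union(2,1), of x "blinfun_apply (E x {a. 0 < g a}) \<xi>" \<eta>] union(3) by simp
    then show "ecoeff x (blinfun_apply (E x {a. 0 < g a}) \<xi>) \<eta> (\<Union>n. A n) =
        ecoeff x \<xi> \<eta> ((\<Union>n. A n) \<inter> {a. 0 < g a})"
      using ecoeff_Int_sums[OF union(2,1) positive_set_borel[OF g(1)]] by (rule sums_unique2)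
  qed
qed

text \<open>Self-adjointness of \<open>E x \<alpha>\<close> turns
  \<open>ecoeff_E_positive_set\<close> into the base case of an induction in which \<beta> varies
  while \<alpha> is already arbitrary.\<close>

lemma ecoeff_E_right:
  assumes \<alpha>: "\<alpha> \<in> sets borel" and \<beta>: "\<beta> \<in> sets borel"
  shows "\<forall>\<xi> \<eta>. ecoeff x \<xi> (blinfun_apply (E x \<alpha>) \<eta>) \<beta> = ecoeff x \<xi> \<eta> (\<beta> \<inter> \<alpha>)"
  using cpt \<beta>
proof (induction rule: borel_induct_positive_sets)
  case (basic g)
  show ?case
  proof (intro allI)
    fix \<xi> \<eta>
    have "ecoeff x \<xi> (blinfun_apply (E x \<alpha>) \<eta>) {a. 0 < g a} =
        cinner (blinfun_apply (E x {a. 0 < g a}) \<xi>) (blinfun_apply (E x \<alpha>) \<eta>)"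
      by (simp add: cinner_E positive_set_borel[OF basic(1)])
    also have "\<dots> = ecoeff x (blinfun_apply (E x {a. 0 < g a}) \<xi>) \<eta> \<alpha>"
      using positive_op_selfadjoint[OF positive_E[OF \<alpha>]] by (simp add: cinner_E[OF \<alpha>, symmetric])
    also have "\<dots> = ecoeff x \<xi> \<eta> ({a. 0 < g a} \<inter> \<alpha>)"
      using ecoeff_E_positive_set[OF \<alpha> basic] by (simp add: Int_commute)
    finally show "ecoeff x \<xi> (blinfun_apply (E x \<alpha>) \<eta>) {a. 0 < g a} = ecoeff x \<xi> \<eta> ({a. 0 < g a} \<inter> \<alpha>)" .
  qed
next
  case (compl \<gamma>)
  have "cinner \<xi> (blinfun_apply (E x \<alpha>) \<eta>) = ecoeff x \<xi> \<eta> \<alpha>" for \<xi> \<eta>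
    using positive_op_selfadjoint[OF positive_E[OF \<alpha>], of x \<xi> \<eta>] by (simp add: cinner_E[OF \<alpha>])
  with compl show ?case
    by (simp add: ecoeff_Compl ecoeff_Compl_Int \<alpha>)
next
  case (union A)
  show ?case
  proof (intro allI)
    fix \<xi> \<eta>
    have "(\<lambda>n. ecoeff x \<xi> \<eta> (A n \<inter> \<alpha>)) sums ecoeff x \<xi> (blinfun_apply (E x \<alpha>) \<eta>) (\<Union>n. A n)"
      using ecoeff_sums[OF union(2,1), of x \<xi> "blinfun_apply (E x \<alpha>) \<eta>"] union(3) by simp
    then show "ecoeff x \<xi> (blinfun_apply (E x \<alpha>) \<eta>) (\<Union>n. A n) = ecoeff x \<xi> \<eta> ((\<Union>n. A n) \<inter> \<alpha>)"
      using ecoeff_Int_sums[OF union(2,1) \<alpha>] by (rule sums_unique2)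
  qed
qed

text \<open>Idempotence is the product formula \<open>ecoeff_E_right\<close> with both sets equal to
  \<alpha>.\<close>

lemma projection_valued_E: "projection_valued E"
  unfolding projection_valued_def spectral_measure_def projection_op_def
proof (intro allI conjI ballI qpm_E E_bops)
  fix x and \<alpha> :: "'a set" assume \<alpha>: "\<alpha> \<in> sets borel"
  note sa = positive_op_selfadjoint[OF positive_E[OF \<alpha>]]
  show "E x \<alpha> o\<^sub>L E x \<alpha> = E x \<alpha>"
  proof (rule blinfun_cinner_eqI)
    fix \<xi> \<eta>
    have "cinner (blinfun_apply (E x \<alpha> o\<^sub>L E x \<alpha>) \<xi>) \<eta> = cinner (blinfun_apply (E x \<alpha>) \<xi>) (blinfun_apply (E x \<alpha>) \<eta>)"
      using sa[of x "blinfun_apply (E x \<alpha>) \<xi>" \<eta>] by simp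
    then show "cinner (blinfun_apply (E x \<alpha> o\<^sub>L E x \<alpha>) \<xi>) \<eta> = cinner (blinfun_apply (E x \<alpha>) \<xi>) \<eta>"
      using ecoeff_E_right[OF \<alpha> \<alpha>] by (simp add: cinner_E[OF \<alpha>])
  qed
  show "cadjoint (E x \<alpha>) = E x \<alpha>"
    by (intro cadjoint_eqI E_bops \<alpha> sa)
qed

end

section \<open>Positivity of completely positive maps and of *-homomorphisms\<close>

lemma sqrt_cfuns:
  fixes f :: "'a::topological_space \<Rightarrow> complex"
  assumes f: "f \<in> cfuns" and nonneg: "\<And>a. f a \<in> \<real>\<^sub>\<ge>\<^sub>0"
  obtains g where "g \<in> cfuns" "f = (\<lambda>a. cnj (g a) * g a)"
proof
  show "(\<lambda>a. complex_of_real (sqrt (Re (f a)))) \<in> cfuns"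
    using f unfolding cfuns_def by (auto intro!: continuous_intros)
  have "f a = of_real (Re (f a)) \<and> 0 \<le> Re (f a)" for a
    using nonneg[of a] by (auto simp: complex_nonneg_Reals_iff complex_eq_iff)
  then show "f = (\<lambda>a. cnj (complex_of_real (sqrt (Re (f a)))) * complex_of_real (sqrt (Re (f a))))"
    by (metis complex_cnj_complex_of_real of_real_mult real_sqrt_mult_self abs_of_nonneg)
qed

lemma positive_op_adjoint_mult:
  assumes T: "T \<in> bops"
  shows "positive_op (cadjoint T o\<^sub>L T)"
  unfolding positive_op_def
proof (intro conjI allI bops_compose cadjoint_bops T)
  fix z
  have "cinner (blinfun_apply (cadjoint T o\<^sub>L T) z) z = cinner (blinfun_apply T z) (blinfun_apply T z)"
    using cinner_cadjoint[OF T, of z "blinfun_apply T z"]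
      cinner_commute[of "blinfun_apply (cadjoint T) (blinfun_apply T z)" z]
      cinner_commute[of "blinfun_apply T z" "blinfun_apply T z"] by simp
  then show "cinner (blinfun_apply (cadjoint T o\<^sub>L T) z) z \<in> \<real>\<^sub>\<ge>\<^sub>0"
    by (simp add: cinner_self)
qed

text \<open>The case of 1 by 1 matrices: a nonnegative function is cnj g * g for a continuous g, and
  its image is of the form G* G.\<close>

lemma completely_positive_positive:
  assumes cp: "completely_positive \<Phi>" and f: "f \<in> cfuns" "\<And>a. f a \<in> \<real>\<^sub>\<ge>\<^sub>0"
  shows "positive_op (\<Phi> f x)"
proof -
  obtain g where g: "g \<in> cfuns" "f = (\<lambda>a. cnj (g a) * g a)"
    using sqrt_cfuns[OF f] by blast
  have "cfuns_mat_positive 1 (\<lambda>i j. f)"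
    unfolding cfuns_mat_positive_def using g by (intro exI[of _ "\<lambda>i j. g"]) auto
  then have "wmfuns_mat_positive 1 (\<lambda>i j. \<Phi> f)"
    using cp unfolding completely_positive_def by blast
  then obtain G where "G \<in> wmfuns" "\<Phi> f = (\<lambda>x. cadjoint (G x) o\<^sub>L G x)"
    unfolding wmfuns_mat_positive_def by auto
  then show ?thesis
    by (auto simp: wmfuns_def intro: positive_op_adjoint_mult)
qed

lemma star_hom_positive:
  assumes hom: "star_hom \<Phi>" and f: "f \<in> cfuns" "\<And>a. f a \<in> \<real>\<^sub>\<ge>\<^sub>0"
  shows "positive_op (\<Phi> f x)"
proof -
  obtain g where g: "g \<in> cfuns" "f = (\<lambda>a. cnj (g a) * g a)"
    using sqrt_cfuns[OF f] by blast
  have "\<Phi> f x = cadjoint (\<Phi> g x) o\<^sub>L \<Phi> g x"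
    using hom g(1) cfuns_cnj[OF g(1)] unfolding g(2) star_hom_def by simp
  moreover have "\<Phi> g x \<in> bops"
    using hom g(1) by (simp add: star_hom_def clinear_map_def wmfuns_def)
  ultimately show ?thesis
    by (simp add: positive_op_adjoint_mult)
qed

theorem theorem2p4:
  assumes "compact (UNIV :: 'x::{t2_space, second_countable_topology} set)"
    and "compact (UNIV :: 'a::{t2_space, second_countable_topology} set)"
    and "separable_space (euclidean :: 'h::chilbert_space topology)"
  shows "(\<forall>E :: 'x \<Rightarrow> 'a set \<Rightarrow> ('h \<Rightarrow>\<^sub>L 'h). info_channel E \<longrightarrow>
           channel_map_well_defined E \<and> unital_map (channel_map E) \<and>
           completely_positive (channel_map E)) \<and>
        (\<forall>E :: 'x \<Rightarrow> 'a set \<Rightarrow> ('h \<Rightarrow>\<^sub>L 'h). info_channel E \<and> projection_valued E \<longrightarrow>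
           channel_map_well_defined E \<and> unital_map (channel_map E) \<and>
           star_hom (channel_map E)) \<and>
        (\<forall>\<Phi> :: ('a \<Rightarrow> complex) \<Rightarrow> 'x \<Rightarrow> ('h \<Rightarrow>\<^sub>L 'h).
           unital_map \<Phi> \<and> completely_positive \<Phi> \<longrightarrow>
           (\<exists>E :: 'x \<Rightarrow> 'a set \<Rightarrow> ('h \<Rightarrow>\<^sub>L 'h). info_channel E \<and>
              (\<forall>f\<in>cfuns. \<Phi> f = channel_map E f))) \<and>
        (\<forall>\<Phi> :: ('a \<Rightarrow> complex) \<Rightarrow> 'x \<Rightarrow> ('h \<Rightarrow>\<^sub>L 'h).
           unital_map \<Phi> \<and> star_hom \<Phi> \<longrightarrow>
           (\<exists>E :: 'x \<Rightarrow> 'a set \<Rightarrow> ('h \<Rightarrow>\<^sub>L 'h). info_channel E \<and> projection_valued E \<and>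
              (\<forall>f\<in>cfuns. \<Phi> f = channel_map E f)))"
proof (intro conjI allI impI; (elim conjE)?)
  fix E :: "'x \<Rightarrow> 'a set \<Rightarrow> ('h \<Rightarrow>\<^sub>L 'h)" assume E: "info_channel E"
  show "channel_map_well_defined E"
    by (rule channel_map_well_definedI[OF E assms(2)])
  show "unital_map (channel_map E)"
    by (rule unital_channel_map[OF E assms(2)])
  show "completely_positive (channel_map E)"
    by (rule completely_positive_channel_map[OF E assms(2,3)])
next
  fix E :: "'x \<Rightarrow> 'a set \<Rightarrow> ('h \<Rightarrow>\<^sub>L 'h)" assume E: "info_channel E" "projection_valued E"
  show "channel_map_well_defined E"
    by (rule channel_map_well_definedI[OF E(1) assms(2)])
  show "unital_map (channel_map E)"
    by (rule unital_channel_map[OF E(1) assms(2)])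
  show "star_hom (channel_map E)"
    by (rule star_hom_channel_map[OF E assms(2)])
next
  fix \<Phi> :: "('a \<Rightarrow> complex) \<Rightarrow> 'x \<Rightarrow> ('h \<Rightarrow>\<^sub>L 'h)"
  assume u: "unital_map \<Phi>" and cp: "completely_positive \<Phi>"
  interpret positive_map \<Phi>
    using assms(2) u cp completely_positive_positive[OF cp]
    by unfold_locales (auto simp: completely_positive_def)
  show "\<exists>E :: 'x \<Rightarrow> 'a set \<Rightarrow> ('h \<Rightarrow>\<^sub>L 'h). info_channel E \<and> (\<forall>f\<in>cfuns. \<Phi> f = channel_map E f)"
    using info_channel_E \<Phi>_eq_channel_map by blast
next
  fix \<Phi> :: "('a \<Rightarrow> complex) \<Rightarrow> 'x \<Rightarrow> ('h \<Rightarrow>\<^sub>L 'h)"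
  assume u: "unital_map \<Phi>" and hom: "star_hom \<Phi>"
  interpret multiplicative_map \<Phi>
    using assms(2) u hom star_hom_positive[OF hom]
    by unfold_locales (auto simp: star_hom_def)
  show "\<exists>E :: 'x \<Rightarrow> 'a set \<Rightarrow> ('h \<Rightarrow>\<^sub>L 'h). info_channel E \<and> projection_valued E \<and>
      (\<forall>f\<in>cfuns. \<Phi> f = channel_map E f)"
    using info_channel_E projection_valued_E \<Phi>_eq_channel_map by blast
qed

end
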